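(* Let $\gamma>0$ be a constant with $n/N=\gamma$, let $\rho\in(0,1)$ and $\lambda,\mu\ge0$ be constants with $\lambda^2/\gamma\le1$, $\mu^2/\gamma\le1$ and $F(\lambda,\mu,\rho,\gamma)>1+\epsilon$ for some constant $\epsilon>0$. Let $\pi_*$ be the law of a pair $(\mathbb X,\mathbb Y)$ of real random variables with $\mathbb E[\mathbb X]=\mathbb E[\mathbb Y]=0$, $\mathbb E[\mathbb X^2]=\mathbb E[\mathbb Y^2]=1$, $\mathbb E[\mathbb X\mathbb Y]=\rho$ and $\mathbb E[\mathbb X^4],\mathbb E[\mathbb Y^4]\le C$ for an absolute constant $C$. Let $\delta=\delta(\lambda,\mu,\rho,\gamma)\in(0,0.1)$ be a constant with $A_+>(1+\delta)\gamma$, and let $\ell=\ell_n$ satisfy $\ell=O_\delta(\log n)$ and $(1+\delta)^\ell\ge n^2$. Then there is a sufficiently large constant $R=O_{\lambda,\mu,\rho,\gamma}(1)$, satisfying $\mathbb E_{\overline{\mathbb P}}[(\Psi^{\mathcal I}_{u,v})^2]\le R$ and $\mathbb E_{\overline{\mathbb P}}[(\Psi^{\mathcal I}_{u,v})^2x_u^2x_v^2]\le R$ for all distinct $u,v\in[n]$, such that for an arbitrary choice of $w\in[n]$ the estimator $\widehat x\in\mathbb R^n$ given by $$\widehat x_u=\Psi^{\mathcal I}_{w,u}\cdot\mathbf 1_{\{|\Psi^{\mathcal I}_{w,u}|\le R^4\}},\qquad1\le u\le n,$$ satisfies $$\mathbb E_{\overline{\mathbb P}}\Big[\frac{|\langle\widehat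 x,x\rangle|}{\|\widehat x\|\,\|x\|}\Big]\ge\Omega(1)\qquad(n\to\infty).$$
   Context: **The function $F$ and $A_+$.** $F(\lambda,\mu,\rho,\gamma)=\max\Big\{\frac{\lambda^2}{\gamma},\frac{\mu^2}{\gamma},\frac{\lambda^2\rho^2}{\gamma-\lambda^2+\lambda^2\rho^2}+\frac{\mu^2\rho^2}{\gamma-\mu^2+\mu^2\rho^2}\Big\}$ and $A_+=\frac12\Big(\lambda^2+\mu^2+\sqrt{\lambda^4+\mu^4-(2-4\rho^4)\lambda^2\mu^2}\Big)$. (Under the hypotheses of the claim $A_+>\gamma$, so such a $\delta$ exists.) **Model (correlated spiked Wishart).** The pairs $(x_i,y_i)_{1\le i\le n}$ are i.i.d. from $\pi_*$, $x=(x_i)$, $y=(y_i)\in\mathbb R^n$. Independently, $\boldsymbol u,\boldsymbol v\sim\mathcal N(0,\mathbb I_N)$ are independent and $\boldsymbol W,\boldsymbol Z\in\mathbb R^{n\times N}$ are independent with i.i.d. standard normal entries. $\overline{\mathbb P}$ is the (joint) law under which $\boldsymbol X=\frac{\sqrt\lambda}{\sqrt n}x\boldsymbol u^\top+\boldsymbol W$, $\boldsymbol Y=\frac{\sqrt\mu}{\sqrt n}y\boldsymbol v^\top+\boldsymbol Z$. **Decorated bipartite graphs.** A decorated bipartite graph $H$ is a bipartite graph with parts $V^{\mathsf a}(H),V^{\mathsf b}(H)$ and a map $E(H)\to\{\bullet,\circ\}$; $E_\bullet(H),E_\circ(H)$ are the sets of edges with decoration $\bullet,\circ$; $V_\bullet(H),V_\circ(H)$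 are the sets of vertices incident to at least one edge of $E_\bullet(H)$, resp. $E_\circ(H)$; $\mathsf{diff}(H)=V_\bullet(H)\cap V_\circ(H)$; $\mathsf L(H)$ is the set of leaves. Isomorphisms preserve edges, decorations and the two parts; $|\mathsf{Aut}(H)|$ is the number of automorphisms. $\mathsf K_{n,N}$ is the complete bipartite graph with parts $[n]$ (the $\mathsf a$ side) and $[N]$ (the $\mathsf b$ side); edges are written $(i,j)$ with $i\in[n],j\in[N]$; $S\subset\mathsf K_{n,N}$ ranges over decorated subgraphs. **Statistic.** $\mathcal I=\mathcal I(\ell)$ is the collection of isomorphism classes of decorated bipartite paths $H$ of length $2\ell$ (i.e. with $2\ell$ edges) with $\mathsf{diff}(H)\subset V^{\mathsf a}(H)$ and $\mathsf L(H)\subset V_\bullet(H)\cap V^{\mathsf a}(H)$. Set $\Upsilon(H)=\lambda^{|E_\bullet(H)|/2}\mu^{|E_\circ(H)|/2}\rho^{|\mathsf{diff}(H)|}$, $\beta_{\mathcal I}=\sum_{[H]\in\mathcal I}\frac{\Upsilon(H)^2}{|\mathsf{Aut}(H)|}$, $h_S(\boldsymbol X,\boldsymbol Y)=\prod_{(i,j)\in E_\bullet(S)}\boldsymbol X_{i,j}\prod_{(i,j)\in E_\circ(S)}\boldsymbol Y_{i,j}$ and, for $u,v\in[n]$, $$\Psi^{\mathcal I}_{u,v}=\frac1{N^\ell n^{-1}\beta_{\mathcal I}}\sum_{[H]\in\mathcal I}\Upsilon(H)\sum_{\substack{S\subset\mathsf K_{n,N}:\,S\cong H\\ \mathsf L(S)=\{u,v\}}}h_S(\boldsymbol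 X,\boldsymbol Y)$$ (where $u,v$ are vertices of the $\mathsf a$ side; equal to $0$ if $u=v$). The ratio $|\langle\widehat x,x\rangle|/(\|\widehat x\|\|x\|)$ is read as $0$ when its denominator vanishes. *)

theory Defs
  imports "HOL-Probability.Probability"
begin

datatype decoration = Bullet | Circ

text \<open>A decorated bipartite graph. The partial map \<open>deco\<close> encodes the edge set (its domain)
  together with the decoration map on it; an edge is a pair (vertex of part a, vertex of part b).\<close>

record ('a, 'b) dbgraph =
  verts_a :: "'a set"
  verts_b :: "'b set"
  deco :: "'a \<times> 'b \<Rightarrow> decoration option"

definition dbgraph :: "('a, 'b) dbgraph \<Rightarrow> bool" where
  "dbgraph H \<longleftrightarrow> dom (deco H) \<subseteq> verts_a H \<times> verts_b H"

definition edges :: "('a, 'b) dbgraph \<Rightarrow> ('a \<times> 'b) set" where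
  "edges H = dom (deco H)"

definition edges_with :: "decoration \<Rightarrow> ('a, 'b) dbgraph \<Rightarrow> ('a \<times> 'b) set" where
  "edges_with d H = {e. deco H e = Some d}"

text \<open>Vertices of the two sides live in the disjoint sum.\<close>

definition verts :: "('a, 'b) dbgraph \<Rightarrow> ('a + 'b) set" where
  "verts H = Inl ` verts_a H \<union> Inr ` verts_b H"

definition ends :: "'a \<times> 'b \<Rightarrow> ('a + 'b) set" where
  "ends e = {Inl (fst e), Inr (snd e)}"

definition verts_with :: "decoration \<Rightarrow> ('a, 'b) dbgraph \<Rightarrow> ('a + 'b) set" where
  "verts_with d H = {z \<in> verts H. \<exists>e \<in> edges_with d H. z \<in> ends e}"

definition diff_verts :: "('a, 'b) dbgraph \<Rightarrow> ('a + 'b) set" where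
  "diff_verts H = verts_with Bullet H \<inter> verts_with Circ H"

definition leaves :: "('a, 'b) dbgraph \<Rightarrow> ('a + 'b) set" where
  "leaves H = {z \<in> verts H. card {e \<in> edges H. z \<in> ends e} = 1}"

text \<open>\<open>H\<close> is a path with \<open>m\<close> edges: \<open>p\<close> lists all of its vertices in order.\<close>

definition is_path :: "nat \<Rightarrow> ('a, 'b) dbgraph \<Rightarrow> bool" where
  "is_path m H \<longleftrightarrow> (\<exists>p. length p = m + 1 \<and> distinct p \<and> set p = verts H \<and>
     ends ` edges H = {{p ! k, p ! (k + 1)} | k. k < m})"

text \<open>Isomorphisms preserve the two parts, the edges and the decorations; they are pairs of
  bijections, extensional so that they can be counted.\<close>

definition isos :: "('a, 'b) dbgraph \<Rightarrow> ('c, 'd) dbgraph \<Rightarrow> (('a \<Rightarrow> 'c) \<times> ('b \<Rightarrow> 'd)) set" where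
  "isos H H' = {(f, g). f \<in> extensional (verts_a H) \<and> g \<in> extensional (verts_b H) \<and>
     bij_betw f (verts_a H) (verts_a H') \<and> bij_betw g (verts_b H) (verts_b H') \<and>
     (\<forall>i \<in> verts_a H. \<forall>j \<in> verts_b H. deco H' (f i, g j) = deco H (i, j))}"

definition isomorphic :: "('a, 'b) dbgraph \<Rightarrow> ('c, 'd) dbgraph \<Rightarrow> bool" where
  "isomorphic H H' \<longleftrightarrow> isos H H' \<noteq> {}"

definition aut :: "('a, 'b) dbgraph \<Rightarrow> (('a \<Rightarrow> 'a) \<times> ('b \<Rightarrow> 'b)) set" where
  "aut H = isos H H"

definition iso_rel :: "(nat, nat) dbgraph rel" where
  "iso_rel = {(H, H'). dbgraph H \<and> dbgraph H' \<and> isomorphic H H'}"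

definition admissible_paths :: "nat \<Rightarrow> (nat, nat) dbgraph set" where
  "admissible_paths l = {H. dbgraph H \<and> is_path (2 * l) H \<and>
     diff_verts H \<subseteq> Inl ` verts_a H \<and>
     leaves H \<subseteq> verts_with Bullet H \<inter> Inl ` verts_a H}"

text \<open>The collection of isomorphism classes. Every finite graph has a copy with vertices in
  \<^typ>\<open>nat\<close>, so no class is missed.\<close>

definition path_classes :: "nat \<Rightarrow> (nat, nat) dbgraph set set" where
  "path_classes l = admissible_paths l // iso_rel"

text \<open>A representative of a class; only isomorphism-invariant quantities are evaluated at it.\<close>

definition rep :: "(nat, nat) dbgraph set \<Rightarrow> (nat, nat) dbgraph" where
  "rep c = (SOME H. H \<in> c)"

text \<open>The powers of \<open>sqrt\<close> are the half-integer powers; unlike \<open>powr\<close> they satisfy \<open>0 ^ 0 = 1\<close>.\<close>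

definition Upsilon :: "real \<Rightarrow> real \<Rightarrow> real \<Rightarrow> ('a, 'b) dbgraph \<Rightarrow> real" where
  "Upsilon lam mu rho H = sqrt lam ^ card (edges_with Bullet H) *
     sqrt mu ^ card (edges_with Circ H) * rho ^ card (diff_verts H)"

definition beta :: "real \<Rightarrow> real \<Rightarrow> real \<Rightarrow> nat \<Rightarrow> real" where
  "beta lam mu rho l =
     (\<Sum>c\<in>path_classes l. (Upsilon lam mu rho (rep c))\<^sup>2 / real (card (aut (rep c))))"

text \<open>Decorated subgraphs of the complete bipartite graph; \<open>[n]\<close> and \<open>[N]\<close> are indexed from 0.\<close>

definition subgraphs :: "nat \<Rightarrow> nat \<Rightarrow> (nat, nat) dbgraph set" where
  "subgraphs n N = {S. dbgraph S \<and> verts_a S \<subseteq> {..<n} \<and> verts_b S \<subseteq> {..<N}}"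

definition h_mon :: "(nat, nat) dbgraph \<Rightarrow> (nat \<Rightarrow> nat \<Rightarrow> real) \<Rightarrow> (nat \<Rightarrow> nat \<Rightarrow> real) \<Rightarrow> real" where
  "h_mon S X Y = (\<Prod>(i, j)\<in>edges_with Bullet S. X i j) * (\<Prod>(i, j)\<in>edges_with Circ S. Y i j)"

definition Psi :: "real \<Rightarrow> real \<Rightarrow> real \<Rightarrow> nat \<Rightarrow> nat \<Rightarrow> nat \<Rightarrow>
    (nat \<Rightarrow> nat \<Rightarrow> real) \<Rightarrow> (nat \<Rightarrow> nat \<Rightarrow> real) \<Rightarrow> nat \<Rightarrow> nat \<Rightarrow> real" where
  "Psi lam mu rho l n N X Y u v =
     (if u = v then 0 else
       1 / (real N ^ l * inverse (real n) * beta lam mu rho l) *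
       (\<Sum>c\<in>path_classes l. Upsilon lam mu rho (rep c) *
          (\<Sum>S | S \<in> subgraphs n N \<and> isomorphic S (rep c) \<and> leaves S = {Inl u, Inl v}.
             h_mon S X Y)))"

definition xhat :: "real \<Rightarrow> real \<Rightarrow> real \<Rightarrow> nat \<Rightarrow> nat \<Rightarrow> nat \<Rightarrow> real \<Rightarrow>
    (nat \<Rightarrow> nat \<Rightarrow> real) \<Rightarrow> (nat \<Rightarrow> nat \<Rightarrow> real) \<Rightarrow> nat \<Rightarrow> nat \<Rightarrow> real" where
  "xhat lam mu rho l n N R X Y w u =
     (let p = Psi lam mu rho l n N X Y w u in p * (if \<bar>p\<bar> \<le> R ^ 4 then 1 else 0))"

text \<open>\<open>|\<langle>a, b\<rangle>| / (\<parallel>a\<parallel> \<parallel>b\<parallel>)\<close> for vectors indexed by \<open>{..<n}\<close>; division by zero gives 0.\<close>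

definition overlap :: "nat \<Rightarrow> (nat \<Rightarrow> real) \<Rightarrow> (nat \<Rightarrow> real) \<Rightarrow> real" where
  "overlap n a b = \<bar>\<Sum>i<n. a i * b i\<bar> / (L2_set a {..<n} * L2_set b {..<n})"

definition F_fun :: "real \<Rightarrow> real \<Rightarrow> real \<Rightarrow> real \<Rightarrow> real" where
  "F_fun lam mu rho gam = Max {lam\<^sup>2 / gam, mu\<^sup>2 / gam,
     lam\<^sup>2 * rho\<^sup>2 / (gam - lam\<^sup>2 + lam\<^sup>2 * rho\<^sup>2) +
     mu\<^sup>2 * rho\<^sup>2 / (gam - mu\<^sup>2 + mu\<^sup>2 * rho\<^sup>2)}"

definition A_plus :: "real \<Rightarrow> real \<Rightarrow> real \<Rightarrow> real" where
  "A_plus lam mu rho =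
     (lam\<^sup>2 + mu\<^sup>2 + sqrt (lam ^ 4 + mu ^ 4 - (2 - 4 * rho ^ 4) * lam\<^sup>2 * mu\<^sup>2)) / 2"

text \<open>The admissible laws of the pair. Integrability of the fourth moments is explicit because the
  Bochner integral of a non-integrable function is 0; it implies integrability of the lower
  moments.\<close>

definition prior :: "real \<Rightarrow> real \<Rightarrow> (real \<times> real) measure \<Rightarrow> bool" where
  "prior rho C P \<longleftrightarrow> prob_space P \<and> sets P = sets borel \<and>
     (\<integral>p. fst p \<partial>P) = 0 \<and> (\<integral>p. snd p \<partial>P) = 0 \<and>
     (\<integral>p. (fst p)\<^sup>2 \<partial>P) = 1 \<and> (\<integral>p. (snd p)\<^sup>2 \<partial>P) = 1 \<and>
     (\<integral>p. fst p * snd p \<partial>P) = rho \<and>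
     integrable P (\<lambda>p. fst p ^ 4) \<and> (\<integral>p. fst p ^ 4 \<partial>P) \<le> C \<and>
     integrable P (\<lambda>p. snd p ^ 4) \<and> (\<integral>p. snd p ^ 4 \<partial>P) \<le> C"

definition std_normal :: "real measure" where
  "std_normal = density lborel (\<lambda>t. ennreal (std_normal_density t))"

text \<open>The planted law is the law of the independent inputs \<open>(z, (u, v), (W, Z))\<close>, where
  \<open>z i = (x i, y i)\<close>; the observations are functions of them.\<close>

type_synonym sample =
  "(nat \<Rightarrow> real \<times> real) \<times> ((nat \<Rightarrow> real) \<times> (nat \<Rightarrow> real)) \<times> ((nat \<times> nat \<Rightarrow> real) \<times> (nat \<times> nat \<Rightarrow> real))"

definition planted :: "(real \<times> real) measure \<Rightarrow> nat \<Rightarrow> nat \<Rightarrow> sample measure" where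
  "planted P n N =
     (\<Pi>\<^sub>M i\<in>{..<n}. P) \<Otimes>\<^sub>M
     (((\<Pi>\<^sub>M j\<in>{..<N}. std_normal) \<Otimes>\<^sub>M (\<Pi>\<^sub>M j\<in>{..<N}. std_normal)) \<Otimes>\<^sub>M
      ((\<Pi>\<^sub>M e\<in>{..<n} \<times> {..<N}. std_normal) \<Otimes>\<^sub>M (\<Pi>\<^sub>M e\<in>{..<n} \<times> {..<N}. std_normal)))"

definition spike_x :: "sample \<Rightarrow> nat \<Rightarrow> real" where
  "spike_x = (\<lambda>(z, (u, v), (W, Z)) i. fst (z i))"

definition obs_X :: "real \<Rightarrow> nat \<Rightarrow> sample \<Rightarrow> nat \<Rightarrow> nat \<Rightarrow> real" where
  "obs_X lam n = (\<lambda>(z, (u, v), (W, Z)) i j. sqrt lam / sqrt (real n) * fst (z i) * u j + W (i, j))"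

definition obs_Y :: "real \<Rightarrow> nat \<Rightarrow> sample \<Rightarrow> nat \<Rightarrow> nat \<Rightarrow> real" where
  "obs_Y mu n = (\<lambda>(z, (u, v), (W, Z)) i j. sqrt mu / sqrt (real n) * snd (z i) * v j + Z (i, j))"

end

theory Submission
  imports Defs
begin

text \<open>Every isomorphism class of admissible paths is determined by a word in \<open>Bullet\<close>, \<open>Circ\<close> up to reversal, so
  \<open>Psi u v\<close> is \<open>n / (N ^ l * beta)\<close> times a weighted sum over self-avoiding paths from \<open>u\<close> to \<open>v\<close>.

  In the product of the monomials of two paths S and T every factor is expanded into its signal and its noise part.
  Only those terms survive in which the noise is taken at a set of edges shared by S and T. For fixed S, the path T is
  explored step by step. Relative to the weight of S, a step away from S grows like a transfer matrix with
  leading eigenvalue \<open>A_plus\<close>, a step that follows S through shared noise edges costs \<open>gam < A_plus\<close>, and each return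
  to S costs \<open>1 / n\<close>. A potential function for this walk bounds the sum over T by a multiple of \<open>A_plus ^ l / n\<close>,
  where \<open>(1 + \<delta>) ^ l \<ge> n\<^sup>2\<close> absorbs the pairs with T = S. Since \<open>beta\<close> is at least a multiple of \<open>A_plus ^ l\<close>,
  both second moments are bounded, while the correlation of \<open>Psi w u\<close> with \<open>x w * x u\<close> is at least 1/2 for large n.

  The correlation survives the truncation at \<open>R ^ 4\<close>, and the truncation bounds the norm of the estimator by
  \<open>R ^ 4 * sqrt n\<close>. The remaining random denominator is removed by \<open>1 / t \<ge> 2 * s - s\<^sup>2 * t\<close>
  with \<open>t = \<bar>x w\<bar> * norm x\<close> and s of order \<open>1 / sqrt n\<close>.\<close>

section \<open>Moments of products of observations\<close>

text \<open>The second moment is a quadratic form in the path weights. It is estimated by a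
  Schur-type row bound: for every S, the weights of all T times the absolute pair expectations add
  up to at most a common multiple of the weight of S, so no cancellation between pairs is exploited.
  The obstacle is combinatorial: T may leave and rejoin S many times, at any positions and in either
  direction. Instead of classifying these overlaps, the walk forgets its past. Its state keeps only
  the last step and two noise flags, and only local traces of self-avoidance survive. The local
  weights must then be sharp in two places only: off S, where the growth per step has to be the
  eigenvalue \<open>A_plus\<close>, and along shared noise edges, where it has to be
  \<open>gam\<close> with no extra constant. Everywhere else crude constants are harmless, since
  meeting S costs a factor of order \<open>l / n\<close>, and \<open>l = O(log n)\<close> keeps
  \<open>(1 + O(l / n)) ^ l\<close> bounded. The same 2 by 2 transfer matrix produces the lower
  bound for \<open>beta\<close>, so numerator and normalisation grow at the same rate.\<close>

definition coord :: "decoration \<Rightarrow> real \<times> real \<Rightarrow> real" where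
  "coord d p = (case d of Bullet \<Rightarrow> fst p | Circ \<Rightarrow> snd p)"

definition normal_moment :: "nat \<Rightarrow> real" where
  "normal_moment r = (\<integral>x. x ^ r \<partial>std_normal)"

lemma prob_space_std_normal: "prob_space std_normal"
  unfolding std_normal_def by (rule prob_space_normal_density) simp

lemma sets_std_normal [measurable_cong, simp]: "sets std_normal = sets borel"
  by (simp add: std_normal_def)

lemma integrable_std_normal_power: "integrable std_normal (\<lambda>x. x ^ r)"
  unfolding std_normal_def using integrable_std_normal_moment[of r]
  by (subst integrable_density) (auto simp: normal_density_nonneg)

lemma normal_moment_eq: "normal_moment r = (\<integral>x. std_normal_density x * x ^ r \<partial>lborel)"
  unfolding normal_moment_def std_normal_def
  by (subst integral_density) (auto simp: normal_density_nonneg)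

lemma normal_moment_simps [simp]:
  "normal_moment 0 = 1" "normal_moment (Suc 0) = 0" "normal_moment 2 = 1"
  "normal_moment 3 = 0" "normal_moment 4 = 3"
  using integral_std_normal_moment_even[of 0] integral_std_normal_moment_even[of 1]
    integral_std_normal_moment_even[of 2] integral_std_normal_moment_odd[of 1]
    integral_std_normal_moment_odd[of 0]
  by (auto simp: normal_moment_eq fact_numeral)

lemma abs_normal_moment_le_1: "r \<le> 2 \<Longrightarrow> \<bar>normal_moment r\<bar> \<le> 1"
proof -
  assume "r \<le> 2"
  then have "r = 0 \<or> r = Suc 0 \<or> r = 2" by linarith
  then show ?thesis by auto
qed

lemma abs_normal_moment_le_3: "r \<le> 4 \<Longrightarrow> \<bar>normal_moment r\<bar> \<le> 3"
proof -
  assume "r \<le> 4"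
  then have "r = 0 \<or> r = Suc 0 \<or> r = 2 \<or> r = 3 \<or> r = 4" by linarith
  then show ?thesis by auto
qed

lemma integrable_pair_mult:
  fixes f :: "'a \<Rightarrow> real" and g :: "'b \<Rightarrow> real"
  assumes "prob_space M1" "prob_space M2" and f: "integrable M1 f" and g: "integrable M2 g"
  shows "integrable (M1 \<Otimes>\<^sub>M M2) (\<lambda>(x, y). f x * g y)"
    and "(\<integral>z. (case z of (x, y) \<Rightarrow> f x * g y) \<partial>(M1 \<Otimes>\<^sub>M M2)) = (\<integral>x. f x \<partial>M1) * (\<integral>y. g y \<partial>M2)"
proof -
  interpret M1: prob_space M1 by fact
  interpret M2: prob_space M2 by fact
  interpret pair_sigma_finite M1 M2 ..
  note [measurable] = borel_measurable_integrable[OF f] borel_measurable_integrable[OF g]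
  show int: "integrable (M1 \<Otimes>\<^sub>M M2) (\<lambda>(x, y). f x * g y)"
    by (rule Fubini_integrable) (use f g in \<open>auto simp: abs_mult\<close>)
  show "(\<integral>z. (case z of (x, y) \<Rightarrow> f x * g y) \<partial>(M1 \<Otimes>\<^sub>M M2)) = (\<integral>x. f x \<partial>M1) * (\<integral>y. g y \<partial>M2)"
    using integral_fst'[OF int] by simp
qed

lemma prob_space_pair:
  assumes "prob_space M1" "prob_space M2"
  shows "prob_space (M1 \<Otimes>\<^sub>M M2)"
proof -
  interpret M1: prob_space M1 by fact
  interpret M2: prob_space M2 by fact
  interpret pair_prob_space M1 M2 ..
  show ?thesis by (rule P.prob_space_axioms)
qed

lemma integrable_planted_prod:
  fixes f1 :: "(nat \<Rightarrow> real \<times> real) \<Rightarrow> real"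
  assumes "prob_space P"
    and "integrable (\<Pi>\<^sub>M i\<in>{..<n}. P) f1"
    and "integrable (\<Pi>\<^sub>M j\<in>{..<N}. std_normal) f2" "integrable (\<Pi>\<^sub>M j\<in>{..<N}. std_normal) f3"
    and "integrable (\<Pi>\<^sub>M e\<in>{..<n}\<times>{..<N}. std_normal) f4" "integrable (\<Pi>\<^sub>M e\<in>{..<n}\<times>{..<N}. std_normal) f5"
  shows "integrable (planted P n N) (\<lambda>(z, (u, v), (W, Z)). f1 z * ((f2 u * f3 v) * (f4 W * f5 Z)))"
    and "integral\<^sup>L (planted P n N) (\<lambda>(z, (u, v), (W, Z)). f1 z * ((f2 u * f3 v) * (f4 W * f5 Z)))
      = (\<integral>z. f1 z \<partial>(\<Pi>\<^sub>M i\<in>{..<n}. P)) *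
        (((\<integral>u. f2 u \<partial>(\<Pi>\<^sub>M j\<in>{..<N}. std_normal)) * (\<integral>v. f3 v \<partial>(\<Pi>\<^sub>M j\<in>{..<N}. std_normal))) *
         ((\<integral>W. f4 W \<partial>(\<Pi>\<^sub>M e\<in>{..<n}\<times>{..<N}. std_normal)) * (\<integral>Z. f5 Z \<partial>(\<Pi>\<^sub>M e\<in>{..<n}\<times>{..<N}. std_normal))))"
proof -
  note prob = prob_space_PiM[OF prob_space_std_normal] prob_space_PiM[OF assms(1)]
  note p2 = prob_space_pair
  note i1 = integrable_pair_mult[OF prob(1) prob(1) assms(3,4)]
  note i2 = integrable_pair_mult[OF prob(1) prob(1) assms(5,6)]
  note i3 = integrable_pair_mult[OF p2[OF prob(1) prob(1)] p2[OF prob(1) prob(1)] i1(1) i2(1)]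
  note i4 = integrable_pair_mult[OF prob(2) p2[OF p2[OF prob(1) prob(1)] p2[OF prob(1) prob(1)]] assms(2) i3(1)]
  show "integrable (planted P n N) (\<lambda>(z, (u, v), (W, Z)). f1 z * ((f2 u * f3 v) * (f4 W * f5 Z)))"
    using i4(1) unfolding planted_def by (simp add: case_prod_unfold)
  show "integral\<^sup>L (planted P n N) (\<lambda>(z, (u, v), (W, Z)). f1 z * ((f2 u * f3 v) * (f4 W * f5 Z)))
      = (\<integral>z. f1 z \<partial>(\<Pi>\<^sub>M i\<in>{..<n}. P)) *
        (((\<integral>u. f2 u \<partial>(\<Pi>\<^sub>M j\<in>{..<N}. std_normal)) * (\<integral>v. f3 v \<partial>(\<Pi>\<^sub>M j\<in>{..<N}. std_normal))) *
         ((\<integral>W. f4 W \<partial>(\<Pi>\<^sub>M e\<in>{..<n}\<times>{..<N}. std_normal)) * (\<integral>Z. f5 Z \<partial>(\<Pi>\<^sub>M e\<in>{..<n}\<times>{..<N}. std_normal))))"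
    using i4(2) i3(2) i1(2) i2(2) unfolding planted_def by (simp add: case_prod_unfold)
qed

lemma integrable_PiM_prod:
  fixes f :: "'i \<Rightarrow> 'a \<Rightarrow> real"
  assumes "prob_space Q" "finite I" "\<And>i. i \<in> I \<Longrightarrow> integrable Q (f i)"
  shows "integrable (\<Pi>\<^sub>M i\<in>I. Q) (\<lambda>x. \<Prod>i\<in>I. f i (x i))"
    and "(\<integral>x. (\<Prod>i\<in>I. f i (x i)) \<partial>(\<Pi>\<^sub>M i\<in>I. Q)) = (\<Prod>i\<in>I. \<integral>p. f i p \<partial>Q)"
proof -
  interpret Q: prob_space Q by fact
  interpret product_sigma_finite "\<lambda>_. Q" ..
  show "integrable (\<Pi>\<^sub>M i\<in>I. Q) (\<lambda>x. \<Prod>i\<in>I. f i (x i))"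
    by (rule product_integrable_prod) (use assms in auto)
  show "(\<integral>x. (\<Prod>i\<in>I. f i (x i)) \<partial>(\<Pi>\<^sub>M i\<in>I. Q)) = (\<Prod>i\<in>I. \<integral>p. f i p \<partial>Q)"
    by (rule product_integral_prod) (use assms in auto)
qed

lemma integrable_PiM_normal:
  assumes "finite K" "finite I" "c ` K \<subseteq> I"
  shows "integrable (\<Pi>\<^sub>M i\<in>I. std_normal) (\<lambda>x. \<Prod>k\<in>K. x (c k))"
    and "(\<integral>x. (\<Prod>k\<in>K. x (c k)) \<partial>(\<Pi>\<^sub>M i\<in>I. std_normal)) = (\<Prod>i\<in>I. normal_moment (card {k \<in> K. c k = i}))"
proof -
  have eq: "(\<Prod>k\<in>K. x (c k)) = (\<Prod>i\<in>I. x i ^ card {k \<in> K. c k = i})" for x :: "'b \<Rightarrow> real"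
  proof -
    have "(\<Prod>k\<in>K. x (c k)) = (\<Prod>i\<in>I. \<Prod>k\<in>{k \<in> K. c k = i}. x (c k))"
      by (rule prod.group[symmetric]) (use assms in auto)
    also have "\<dots> = (\<Prod>i\<in>I. \<Prod>k\<in>{k \<in> K. c k = i}. x i)"
      by (intro prod.cong) auto
    finally show ?thesis by simp
  qed
  show "integrable (\<Pi>\<^sub>M i\<in>I. std_normal) (\<lambda>x. \<Prod>k\<in>K. x (c k))"
    unfolding eq by (rule integrable_PiM_prod) (use assms in \<open>auto intro: prob_space_std_normal integrable_std_normal_power\<close>)
  show "(\<integral>x. (\<Prod>k\<in>K. x (c k)) \<partial>(\<Pi>\<^sub>M i\<in>I. std_normal)) = (\<Prod>i\<in>I. normal_moment (card {k \<in> K. c k = i}))"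
    unfolding eq normal_moment_def
    by (rule integrable_PiM_prod) (use assms in \<open>auto intro: prob_space_std_normal integrable_std_normal_power\<close>)
qed

lemma priorD:
  assumes "prior rho C P"
  shows "prob_space P" "sets P = sets borel" "(\<integral>p. fst p \<partial>P) = 0" "(\<integral>p. snd p \<partial>P) = 0"
    "(\<integral>p. (fst p)\<^sup>2 \<partial>P) = 1" "(\<integral>p. (snd p)\<^sup>2 \<partial>P) = 1" "(\<integral>p. fst p * snd p \<partial>P) = rho"
    "integrable P (\<lambda>p. fst p ^ 4)" "(\<integral>p. fst p ^ 4 \<partial>P) \<le> C"
    "integrable P (\<lambda>p. snd p ^ 4)" "(\<integral>p. snd p ^ 4 \<partial>P) \<le> C"
  using assms by (auto simp: prior_def)

lemma coord_measurable [measurable]: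
  "sets P = sets borel \<Longrightarrow> coord d \<in> borel_measurable P"
proof -
  assume s: "sets P = sets borel"
  have "coord d \<in> borel_measurable (borel :: (real \<times> real) measure)"
    by (cases d) (auto simp: coord_def[abs_def] borel_prod[symmetric])
  then show ?thesis using s by (simp cong: measurable_cong_sets)
qed

text \<open>Four is the largest degree that occurs: two paths give an interior a-vertex at most two
  edges each, and an endpoint gets one edge from each path plus at most two powers of the spike.
  Such a monomial is at most the fourth power of the maximum of 1 and the two absolute coordinates,
  hence at most \<open>1 + x ^ 4 + y ^ 4\<close>.\<close>

lemma prior_moment:
  assumes pr: "prior rho C P" and fin: "finite K" and deg: "card K + m \<le> 4"
  shows "integrable P (\<lambda>p. (\<Prod>k\<in>K. coord (dd k) p) * fst p ^ m)"
    and "\<bar>\<integral>p. (\<Prod>k\<in>K. coord (dd k) p) * fst p ^ m \<partial>P\<bar> \<le> 1 + 2 * \<bar>C\<bar>"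
proof -
  note D = priorD[OF pr]
  interpret prob_space P by (rule D)
  define f where "f = (\<lambda>p. (\<Prod>k\<in>K. coord (dd k) p) * fst p ^ m)"
  define g :: "real \<times> real \<Rightarrow> real" where "g = (\<lambda>p. 1 + fst p ^ 4 + snd p ^ 4)"
  have fst_m [measurable]: "fst \<in> borel_measurable P"
    using coord_measurable[OF D(2), of Bullet] by (simp add: coord_def[abs_def])
  note [measurable] = coord_measurable[OF D(2)]
  have m: "f \<in> borel_measurable P" unfolding f_def by measurable
  have bd: "\<bar>f p\<bar> \<le> g p" for p
  proof -
    define M where "M = max 1 (max \<bar>fst p\<bar> \<bar>snd p\<bar>)"
    have M1: "1 \<le> M" "\<bar>fst p\<bar> \<le> M" "\<bar>snd p\<bar> \<le> M" by (auto simp: M_def)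
    have c: "\<bar>coord d p\<bar> \<le> M" for d using M1 by (cases d) (auto simp: coord_def)
    have "\<bar>f p\<bar> = (\<Prod>k\<in>K. \<bar>coord (dd k) p\<bar>) * \<bar>fst p\<bar> ^ m"
      by (simp add: f_def abs_mult abs_prod power_abs)
    also have "\<dots> \<le> (\<Prod>k\<in>K. M) * M ^ m"
      by (intro mult_mono prod_mono power_mono prod_nonneg) (use c M1 in auto)
    also have "\<dots> = M ^ (card K + m)" by (simp add: power_add)
    also have "\<dots> \<le> M ^ 4" by (rule power_increasing[OF deg M1(1)])
    also have "\<dots> \<le> g p" by (auto simp: M_def g_def max_def)
    finally show ?thesis .
  qed
  have gi: "integrable P g" unfolding g_def using D by auto
  show i: "integrable P (\<lambda>p. (\<Prod>k\<in>K. coord (dd k) p) * fst p ^ m)"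
    using Bochner_Integration.integrable_bound[OF gi m] bd unfolding f_def
    by (metis (mono_tags, lifting) AE_I2 abs_of_nonneg abs_ge_zero order_trans real_norm_def)
  have "\<bar>\<integral>p. f p \<partial>P\<bar> \<le> (\<integral>p. \<bar>f p\<bar> \<partial>P)" by (rule integral_abs_bound)
  also have "\<dots> \<le> (\<integral>p. g p \<partial>P)"
    by (rule integral_mono) (use i gi bd in \<open>auto simp: f_def\<close>)
  also have "\<dots> = 1 + (\<integral>p. fst p ^ 4 \<partial>P) + (\<integral>p. snd p ^ 4 \<partial>P)"
    unfolding g_def using D by (simp add: prob_space)
  also have "\<dots> \<le> 1 + 2 * \<bar>C\<bar>" using D(9,11) by linarith
  finally show "\<bar>\<integral>p. (\<Prod>k\<in>K. coord (dd k) p) * fst p ^ m \<partial>P\<bar> \<le> 1 + 2 * \<bar>C\<bar>" unfolding f_def .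
qed

text \<open>The source of the factor \<open>rho\<close> at every change of decoration: an interior
  a-vertex of a single path carries exactly two signal factors.\<close>

lemma prior_second_moment:
  assumes "prior rho C P"
  shows "(\<integral>p. coord d p * coord d' p \<partial>P) = (if d = d' then 1 else rho)"
  using priorD(5,6,7)[OF assms] by (cases d; cases d') (auto simp: coord_def power2_eq_square mult.commute)


section \<open>Splitting each observation into signal and noise\<close>

definition amp :: "real \<Rightarrow> real \<Rightarrow> nat \<Rightarrow> decoration \<Rightarrow> real" where
  "amp lam mu n d = (case d of Bullet \<Rightarrow> sqrt lam | Circ \<Rightarrow> sqrt mu) / sqrt (real n)"

definition obs :: "real \<Rightarrow> real \<Rightarrow> nat \<Rightarrow> sample \<Rightarrow> decoration \<Rightarrow> nat \<Rightarrow> nat \<Rightarrow> real" where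
  "obs lam mu n \<omega> d = (case d of Bullet \<Rightarrow> obs_X lam n \<omega> | Circ \<Rightarrow> obs_Y mu n \<omega>)"

lemma prod_case_decoration:
  assumes "finite A"
  shows "(\<Prod>k\<in>A. case dd k of Bullet \<Rightarrow> f k | Circ \<Rightarrow> g k) =
    (\<Prod>k\<in>{k \<in> A. dd k = Bullet}. f k) * (\<Prod>k\<in>{k \<in> A. dd k = Circ}. g k :: real)"
proof -
  have "(\<Prod>k\<in>A. case dd k of Bullet \<Rightarrow> f k | Circ \<Rightarrow> g k) = (\<Prod>k\<in>A. if dd k = Bullet then f k else g k)"
    by (intro prod.cong) (auto split: decoration.splits)
  also have "\<dots> = (\<Prod>k\<in>{k \<in> A. dd k = Bullet}. f k) * (\<Prod>k\<in>{k \<in> A. dd k \<noteq> Bullet}. g k)"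
    using assms by (subst prod.If_cases) (auto simp: Int_def Collect_neg_eq conj_commute)
  also have "{k \<in> A. dd k \<noteq> Bullet} = {k \<in> A. dd k = Circ}"
    by (metis decoration.exhaust decoration.distinct(1))
  finally show ?thesis .
qed

text \<open>The part of the expectation in which the noise term is chosen exactly for the factors in \<open>B\<close>.\<close>

definition obs_term where
  "obs_term lam mu n N P dd ii jj gg K G B =
     (\<Prod>k\<in>K - B. amp lam mu n (dd k)) *
     (\<Prod>i<n. \<integral>p. (\<Prod>k\<in>{k \<in> K - B. ii k = i}. coord (dd k) p) * fst p ^ card {k \<in> G. gg k = i} \<partial>P) *
     ((\<Prod>j<N. normal_moment (card {k \<in> K - B. dd k = Bullet \<and> jj k = j})) *
      (\<Prod>j<N. normal_moment (card {k \<in> K - B. dd k = Circ \<and> jj k = j}))) *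
     ((\<Prod>e\<in>{..<n} \<times> {..<N}. normal_moment (card {k \<in> B. dd k = Bullet \<and> (ii k, jj k) = e})) *
      (\<Prod>e\<in>{..<n} \<times> {..<N}. normal_moment (card {k \<in> B. dd k = Circ \<and> (ii k, jj k) = e})))"

text \<open>Multiplying out gives one summand for each set \<open>B\<close> of factors at which the
  noise is taken. For fixed \<open>B\<close> the summand is a product of functions of the
  independent blocks z, u, v, W and Z, so its expectation factorises over rows, columns and entries.
  The index types are abstract because the lemma serves pairs of paths, single paths and, with
  \<open>K\<close> empty, powers of the spike alone; \<open>G\<close> lists the additional spike
  factors.\<close>

lemma obs_expectation:
  fixes K :: "'k set" and G :: "'g set" and ii jj :: "'k \<Rightarrow> nat" and gg :: "'g \<Rightarrow> nat"
    and dd :: "'k \<Rightarrow> decoration" and lam mu :: real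
  assumes pr: "prior rho C P" and fK: "finite K" and fG: "finite G"
    and ii: "ii ` K \<subseteq> {..<n}" and jj: "jj ` K \<subseteq> {..<N}" and gg: "gg ` G \<subseteq> {..<n}"
    and deg: "\<And>i. i < n \<Longrightarrow> card {k \<in> K. ii k = i} + card {k \<in> G. gg k = i} \<le> 4"
  defines "F \<equiv> (\<lambda>\<omega>. (\<Prod>k\<in>K. obs lam mu n \<omega> (dd k) (ii k) (jj k)) * (\<Prod>k\<in>G. spike_x \<omega> (gg k)))"
  shows "integrable (planted P n N) F"
    and "(\<integral>\<omega>. F \<omega> \<partial>planted P n N) = (\<Sum>B\<in>Pow K. obs_term lam mu n N P dd ii jj gg K G B)"
proof -
  define T :: "'k set \<Rightarrow> sample \<Rightarrow> real" where "T B = (\<lambda>(z, (u, v), (W, Z)).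
      ((\<Prod>k\<in>K - B. amp lam mu n (dd k)) *
       (\<Prod>i<n. (\<Prod>k\<in>{k \<in> K - B. ii k = i}. coord (dd k) (z i)) * fst (z i) ^ card {k \<in> G. gg k = i})) *
      (((\<Prod>k\<in>{k \<in> K - B. dd k = Bullet}. u (jj k)) * (\<Prod>k\<in>{k \<in> K - B. dd k = Circ}. v (jj k))) *
       ((\<Prod>k\<in>{k \<in> B. dd k = Bullet}. W (ii k, jj k)) * (\<Prod>k\<in>{k \<in> B. dd k = Circ}. Z (ii k, jj k)))))" for B
  have eq: "F \<omega> = (\<Sum>B\<in>Pow K. T B \<omega>)" for \<omega>
  proof -
    obtain z u v W Z where \<omega>: "\<omega> = (z, (u, v), (W, Z))" by (metis prod.exhaust)
    have G: "(\<Prod>k\<in>G. fst (z (gg k))) = (\<Prod>i<n. fst (z i) ^ card {k \<in> G. gg k = i})"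
    proof -
      have "(\<Prod>k\<in>G. fst (z (gg k))) = (\<Prod>i<n. \<Prod>k\<in>{k \<in> G. gg k = i}. fst (z (gg k)))"
        by (rule prod.group[symmetric]) (use fG gg in auto)
      also have "\<dots> = (\<Prod>i<n. \<Prod>k\<in>{k \<in> G. gg k = i}. fst (z i))"
        by (intro prod.cong) auto
      finally show ?thesis by simp
    qed
    have "(\<Prod>k\<in>K. obs lam mu n \<omega> (dd k) (ii k) (jj k)) =
       (\<Prod>k\<in>K. (case dd k of Bullet \<Rightarrow> W (ii k, jj k) | Circ \<Rightarrow> Z (ii k, jj k)) +
         amp lam mu n (dd k) * coord (dd k) (z (ii k)) * (case dd k of Bullet \<Rightarrow> u (jj k) | Circ \<Rightarrow> v (jj k)))"
      by (intro prod.cong)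
        (auto simp: \<omega> obs_def obs_X_def obs_Y_def amp_def coord_def split: decoration.splits)
    also have "\<dots> = (\<Sum>B\<in>Pow K. (\<Prod>k\<in>B. case dd k of Bullet \<Rightarrow> W (ii k, jj k) | Circ \<Rightarrow> Z (ii k, jj k)) *
        (\<Prod>k\<in>K - B. amp lam mu n (dd k) * coord (dd k) (z (ii k)) * (case dd k of Bullet \<Rightarrow> u (jj k) | Circ \<Rightarrow> v (jj k))))"
      using fK by (rule prod_add)
    finally have 1: "F \<omega> = (\<Sum>B\<in>Pow K. (\<Prod>k\<in>B. case dd k of Bullet \<Rightarrow> W (ii k, jj k) | Circ \<Rightarrow> Z (ii k, jj k)) *
        (\<Prod>k\<in>K - B. amp lam mu n (dd k) * coord (dd k) (z (ii k)) * (case dd k of Bullet \<Rightarrow> u (jj k) | Circ \<Rightarrow> v (jj k))) *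
        (\<Prod>k\<in>G. fst (z (gg k))))"
      by (simp add: F_def sum_distrib_right spike_x_def \<omega>)
    show ?thesis unfolding 1
    proof (rule sum.cong[OF refl])
      fix B assume "B \<in> Pow K"
      then have fB: "finite B" "finite (K - B)" using fK by (auto intro: finite_subset)
      have "(\<Prod>k\<in>K - B. coord (dd k) (z (ii k))) = (\<Prod>i<n. \<Prod>k\<in>{k \<in> K - B. ii k = i}. coord (dd k) (z (ii k)))"
        by (rule prod.group[symmetric]) (use fB ii in auto)
      also have "\<dots> = (\<Prod>i<n. \<Prod>k\<in>{k \<in> K - B. ii k = i}. coord (dd k) (z i))"
        by (intro prod.cong) auto
      finally show "(\<Prod>k\<in>B. case dd k of Bullet \<Rightarrow> W (ii k, jj k) | Circ \<Rightarrow> Z (ii k, jj k)) *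
        (\<Prod>k\<in>K - B. amp lam mu n (dd k) * coord (dd k) (z (ii k)) * (case dd k of Bullet \<Rightarrow> u (jj k) | Circ \<Rightarrow> v (jj k))) *
        (\<Prod>k\<in>G. fst (z (gg k))) = T B \<omega>"
        by (simp add: T_def \<omega> G prod.distrib prod_case_decoration[OF fB(1)] prod_case_decoration[OF fB(2)])
    qed
  qed
  have TB: "integrable (planted P n N) (T B)"
    "(\<integral>\<omega>. T B \<omega> \<partial>planted P n N) = obs_term lam mu n N P dd ii jj gg K G B" if "B \<subseteq> K" for B
  proof -
    have fB: "finite B" "finite (K - B)" using fK that by (auto intro: finite_subset)
    have mom: "integrable P (\<lambda>p. (\<Prod>k\<in>{k \<in> K - B. ii k = i}. coord (dd k) p) * fst p ^ card {k \<in> G. gg k = i})"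
      if "i \<in> {..<n}" for i
    proof (rule prior_moment(1)[OF pr])
      have "card {k \<in> K - B. ii k = i} \<le> card {k \<in> K. ii k = i}"
        by (rule card_mono) (use fK in auto)
      then show "card {k \<in> K - B. ii k = i} + card {k \<in> G. gg k = i} \<le> 4"
        using deg[of i] that by simp
    qed (use fB in auto)
    note pP = priorD(1)[OF pr]
    note z = integrable_PiM_prod[where f = "\<lambda>i p. (\<Prod>k\<in>{k \<in> K - B. ii k = i}. coord (dd k) p) * fst p ^ card {k \<in> G. gg k = i}",
        OF pP finite_lessThan mom]
    have z2: "(\<integral>z. (\<Prod>i<n. (\<Prod>k\<in>{k \<in> K - B. ii k = i}. coord (dd k) (z i)) * fst (z i) ^ card {k \<in> G. gg k = i}) \<partial>(\<Pi>\<^sub>M i\<in>{..<n}. P))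
      = (\<Prod>i<n. \<integral>p. (\<Prod>k\<in>{k \<in> K - B. ii k = i}. coord (dd k) p) * fst p ^ card {k \<in> G. gg k = i} \<partial>P)"
      by (rule z(2))
    have sub: "jj ` {k \<in> K - B. dd k = d} \<subseteq> {..<N}" "(\<lambda>k. (ii k, jj k)) ` {k \<in> B. dd k = d} \<subseteq> {..<n} \<times> {..<N}" for d
      using ii jj that by (auto simp: image_subset_iff)
    have fin: "finite {k \<in> K - B. dd k = d}" "finite {k \<in> B. dd k = d}" for d
      using fB by auto
    note u = integrable_PiM_normal[OF fin(1)[of Bullet] finite_lessThan sub(1)]
    note v = integrable_PiM_normal[OF fin(1)[of Circ] finite_lessThan sub(1)]
    note W = integrable_PiM_normal[OF fin(2)[of Bullet] _ sub(2), OF finite_cartesian_product[OF finite_lessThan finite_lessThan]]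
    note Z = integrable_PiM_normal[OF fin(2)[of Circ] _ sub(2), OF finite_cartesian_product[OF finite_lessThan finite_lessThan]]
    have "integrable (\<Pi>\<^sub>M i\<in>{..<n}. P) (\<lambda>z. (\<Prod>k\<in>K - B. amp lam mu n (dd k)) *
       (\<Prod>i<n. (\<Prod>k\<in>{k \<in> K - B. ii k = i}. coord (dd k) (z i)) * fst (z i) ^ card {k \<in> G. gg k = i}))"
      by (intro integrable_mult_right z(1)) auto
    note all = integrable_planted_prod[OF pP this u(1) v(1) W(1) Z(1)]
    show "integrable (planted P n N) (T B)"
      unfolding T_def by (rule all(1))
    have "(\<integral>\<omega>. T B \<omega> \<partial>planted P n N) =
       ((\<Prod>k\<in>K - B. amp lam mu n (dd k)) *
       (\<Prod>i<n. \<integral>p. (\<Prod>k\<in>{k \<in> K - B. ii k = i}. coord (dd k) p) * fst p ^ card {k \<in> G. gg k = i} \<partial>P)) *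
       (((\<Prod>j<N. normal_moment (card {k \<in> {k \<in> K - B. dd k = Bullet}. jj k = j})) *
        (\<Prod>j<N. normal_moment (card {k \<in> {k \<in> K - B. dd k = Circ}. jj k = j}))) *
       ((\<Prod>e\<in>{..<n} \<times> {..<N}. normal_moment (card {k \<in> {k \<in> B. dd k = Bullet}. (ii k, jj k) = e})) *
        (\<Prod>e\<in>{..<n} \<times> {..<N}. normal_moment (card {k \<in> {k \<in> B. dd k = Circ}. (ii k, jj k) = e}))))"
      unfolding T_def
      by (rule trans[OF all(2)]) (simp only: z2 u(2) v(2) W(2) Z(2) integral_mult_right_zero lessThan_iff)
    also have "\<dots> = obs_term lam mu n N P dd ii jj gg K G B"
      by (simp add: obs_term_def mult.assoc conj_assoc)
    finally show "(\<integral>\<omega>. T B \<omega> \<partial>planted P n N) = obs_term lam mu n N P dd ii jj gg K G B" .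
  qed
  have F: "F = (\<lambda>\<omega>. \<Sum>B\<in>Pow K. T B \<omega>)" using eq by auto
  show "integrable (planted P n N) F" unfolding F
    by (intro Bochner_Integration.integrable_sum TB) auto
  show "(\<integral>\<omega>. F \<omega> \<partial>planted P n N) = (\<Sum>B\<in>Pow K. obs_term lam mu n N P dd ii jj gg K G B)"
    unfolding F by (subst Bochner_Integration.integral_sum) (auto simp: TB)
qed

section \<open>Paths as lists of steps\<close>

lemma UNIV_decoration: "(UNIV :: decoration set) = {Bullet, Circ}"
  using decoration.exhaust by blast

lemma finite_decoration [simp]: "finite (A :: decoration set)"
  by (rule finite_subset[OF subset_UNIV]) (simp add: UNIV_decoration)

text \<open>A path \<open>i\<^sub>0, j\<^sub>1, i\<^sub>1, \<dots>, j\<^sub>l, i\<^sub>l\<close> is stored as its start \<open>i\<^sub>0\<close> and the list of the steps \<open>(d\<^sub>t, j\<^sub>t, i\<^sub>t)\<close>,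
  where \<open>d\<^sub>t\<close> decorates both edges at \<open>j\<^sub>t\<close>. Positions count from 0: \<open>bv xs t\<close> lies between \<open>av u xs t\<close> and \<open>av u xs (Suc t)\<close>.\<close>

type_synonym pstep = "decoration \<times> nat \<times> nat"

definition av :: "nat \<Rightarrow> pstep list \<Rightarrow> nat \<Rightarrow> nat" where
  "av u xs t = (u # map (snd \<circ> snd) xs) ! t"

definition bv :: "pstep list \<Rightarrow> nat \<Rightarrow> nat" where
  "bv xs t = fst (snd (xs ! t))"

definition wv :: "pstep list \<Rightarrow> nat \<Rightarrow> decoration" where
  "wv xs t = fst (xs ! t)"

definition simple :: "nat \<Rightarrow> pstep list \<Rightarrow> bool" where
  "simple u xs \<longleftrightarrow> distinct (u # map (snd \<circ> snd) xs) \<and> distinct (map (fst \<circ> snd) xs)"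

text \<open>The index \<open>(t, False)\<close> is the edge by which step \<open>t\<close> enters
  its b-vertex, \<open>(t, True)\<close> the edge by which it leaves. Sets of edges are handled as
  sets of such indices, which are the same for all paths of one length.\<close>

definition path_edge :: "nat \<Rightarrow> pstep list \<Rightarrow> nat \<times> bool \<Rightarrow> nat \<times> nat" where
  "path_edge u xs = (\<lambda>(t, s). (av u xs (if s then Suc t else t), bv xs t))"

text \<open>The decoration of an edge is read off the step that owns its b-vertex. The
  \<open>THE\<close> is meaningful only when the b-vertices are distinct, which is why facts about
  \<open>deco\<close> assume \<open>simple\<close>.\<close>

definition pgraph :: "nat \<Rightarrow> pstep list \<Rightarrow> (nat, nat) dbgraph" where
  "pgraph u xs = \<lparr>verts_a = av u xs ` {..length xs}, verts_b = bv xs ` {..<length xs},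
     deco = (\<lambda>(i, j). if \<exists>t<length xs. bv xs t = j \<and> (i = av u xs t \<or> i = av u xs (Suc t))
       then Some (wv xs (THE t. t < length xs \<and> bv xs t = j)) else None)\<rparr>"

lemma av_0 [simp]: "av u xs 0 = u" by (simp add: av_def)
lemma av_Suc: "t < length xs \<Longrightarrow> av u xs (Suc t) = snd (snd (xs ! t))" by (simp add: av_def)

lemma pstep_nth: "t < length xs \<Longrightarrow> xs ! t = (wv xs t, bv xs t, av u xs (Suc t))"
  by (simp add: av_Suc wv_def bv_def)

lemma simple_iff:
  "simple u xs \<longleftrightarrow> inj_on (av u xs) {..length xs} \<and> inj_on (bv xs) {..<length xs}"
proof -
  have "distinct (u # map (snd \<circ> snd) xs) \<longleftrightarrow> inj_on (av u xs) {..length xs}"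
    unfolding distinct_conv_nth inj_on_def av_def[symmetric] by (auto simp: less_Suc_eq_le)
  moreover have "distinct (map (fst \<circ> snd) xs) \<longleftrightarrow> inj_on (bv xs) {..<length xs}"
    unfolding distinct_conv_nth inj_on_def bv_def by auto
  ultimately show ?thesis by (simp add: simple_def)
qed

lemma av_eq: "simple u xs \<Longrightarrow> s \<le> length xs \<Longrightarrow> t \<le> length xs \<Longrightarrow> av u xs s = av u xs t \<longleftrightarrow> s = t"
  by (auto simp: simple_iff inj_on_def)

lemma bv_eq: "simple u xs \<Longrightarrow> s < length xs \<Longrightarrow> t < length xs \<Longrightarrow> bv xs s = bv xs t \<longleftrightarrow> s = t"
  by (auto simp: simple_iff inj_on_def)

lemma set_av: "av u xs ` {..length xs} = set (u # map (snd \<circ> snd) xs)"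
  unfolding av_def by (auto simp: set_conv_nth image_iff less_Suc_eq_le)

lemma set_bv: "bv xs ` {..<length xs} = set (map (fst \<circ> snd) xs)"
  unfolding bv_def set_map by (force simp: set_conv_nth)

lemma list_eqI:
  assumes "length xs = length ys" "\<And>t. t < length xs \<Longrightarrow> wv xs t = wv ys t \<and> bv xs t = bv ys t \<and> av u xs (Suc t) = av u' ys (Suc t)"
  shows "xs = ys"
proof (rule nth_equalityI)
  fix t assume t: "t < length xs"
  show "xs ! t = ys ! t"
    using assms t pstep_nth[OF t, of u] pstep_nth[of t ys u'] by simp
qed fact

lemma deco_pgraph:
  assumes "simple u xs"
  shows "deco (pgraph u xs) (i, j) = Some d \<longleftrightarrow>
    (\<exists>t<length xs. bv xs t = j \<and> wv xs t = d \<and> (i = av u xs t \<or> i = av u xs (Suc t)))"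
proof -
  have "(THE s. s < length xs \<and> bv xs s = bv xs t) = t" if "t < length xs" for t
    using that bv_eq[OF assms] by (intro the_equality) auto
  then show ?thesis unfolding pgraph_def using bv_eq[OF assms] by auto
qed

lemma verts_pgraph [simp]:
  "verts_a (pgraph u xs) = av u xs ` {..length xs}" "verts_b (pgraph u xs) = bv xs ` {..<length xs}"
  by (simp_all add: pgraph_def)

lemma dbgraph_pgraph: "dbgraph (pgraph u xs)"
  unfolding dbgraph_def by (auto simp: pgraph_def split: if_splits)

lemma path_edge_inj:
  assumes "simple u xs"
  shows "inj_on (path_edge u xs) ({..<length xs} \<times> UNIV)"
  using assms av_eq[OF assms] bv_eq[OF assms]
  by (auto simp: inj_on_def path_edge_def split: if_splits)

lemma edges_with_pgraph:
  assumes "simple u xs"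
  shows "edges_with d (pgraph u xs) = path_edge u xs ` {k \<in> {..<length xs} \<times> UNIV. wv xs (fst k) = d}"
proof (rule set_eqI)
  fix e :: "nat \<times> nat"
  obtain i j where e: "e = (i, j)" by fastforce
  have "e \<in> edges_with d (pgraph u xs) \<longleftrightarrow>
    (\<exists>t<length xs. bv xs t = j \<and> wv xs t = d \<and> (i = av u xs t \<or> i = av u xs (Suc t)))"
    by (simp add: edges_with_def e deco_pgraph[OF assms])
  also have "\<dots> \<longleftrightarrow> (\<exists>t s. t < length xs \<and> wv xs t = d \<and> e = path_edge u xs (t, s))"
    unfolding path_edge_def e by (auto intro: exI[of _ True] exI[of _ False])
  also have "\<dots> \<longleftrightarrow> e \<in> path_edge u xs ` {k \<in> {..<length xs} \<times> UNIV. wv xs (fst k) = d}"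
    by (auto simp: image_iff)
  finally show "e \<in> edges_with d (pgraph u xs) \<longleftrightarrow> \<dots>" .
qed

lemma edges_eq: "edges H = edges_with Bullet H \<union> edges_with Circ H"
  unfolding edges_def edges_with_def dom_def by (auto intro: decoration.exhaust)

lemma decoration_cases: "d = Bullet \<or> d = Circ" by (cases d) auto

lemma edges_pgraph:
  assumes "simple u xs"
  shows "edges (pgraph u xs) = path_edge u xs ` ({..<length xs} \<times> UNIV)"
  unfolding edges_eq edges_with_pgraph[OF assms] using decoration_cases by (auto simp: image_iff) 

lemma verts_pgraph_iff:
  "Inl i \<in> verts (pgraph u xs) \<longleftrightarrow> (\<exists>t\<le>length xs. i = av u xs t)"
  "Inr j \<in> verts (pgraph u xs) \<longleftrightarrow> (\<exists>t<length xs. j = bv xs t)"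
  by (auto simp: verts_def)

lemma verts_with_pgraph:
  assumes "simple u xs"
  shows "Inl i \<in> verts_with d (pgraph u xs) \<longleftrightarrow> (\<exists>t<length xs. wv xs t = d \<and> (i = av u xs t \<or> i = av u xs (Suc t)))"
    and "Inr j \<in> verts_with d (pgraph u xs) \<longleftrightarrow> (\<exists>t<length xs. wv xs t = d \<and> j = bv xs t)"
proof -
  have 1: "z \<in> verts_with d (pgraph u xs) \<longleftrightarrow>
    z \<in> verts (pgraph u xs) \<and> (\<exists>t<length xs. wv xs t = d \<and> (\<exists>s. z \<in> ends (path_edge u xs (t, s))))" for z
    unfolding verts_with_def edges_with_pgraph[OF assms] by auto
  show "Inl i \<in> verts_with d (pgraph u xs) \<longleftrightarrow> (\<exists>t<length xs. wv xs t = d \<and> (i = av u xs t \<or> i = av u xs (Suc t)))"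
    unfolding 1 verts_pgraph_iff ends_def path_edge_def
    by (auto intro: less_imp_le Suc_leI exI[of _ True] exI[of _ False])
  show "Inr j \<in> verts_with d (pgraph u xs) \<longleftrightarrow> (\<exists>t<length xs. wv xs t = d \<and> j = bv xs t)"
    unfolding 1 verts_pgraph_iff ends_def path_edge_def by auto
qed

text \<open>Both edges at a b-vertex belong to one step and share its decoration, so two decorations
  can meet only at an a-vertex between consecutive steps.\<close>

lemma diff_verts_pgraph:
  assumes "simple u xs"
  shows "diff_verts (pgraph u xs) = Inl ` av u xs ` {t. 0 < t \<and> t < length xs \<and> wv xs (t - 1) \<noteq> wv xs t}"
proof (rule set_eqI)
  fix z :: "nat + nat"
  show "z \<in> diff_verts (pgraph u xs) \<longleftrightarrow> z \<in> Inl ` av u xs ` {t. 0 < t \<and> t < length xs \<and> wv xs (t - 1) \<noteq> wv xs t}"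
  proof (cases z)
    case (Inr j)
    then show ?thesis using bv_eq[OF assms]
      by (auto simp: diff_verts_def verts_with_pgraph[OF assms])
  next
    case (Inl i)
    show ?thesis
    proof
      assume "z \<in> diff_verts (pgraph u xs)"
      then obtain s t where st: "s < length xs" "wv xs s = Bullet" "i = av u xs s \<or> i = av u xs (Suc s)"
        "t < length xs" "wv xs t = Circ" "i = av u xs t \<or> i = av u xs (Suc t)"
        unfolding diff_verts_def Inl Int_iff verts_with_pgraph[OF assms] by blast
      then have "s \<noteq> t" by auto
      then have "(t = Suc s \<and> i = av u xs t) \<or> (s = Suc t \<and> i = av u xs s)"
        using st av_eq[OF assms, of s t] av_eq[OF assms, of "Suc s" t] av_eq[OF assms, of s "Suc t"]
          av_eq[OF assms, of "Suc s" "Suc t"] by auto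
      then have "\<exists>r. 0 < r \<and> r < length xs \<and> wv xs (r - 1) \<noteq> wv xs r \<and> i = av u xs r"
      proof
        assume "t = Suc s \<and> i = av u xs t"
        then show ?thesis using st by (intro exI[of _ t]) auto
      next
        assume "s = Suc t \<and> i = av u xs s"
        then show ?thesis using st by (intro exI[of _ s]) auto
      qed
      then show "z \<in> Inl ` av u xs ` {t. 0 < t \<and> t < length xs \<and> wv xs (t - 1) \<noteq> wv xs t}"
        using Inl by blast
    next
      assume "z \<in> Inl ` av u xs ` {t. 0 < t \<and> t < length xs \<and> wv xs (t - 1) \<noteq> wv xs t}"
      then obtain t where t: "0 < t" "t < length xs" "wv xs (t - 1) \<noteq> wv xs t" "i = av u xs t" using Inl by auto
      then have "Inl i \<in> verts_with (wv xs t) (pgraph u xs)" "Inl i \<in> verts_with (wv xs (t - 1)) (pgraph u xs)"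
        unfolding verts_with_pgraph[OF assms] by (auto intro: exI[of _ "t - 1"])
      then show "z \<in> diff_verts (pgraph u xs)"
        using t(3) Inl unfolding diff_verts_def by (cases "wv xs t"; cases "wv xs (t - 1)") auto
    qed
  qed
qed

lemma leaves_pgraph:
  assumes s: "simple u xs" and l: "xs \<noteq> []"
  shows "leaves (pgraph u xs) = {Inl u, Inl (av u xs (length xs))}"
proof (rule set_eqI)
  fix z :: "nat + nat"
  have "{e \<in> edges (pgraph u xs). z \<in> ends e} = path_edge u xs ` {k \<in> {..<length xs} \<times> UNIV. z \<in> ends (path_edge u xs k)}"
    unfolding edges_pgraph[OF s] by auto
  then have c: "card {e \<in> edges (pgraph u xs). z \<in> ends e} = card {k \<in> {..<length xs} \<times> UNIV. z \<in> ends (path_edge u xs k)}"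
    using card_image[OF inj_on_subset[OF path_edge_inj[OF s]]] by (metis (no_types, lifting) mem_Collect_eq subsetI)
  show "z \<in> leaves (pgraph u xs) \<longleftrightarrow> z \<in> {Inl u, Inl (av u xs (length xs))}"
  proof (cases "z \<in> verts (pgraph u xs)")
    case False
    then have "z \<notin> {Inl u, Inl (av u xs (length xs))}" using verts_pgraph_iff(1) by (metis av_0 empty_iff insert_iff le0 order_refl)
    then show ?thesis using False by (auto simp: leaves_def)
  next
    case True
    show ?thesis
    proof (cases z)
      case (Inr j)
      then obtain t where t: "t < length xs" "j = bv xs t" using True verts_pgraph_iff by blast
      have "{k \<in> {..<length xs} \<times> UNIV. z \<in> ends (path_edge u xs k)} = {(t, False), (t, True)}"
        using t bv_eq[OF s] Inr by (auto simp: ends_def path_edge_def)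
      then show ?thesis using c Inr by (simp add: leaves_def)
    next
      case (Inl i)
      then obtain t where t: "t \<le> length xs" "i = av u xs t" using True verts_pgraph_iff by blast
      \<comment> \<open>Position \<open>t\<close> meets the first edge of step \<open>t\<close> and
        the second edge of step \<open>t - 1\<close>; one of them is missing exactly at the two ends
        of the list.\<close>
      have "{k \<in> {..<length xs} \<times> UNIV. z \<in> ends (path_edge u xs k)} =
        (if t < length xs then {(t, False)} else {}) \<union> (if 0 < t then {(t - 1, True)} else {})"
        using t av_eq[OF s] av_eq[OF s, of 0] Inl by (auto simp: ends_def path_edge_def split: if_splits)
      then have "card {k \<in> {..<length xs} \<times> UNIV. z \<in> ends (path_edge u xs k)} = 1 \<longleftrightarrow> t = 0 \<or> t = length xs"
        using t l by auto
      moreover have "i = u \<longleftrightarrow> t = 0" "i = av u xs (length xs) \<longleftrightarrow> t = length xs"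
        using t av_eq[OF s, of t 0] av_eq[OF s, of t "length xs"] by auto
      ultimately show ?thesis using c Inl True by (simp add: leaves_def)
    qed
  qed
qed

lemma is_path_pgraph:
  assumes s: "simple u xs"
  shows "is_path (2 * length xs) (pgraph u xs)"
proof -
  \<comment> \<open>Even positions of the vertex list are a-vertices, odd ones b-vertices; the edge
    number \<open>k\<close> has index \<open>(k div 2, odd k)\<close>.\<close>
  define q where "q k = (if even k then Inl (av u xs (k div 2)) else Inr (bv xs (k div 2)) :: nat + nat)" for k
  define p where "p = map q [0..<2 * length xs + 1]"
  have "inj_on q {0..<2 * length xs + 1}"
  proof (rule inj_onI)
    fix k k' assume k: "k \<in> {0..<2 * length xs + 1}" "k' \<in> {0..<2 * length xs + 1}" "q k = q k'"
    have e: "even k \<longleftrightarrow> even k'" using k(3) by (auto simp: q_def split: if_splits)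
    have "k div 2 = k' div 2"
    proof (cases "even k")
      case True
      then have "av u xs (k div 2) = av u xs (k' div 2)" using k(3) e by (simp add: q_def)
      then show ?thesis using k av_eq[OF s, of "k div 2" "k' div 2"] by auto
    next
      case False
      then have "bv xs (k div 2) = bv xs (k' div 2)" using k(3) e by (simp add: q_def)
      moreover have "k div 2 < length xs" "k' div 2 < length xs" using k False e by (auto elim!: oddE)
      ultimately show ?thesis using bv_eq[OF s, of "k div 2" "k' div 2"] by auto
    qed
    then show "k = k'" using e by (metis even_two_times_div_two odd_two_times_div_two_succ)
  qed
  then have d: "distinct p" by (simp add: p_def distinct_map del: upt_Suc)
  have "set p = verts (pgraph u xs)"
  proof (rule set_eqI)
    fix z
    show "z \<in> set p \<longleftrightarrow> z \<in> verts (pgraph u xs)"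
    proof (cases z)
      case (Inl i)
      have "z \<in> set p \<longleftrightarrow> (\<exists>k<2 * length xs + 1. z = q k)" unfolding p_def by (auto simp del: upt_Suc)
      also have "\<dots> \<longleftrightarrow> (\<exists>t\<le>length xs. i = av u xs t)"
      proof
        assume "\<exists>k<2 * length xs + 1. z = q k"
        then obtain k where "k < 2 * length xs + 1" "z = q k" by blast
        then show "\<exists>t\<le>length xs. i = av u xs t" using Inl
          by (intro exI[of _ "k div 2"]) (auto simp: q_def split: if_splits)
      next
        assume "\<exists>t\<le>length xs. i = av u xs t"
        then obtain t where "t \<le> length xs" "i = av u xs t" by blast
        then show "\<exists>k<2 * length xs + 1. z = q k" using Inl
          by (intro exI[of _ "2 * t"]) (auto simp: q_def)
      qed
      finally show ?thesis by (simp add: Inl verts_pgraph_iff)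
    next
      case (Inr i)
      have "z \<in> set p \<longleftrightarrow> (\<exists>k<2 * length xs + 1. z = q k)" unfolding p_def by (auto simp del: upt_Suc)
      also have "\<dots> \<longleftrightarrow> (\<exists>t<length xs. i = bv xs t)"
      proof
        assume "\<exists>k<2 * length xs + 1. z = q k"
        then obtain k where "k < 2 * length xs + 1" "z = q k" by blast
        then show "\<exists>t<length xs. i = bv xs t" using Inr
          by (intro exI[of _ "k div 2"]) (auto simp: q_def elim!: oddE split: if_splits)
      next
        assume "\<exists>t<length xs. i = bv xs t"
        then obtain t where "t < length xs" "i = bv xs t" by blast
        then show "\<exists>k<2 * length xs + 1. z = q k" using Inr
          by (intro exI[of _ "2 * t + 1"]) (auto simp: q_def)
      qed
      finally show ?thesis by (simp add: Inr verts_pgraph_iff)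
    qed
  qed
  moreover have "ends ` edges (pgraph u xs) = {{p ! k, p ! (k + 1)} | k. k < 2 * length xs}"
  proof -
    have 1: "{p ! k, p ! (k + 1)} = ends (path_edge u xs (k div 2, odd k))" if "k < 2 * length xs" for k
    proof -
      have "p ! k = q k" "p ! (k + 1) = q (k + 1)" using that by (auto simp: p_def simp del: upt_Suc)
      then show ?thesis
        by (cases "even k") (auto simp: q_def ends_def path_edge_def elim!: evenE oddE)
    qed
    have 2: "path_edge u xs ` ({..<length xs} \<times> UNIV) = (\<lambda>k. path_edge u xs (k div 2, odd k)) ` {..<2 * length xs}"
    proof -
      have "{..<length xs} \<times> (UNIV :: bool set) = (\<lambda>k. (k div 2, odd k)) ` {..<2 * length xs}"
      proof (rule set_eqI)
        fix y :: "nat \<times> bool"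
        obtain t b where y: "y = (t, b)" by fastforce
        show "y \<in> {..<length xs} \<times> UNIV \<longleftrightarrow> y \<in> (\<lambda>k. (k div 2, odd k)) ` {..<2 * length xs}"
        proof
          assume "y \<in> {..<length xs} \<times> UNIV"
          then show "y \<in> (\<lambda>k. (k div 2, odd k)) ` {..<2 * length xs}" unfolding y
            by (intro image_eqI[of _ _ "2 * t + (if b then 1 else 0)"]) auto
        qed auto
      qed
      then show ?thesis by (simp only: image_image)
    qed
    have "ends ` edges (pgraph u xs) = (\<lambda>k. {p ! k, p ! (k + 1)}) ` {..<2 * length xs}"
      unfolding edges_pgraph[OF s] 2 image_image by (rule image_cong) (use 1 in auto)
    then show ?thesis by auto
  qed
  moreover have "length p = 2 * length xs + 1" by (simp add: p_def)
  ultimately show ?thesis unfolding is_path_def using d by blast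
qed

lemma pgraph_admissible:
  assumes s: "simple u xs" and l: "xs \<noteq> []" and w: "wv xs 0 = Bullet" "wv xs (length xs - 1) = Bullet"
  shows "pgraph u xs \<in> admissible_paths (length xs)"
proof -
  have "Inl u \<in> verts_with Bullet (pgraph u xs)"
    unfolding verts_with_pgraph[OF s] using l w by (intro exI[of _ 0]) auto
  moreover have "Inl (av u xs (length xs)) \<in> verts_with Bullet (pgraph u xs)"
    unfolding verts_with_pgraph[OF s] using l w by (intro exI[of _ "length xs - 1"]) auto
  moreover have "u \<in> av u xs ` {..length xs}" by (rule image_eqI[of _ _ 0]) auto
  ultimately show ?thesis unfolding admissible_paths_def
    using dbgraph_pgraph is_path_pgraph[OF s] diff_verts_pgraph[OF s] leaves_pgraph[OF s l]
    by auto
qed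

lemma ends_inj: "ends e = ends e' \<Longrightarrow> e = e'"
  by (auto simp: ends_def doubleton_eq_iff prod_eq_iff)

lemma pgraph_eqI:
  assumes s: "simple u xs" and H: "dbgraph H" and va: "verts_a H = av u xs ` {..length xs}" and vb: "verts_b H = bv xs ` {..<length xs}"
    and d: "\<And>i j d. deco H (i, j) = Some d \<longleftrightarrow>
      (\<exists>t<length xs. bv xs t = j \<and> wv xs t = d \<and> (i = av u xs t \<or> i = av u xs (Suc t)))"
  shows "H = pgraph u xs"
proof -
  have "deco H (i, j) = deco (pgraph u xs) (i, j)" for i j
    using d[of i j] deco_pgraph[OF s, of i j] by (metis not_Some_eq)
  then have "deco H = deco (pgraph u xs)" by auto
  then show ?thesis using va vb by (intro dbgraph.equality) auto
qed

text \<open>Each admissibility condition supplies one part of the normal form. Leaves on the a side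
  make the vertex list begin with an a-vertex, so a- and b-vertices alternate from there. Since no
  b-vertex lies in \<open>diff_verts\<close>, its two edges have one decoration, and a single letter
  per step suffices. Leaves incident to a Bullet edge make the first and the last letter
  Bullet.\<close>

lemma admissible_pgraph:
  assumes H: "H \<in> admissible_paths l" and l: "l > 0"
  shows "\<exists>u xs. simple u xs \<and> length xs = l \<and> H = pgraph u xs \<and> wv xs 0 = Bullet \<and> wv xs (l - 1) = Bullet"
proof -
  have db: "dbgraph H" and diff: "diff_verts H \<subseteq> Inl ` verts_a H"
    and lv: "leaves H \<subseteq> verts_with Bullet H \<inter> Inl ` verts_a H" and "is_path (2 * l) H"
    using H by (auto simp: admissible_paths_def)
  then obtain p where p: "length p = 2 * l + 1" "distinct p" "set p = verts H"
    "ends ` edges H = {{p ! k, p ! (k + 1)} | k. k < 2 * l}" unfolding is_path_def by blast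
  have p_eq: "p ! k = p ! k' \<longleftrightarrow> k = k'" if "k \<le> 2 * l" "k' \<le> 2 * l" for k k'
    using p(1,2) that by (simp add: nth_eq_iff_index_eq)
  have edge_k: "\<exists>e\<in>edges H. ends e = {p ! k, p ! (k + 1)}" if "k < 2 * l" for k
  proof -
    have "{p ! k, p ! (k + 1)} \<in> ends ` edges H" unfolding p(4) using that by blast
    then show ?thesis by (metis imageE)
  qed
  have k_edge: "\<exists>k<2 * l. ends e = {p ! k, p ! (k + 1)}" if "e \<in> edges H" for e
  proof -
    have "ends e \<in> {{p ! k, p ! (k + 1)} | k. k < 2 * l}" unfolding p(4)[symmetric] using that by blast
    then show ?thesis by blast
  qed
  have alt: "isl (p ! (k + 1)) \<longleftrightarrow> \<not> isl (p ! k)" if k: "k < 2 * l" for k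
  proof -
    obtain e where "ends e = {p ! k, p ! (k + 1)}" using edge_k[OF k] by blast
    then show ?thesis unfolding ends_def
      by (cases "p ! k"; cases "p ! (k + 1)") (auto simp: doubleton_eq_iff)
  qed
  \<comment> \<open>The first vertex of the list lies on a single edge, so it is a leaf and hence on
    the a side; this fixes the parity of all positions.\<close>
  have "p ! 0 \<in> leaves H"
  proof -
    obtain e where e: "e \<in> edges H" "ends e = {p ! 0, p ! (0 + 1)}" using edge_k[of 0] l by auto
    have "{e' \<in> edges H. p ! 0 \<in> ends e'} = {e}"
    proof (intro equalityI subsetI)
      fix e' assume e': "e' \<in> {e' \<in> edges H. p ! 0 \<in> ends e'}"
      then obtain k where k: "k < 2 * l" "ends e' = {p ! k, p ! (k + 1)}" using k_edge by blast
      then have "p ! 0 = p ! k \<or> p ! 0 = p ! (k + 1)" using e' by auto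
      then have "k = 0" using k p_eq[of 0 k] p_eq[of 0 "k + 1"] by auto
      then show "e' \<in> {e}" using e k ends_inj[of e' e] by simp
    qed (use e in auto)
    then have "card {e' \<in> edges H. p ! 0 \<in> ends e'} = 1" by simp
    moreover have "p ! 0 \<in> verts H" using p by (metis add_gr_0 less_numeral_extra(1) nth_mem)
    ultimately show ?thesis by (simp add: leaves_def)
  qed
  then have p0: "isl (p ! 0)" using lv by auto
  have isl_p: "k \<le> 2 * l \<Longrightarrow> isl (p ! k) \<longleftrightarrow> even k" for k
    by (induction k) (use p0 alt in auto)
  define A where "A t = projl (p ! (2 * t))" for t
  define B where "B t = projr (p ! (2 * t + 1))" for t
  have A: "p ! (2 * t) = Inl (A t)" if "t \<le> l" for t
    using isl_p[of "2 * t"] that by (simp add: A_def)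
  have B: "p ! (2 * t + 1) = Inr (B t)" if "t < l" for t
    using isl_p[of "2 * t + 1"] that by (simp add: B_def)
  have A_eq: "A s = A t \<longleftrightarrow> s = t" if "s \<le> l" "t \<le> l" for s t
    using A[OF that(1)] A[OF that(2)] p_eq[of "2 * s" "2 * t"] that by auto
  have B_eq: "B s = B t \<longleftrightarrow> s = t" if "s < l" "t < l" for s t
    using B[OF that(1)] B[OF that(2)] p_eq[of "2 * s + 1" "2 * t + 1"] that by auto
  have edges: "(i, j) \<in> edges H \<longleftrightarrow> (\<exists>t<l. j = B t \<and> (i = A t \<or> i = A (Suc t)))" for i j
  proof
    assume "(i, j) \<in> edges H"
    then obtain k where k: "k < 2 * l" "ends (i, j) = {p ! k, p ! (k + 1)}" using k_edge by blast
    show "\<exists>t<l. j = B t \<and> (i = A t \<or> i = A (Suc t))"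
    proof (cases "even k")
      case True
      then obtain t where t: "k = 2 * t" by blast
      then have "{Inl i, Inr j} = {Inl (A t), Inr (B t)}" using k A[of t] B[of t] by (simp add: ends_def)
      then show ?thesis using k t by (intro exI[of _ t]) (auto simp: doubleton_eq_iff)
    next
      case False
      then obtain t where t: "k = 2 * t + 1" using oddE by blast
      then have "{Inl i, Inr j} = {Inr (B t), Inl (A (Suc t))}" using k A[of "Suc t"] B[of t] by (simp add: ends_def)
      then show ?thesis using k t by (intro exI[of _ t]) (auto simp: doubleton_eq_iff)
    qed
  next
    assume "\<exists>t<l. j = B t \<and> (i = A t \<or> i = A (Suc t))"
    then obtain t where t: "t < l" "j = B t" "i = A t \<or> i = A (Suc t)" by blast
    from t(3) have "ends (i, j) = {p ! (2 * t), p ! (2 * t + 1)} \<or> ends (i, j) = {p ! (2 * t + 1), p ! (2 * t + 1 + 1)}"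
      using A[of t] B[of t] A[of "Suc t"] t by (auto simp: ends_def)
    then obtain e where "e \<in> edges H" "ends e = ends (i, j)"
      using edge_k[of "2 * t"] edge_k[of "2 * t + 1"] t by auto
    then show "(i, j) \<in> edges H" using ends_inj by metis
  qed
  have same: "deco H (A t, B t) = deco H (A (Suc t), B t)" if t: "t < l" for t
  proof (rule ccontr)
    assume ne: "deco H (A t, B t) \<noteq> deco H (A (Suc t), B t)"
    have "(A t, B t) \<in> edges H" "(A (Suc t), B t) \<in> edges H" using t unfolding edges by auto
    then obtain d d' where dd: "deco H (A t, B t) = Some d" "deco H (A (Suc t), B t) = Some d'"
      by (auto simp: edges_def)
    have v: "Inr (B t) \<in> verts H" using B[OF t] nth_mem[of "2 * t + 1" p] p t by auto
    have "Inr (B t) \<in> verts_with d H" "Inr (B t) \<in> verts_with d' H"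
      unfolding verts_with_def edges_with_def using v dd by (force simp: ends_def)+
    then have "Inr (B t) \<in> diff_verts H" using ne dd unfolding diff_verts_def by (cases d; cases d') auto
    then show False using diff by auto
  qed
  define xs where "xs = map (\<lambda>t. (the (deco H (A t, B t)), B t, A (Suc t))) [0..<l]"
  have len: "length xs = l" by (simp add: xs_def)
  have av: "av (A 0) xs t = A t" if "t \<le> l" for t
    using that by (cases t) (auto simp: xs_def av_def)
  have bv: "bv xs t = B t" if "t < l" for t using that by (auto simp: xs_def bv_def)
  have wv: "wv xs t = the (deco H (A t, B t))" if "t < l" for t using that by (auto simp: xs_def wv_def)
  have s: "simple (A 0) xs"
    unfolding simple_iff len inj_on_def using A_eq B_eq av bv by auto
  have vertsH: "Inl i \<in> verts H \<longleftrightarrow> (\<exists>t\<le>l. i = A t)" "Inr j \<in> verts H \<longleftrightarrow> (\<exists>t<l. j = B t)" for i j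
  proof -
    show "Inl i \<in> verts H \<longleftrightarrow> (\<exists>t\<le>l. i = A t)"
    proof
      assume "Inl i \<in> verts H"
      then obtain k where k: "k < 2 * l + 1" "p ! k = Inl i" using p by (metis in_set_conv_nth)
      then have "even k" using isl_p[of k] by auto
      then obtain t where "k = 2 * t" by blast
      then show "\<exists>t\<le>l. i = A t" using k A[of t] by (intro exI[of _ t]) auto
    next
      assume "\<exists>t\<le>l. i = A t"
      then obtain t where "t \<le> l" "i = A t" by blast
      then show "Inl i \<in> verts H" using A[of t] nth_mem[of "2 * t" p] p by auto
    qed
    show "Inr j \<in> verts H \<longleftrightarrow> (\<exists>t<l. j = B t)"
    proof
      assume "Inr j \<in> verts H"
      then obtain k where k: "k < 2 * l + 1" "p ! k = Inr j" using p by (metis in_set_conv_nth)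
      then have "odd k" using isl_p[of k] by auto
      then obtain t where "k = 2 * t + 1" using oddE by blast
      then show "\<exists>t<l. j = B t" using k B[of t] by (intro exI[of _ t]) auto
    next
      assume "\<exists>t<l. j = B t"
      then obtain t where "t < l" "j = B t" by blast
      then show "Inr j \<in> verts H" using B[of t] nth_mem[of "2 * t + 1" p] p by auto
    qed
  qed
  have HH: "H = pgraph (A 0) xs"
  proof (rule pgraph_eqI[OF s db])
    show "verts_a H = av (A 0) xs ` {..length xs}"
      using vertsH(1) av len by (force simp: verts_def image_iff)
    show "verts_b H = bv xs ` {..<length xs}"
      using vertsH(2) bv len by (force simp: verts_def image_iff)
    fix i j d
    have "deco H (i, j) = Some d \<longleftrightarrow> (i, j) \<in> edges H \<and> the (deco H (i, j)) = d"
      by (auto simp: edges_def)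
    also have "\<dots> \<longleftrightarrow> (\<exists>t<l. j = B t \<and> (i = A t \<or> i = A (Suc t)) \<and> the (deco H (A t, B t)) = d)"
      unfolding edges using same by auto
    also have "\<dots> \<longleftrightarrow> (\<exists>t<length xs. bv xs t = j \<and> wv xs t = d \<and> (i = av (A 0) xs t \<or> i = av (A 0) xs (Suc t)))"
      unfolding len using av bv wv by (auto simp: Suc_le_eq)
    finally show "deco H (i, j) = Some d \<longleftrightarrow> (\<exists>t<length xs. bv xs t = j \<and> wv xs t = d \<and> (i = av (A 0) xs t \<or> i = av (A 0) xs (Suc t)))" .
  qed
  have ne: "xs \<noteq> []" using l len by auto
  have "Inl (A 0) \<in> verts_with Bullet (pgraph (A 0) xs)" "Inl (av (A 0) xs l) \<in> verts_with Bullet (pgraph (A 0) xs)"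
    using lv leaves_pgraph[OF s ne] HH len by auto
  then obtain t t' where t: "t < l" "wv xs t = Bullet" "A 0 = av (A 0) xs t \<or> A 0 = av (A 0) xs (Suc t)"
    "t' < l" "wv xs t' = Bullet" "av (A 0) xs l = av (A 0) xs t' \<or> av (A 0) xs l = av (A 0) xs (Suc t')"
    unfolding verts_with_pgraph[OF s] len by blast
  have "t = 0" using t av_eq[OF s, of 0 t] av_eq[OF s, of 0 "Suc t"] len by auto
  moreover have "t' = l - 1" using t av_eq[OF s, of l t'] av_eq[OF s, of l "Suc t'"] len by auto
  ultimately show ?thesis using s len HH t by blast
qed

section \<open>Isomorphism classes of paths\<close>

text \<open>Path reversal, to be started at \<open>av u xs (length xs)\<close>. A reversed step
  arrives where the original step departed, so \<open>av\<close> is taken at the same index as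
  \<open>bv\<close> and not at its successor.\<close>

definition prev :: "nat \<Rightarrow> pstep list \<Rightarrow> pstep list" where
  "prev u xs = map (\<lambda>t. (wv xs (length xs - 1 - t), bv xs (length xs - 1 - t), av u xs (length xs - 1 - t))) [0..<length xs]"

lemma length_prev [simp]: "length (prev u xs) = length xs"
  by (simp add: prev_def)

lemma prev_nth:
  assumes "t < length xs"
  shows "wv (prev u xs) t = wv xs (length xs - 1 - t)" "bv (prev u xs) t = bv xs (length xs - 1 - t)"
  using assms by (simp_all add: prev_def wv_def bv_def)

lemma av_prev:
  assumes "t \<le> length xs"
  shows "av (av u xs (length xs)) (prev u xs) t = av u xs (length xs - t)"
  using assms by (cases t) (simp_all add: av_Suc prev_def)

lemma map_fst_prev: "map fst (prev u xs) = rev (map fst xs)"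
  by (rule nth_equalityI) (auto simp: prev_def rev_nth wv_def)

lemma simple_prev:
  assumes "simple u xs"
  shows "simple (av u xs (length xs)) (prev u xs)"
  unfolding simple_iff inj_on_def
  using av_eq[OF assms] bv_eq[OF assms] by (auto simp: av_prev prev_nth)

lemma pgraph_prev:
  assumes s: "simple u xs"
  shows "pgraph (av u xs (length xs)) (prev u xs) = pgraph u xs"
proof (rule pgraph_eqI[OF simple_prev[OF s], symmetric])
  let ?l = "length xs" and ?v = "av u xs (length xs)"
  show "dbgraph (pgraph u xs)" by (rule dbgraph_pgraph)
  have "(\<lambda>t. ?l - t) ` {..?l} = {..?l}"
  proof (intro equalityI subsetI)
    fix x assume "x \<in> {..?l}"
    then show "x \<in> (\<lambda>t. ?l - t) ` {..?l}" by (intro image_eqI[of _ _ "?l - x"]) auto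
  qed auto
  then have "av u xs ` {..?l} = av u xs ` (\<lambda>t. ?l - t) ` {..?l}" by simp
  then show "verts_a (pgraph u xs) = av ?v (prev u xs) ` {..length (prev u xs)}"
    by (simp add: image_image av_prev)
  have "(\<lambda>t. ?l - 1 - t) ` {..<?l} = {..<?l}"
  proof (intro equalityI subsetI)
    fix x assume "x \<in> {..<?l}"
    then show "x \<in> (\<lambda>t. ?l - 1 - t) ` {..<?l}" by (intro image_eqI[of _ _ "?l - 1 - x"]) auto
  qed auto
  then have "bv xs ` {..<?l} = bv xs ` (\<lambda>t. ?l - 1 - t) ` {..<?l}" by simp
  also have "\<dots> = bv (prev u xs) ` {..<?l}"
    unfolding image_image by (rule image_cong) (auto simp: prev_nth)
  finally show "verts_b (pgraph u xs) = bv (prev u xs) ` {..<length (prev u xs)}" by simp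
  fix i j d
  have "(\<exists>t<?l. bv xs t = j \<and> wv xs t = d \<and> (i = av u xs t \<or> i = av u xs (Suc t))) \<longleftrightarrow>
    (\<exists>t<?l. bv (prev u xs) t = j \<and> wv (prev u xs) t = d \<and> (i = av ?v (prev u xs) t \<or> i = av ?v (prev u xs) (Suc t)))"
    (is "?L \<longleftrightarrow> ?R")
  proof
    assume ?L
    then obtain t where t: "t < ?l" "bv xs t = j" "wv xs t = d" "i = av u xs t \<or> i = av u xs (Suc t)" by blast
    then show ?R
      by (intro exI[of _ "?l - 1 - t"]) (auto simp: prev_nth av_prev Suc_diff_Suc)
  next
    assume ?R
    then obtain t where t: "t < ?l" "bv (prev u xs) t = j" "wv (prev u xs) t = d"
      "i = av ?v (prev u xs) t \<or> i = av ?v (prev u xs) (Suc t)" by blast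
    then show ?L
      by (intro exI[of _ "?l - 1 - t"]) (auto simp: prev_nth av_prev Suc_diff_Suc)
  qed
  then show "deco (pgraph u xs) (i, j) = Some d \<longleftrightarrow> (\<exists>t<length (prev u xs). bv (prev u xs) t = j \<and>
      wv (prev u xs) t = d \<and> (i = av ?v (prev u xs) t \<or> i = av ?v (prev u xs) (Suc t)))"
    unfolding deco_pgraph[OF s] by simp
qed

text \<open>With its starting vertex fixed, a path graph can be read in one way only. Along the
  induction, the b-vertex that \<open>xs\<close> uses next is adjacent to the current a-vertex, so
  in \<open>ys\<close> it belongs to the step just made or to the next one; the former is already
  matched with a different b-vertex of \<open>xs\<close>.\<close>

lemma pgraph_inj:
  assumes s: "simple u xs" "simple u ys" and len: "length ys = length xs" and eq: "pgraph u xs = pgraph u ys"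
  shows "ys = xs"
proof -
  have d: "(\<exists>t<length xs. bv xs t = j \<and> wv xs t = d \<and> (i = av u xs t \<or> i = av u xs (Suc t))) \<longleftrightarrow>
    (\<exists>t<length xs. bv ys t = j \<and> wv ys t = d \<and> (i = av u ys t \<or> i = av u ys (Suc t)))" for i j d
    using deco_pgraph[OF s(1), of i j d] deco_pgraph[OF s(2), of i j d] eq len by simp
  have "t \<le> length xs \<Longrightarrow> av u xs t = av u ys t \<and> (\<forall>r<t. bv ys r = bv xs r \<and> wv ys r = wv xs r)" for t
  proof (induction t)
    case (Suc t)
    then have t: "t < length xs" and IH: "av u xs t = av u ys t" "\<And>r. r < t \<Longrightarrow> bv ys r = bv xs r" by auto
    obtain r where r: "r < length xs" "bv ys r = bv xs t" "wv ys r = wv xs t" "av u xs t = av u ys r \<or> av u xs t = av u ys (Suc r)"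
      using d[of "bv xs t" "wv xs t" "av u xs t"] t by blast
    have "r = t"
    proof (rule ccontr)
      assume "r \<noteq> t"
      then have "Suc r = t" using r IH(1) av_eq[OF s(2), of t r] av_eq[OF s(2), of t "Suc r"] t len by auto
      then have "bv xs r = bv xs t" using IH(2)[of r] r by simp
      then show False using bv_eq[OF s(1), of r t] r t \<open>r \<noteq> t\<close> by simp
    qed
    obtain r' where r': "r' < length xs" "bv ys r' = bv xs t" "av u xs (Suc t) = av u ys r' \<or> av u xs (Suc t) = av u ys (Suc r')"
      using d[of "bv xs t" "wv xs t" "av u xs (Suc t)"] t by blast
    have "r' = t" using r' r \<open>r = t\<close> bv_eq[OF s(2), of r' t] t len by auto
    moreover have "av u xs (Suc t) \<noteq> av u ys t" using IH(1) av_eq[OF s(1), of "Suc t" t] t by auto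
    ultimately have "av u xs (Suc t) = av u ys (Suc t)" using r' by auto
    then show ?case using Suc r \<open>r = t\<close> by (auto simp: less_Suc_eq)
  qed simp
  then show ?thesis using len by (intro list_eqI[of _ _ u u]) (auto simp: Suc_le_eq)
qed

text \<open>The leaves leave two candidates for the start, and each determines the list. From these
  two readings come the bound 2 for automorphism groups and the bound 2 for the number of words of a
  class.\<close>

lemma pgraph_eq_cases:
  assumes s: "simple u xs" "simple u' ys" and len: "length ys = length xs" "xs \<noteq> []" and eq: "pgraph u xs = pgraph u' ys"
  shows "(u', ys) = (u, xs) \<or> (u', ys) = (av u xs (length xs), prev u xs)"
proof -
  have "ys \<noteq> []" using len by auto
  then have "Inl u' \<in> leaves (pgraph u xs)" using leaves_pgraph[OF s(2)] eq by auto
  then have "u' = u \<or> u' = av u xs (length xs)" using leaves_pgraph[OF s(1) len(2)] by auto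
  then show ?thesis
  proof
    assume "u' = u"
    then show ?thesis using pgraph_inj[OF s(1), of ys] s len eq by auto
  next
    assume u': "u' = av u xs (length xs)"
    have "ys = prev u xs"
      by (rule pgraph_inj[OF simple_prev[OF s(1)]]) (use s len eq u' pgraph_prev[OF s(1)] in auto)
    then show ?thesis using u' by simp
  qed
qed

lemma deco_pgraph_at:
  assumes s: "simple u xs" and t: "t \<le> length xs" and r: "r < length xs"
  shows "deco (pgraph u xs) (av u xs t, bv xs r) = (if t = r \<or> t = Suc r then Some (wv xs r) else None)"
proof -
  have "deco (pgraph u xs) (av u xs t, bv xs r) = Some d \<longleftrightarrow> wv xs r = d \<and> (t = r \<or> t = Suc r)" for d
  proof -
    have "av u xs t = av u xs r \<longleftrightarrow> t = r" "av u xs t = av u xs (Suc r) \<longleftrightarrow> t = Suc r"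
      using av_eq[OF s t] r by auto
    moreover have "bv xs q = bv xs r \<longleftrightarrow> q = r" if "q < length xs" for q using bv_eq[OF s that r] .
    ultimately show ?thesis unfolding deco_pgraph[OF s] using r by metis
  qed
  then show ?thesis by (cases "deco (pgraph u xs) (av u xs t, bv xs r)") auto
qed

definition relabel :: "(nat \<Rightarrow> nat) \<Rightarrow> (nat \<Rightarrow> nat) \<Rightarrow> pstep list \<Rightarrow> pstep list" where
  "relabel f g = map (\<lambda>(d, j, i). (d, g j, f i))"

lemma relabel_simps:
  "length (relabel f g xs) = length xs" "map fst (relabel f g xs) = map fst xs"
  by (auto simp: relabel_def)

lemma av_relabel: "t \<le> length xs \<Longrightarrow> av (f u) (relabel f g xs) t = f (av u xs t)"
  by (cases t) (auto simp: av_Suc relabel_def split: prod.splits)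

lemma bv_relabel: "t < length xs \<Longrightarrow> bv (relabel f g xs) t = g (bv xs t)"
  by (auto simp: bv_def relabel_def split: prod.splits)

lemma wv_relabel: "t < length xs \<Longrightarrow> wv (relabel f g xs) t = wv xs t"
  by (auto simp: wv_def relabel_def split: prod.splits)

text \<open>An isomorphism carries a reading of the graph to a reading of its image with the same
  word, so isomorphism classes of path graphs can be described by words alone.\<close>

lemma isos_pgraph:
  assumes s: "simple u xs" and iso: "(f, g) \<in> isos (pgraph u xs) H" and H: "dbgraph H"
  shows "simple (f u) (relabel f g xs)" "H = pgraph (f u) (relabel f g xs)"
proof -
  have f: "bij_betw f (av u xs ` {..length xs}) (verts_a H)"
    and g: "bij_betw g (bv xs ` {..<length xs}) (verts_b H)"
    and d: "\<And>t r. t \<le> length xs \<Longrightarrow> r < length xs \<Longrightarrow> deco H (f (av u xs t), g (bv xs r)) = deco (pgraph u xs) (av u xs t, bv xs r)"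
    using iso by (auto simp: isos_def)
  have f_eq: "f (av u xs t) = f (av u xs r) \<longleftrightarrow> t = r" if "t \<le> length xs" "r \<le> length xs" for t r
    using f av_eq[OF s that] that unfolding bij_betw_def inj_on_def by blast
  have g_eq: "g (bv xs t) = g (bv xs r) \<longleftrightarrow> t = r" if "t < length xs" "r < length xs" for t r
    using g bv_eq[OF s that] that unfolding bij_betw_def inj_on_def by blast
  show s': "simple (f u) (relabel f g xs)"
    unfolding simple_iff inj_on_def relabel_simps by (auto simp: av_relabel bv_relabel f_eq g_eq)
  show "H = pgraph (f u) (relabel f g xs)"
  proof (rule pgraph_eqI[OF s' H])
    have "verts_a H = f ` av u xs ` {..length xs}" using f by (simp add: bij_betw_def)
    also have "\<dots> = av (f u) (relabel f g xs) ` {..length xs}"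
      unfolding image_image by (rule image_cong) (auto simp: av_relabel)
    finally show va: "verts_a H = av (f u) (relabel f g xs) ` {..length (relabel f g xs)}"
      by (simp add: relabel_simps)
    have "verts_b H = g ` bv xs ` {..<length xs}" using g by (simp add: bij_betw_def)
    also have "\<dots> = bv (relabel f g xs) ` {..<length xs}"
      unfolding image_image by (rule image_cong) (auto simp: bv_relabel)
    finally show vb: "verts_b H = bv (relabel f g xs) ` {..<length (relabel f g xs)}"
      by (simp add: relabel_simps)
    fix i j c
    show "deco H (i, j) = Some c \<longleftrightarrow> (\<exists>t<length (relabel f g xs). bv (relabel f g xs) t = j \<and> wv (relabel f g xs) t = c \<and>
       (i = av (f u) (relabel f g xs) t \<or> i = av (f u) (relabel f g xs) (Suc t)))" (is "?L \<longleftrightarrow> ?R")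
    proof
      assume L: ?L
      then have "i \<in> verts_a H" "j \<in> verts_b H" using H by (auto simp: dbgraph_def)
      then obtain t r where tr: "t \<le> length xs" "i = f (av u xs t)" "r < length xs" "j = g (bv xs r)"
        unfolding va vb relabel_simps by (auto simp: av_relabel bv_relabel)
      then have "Some c = (if t = r \<or> t = Suc r then Some (wv xs r) else None)"
        using L d[of t r] deco_pgraph_at[OF s, of t r] by simp
      then show ?R using tr
        by (intro exI[of _ r]) (auto simp: relabel_simps av_relabel bv_relabel wv_relabel split: if_splits)
    next
      assume ?R
      then obtain r where r: "r < length xs" "j = g (bv xs r)" "c = wv xs r" "i = f (av u xs r) \<or> i = f (av u xs (Suc r))"
        unfolding relabel_simps by (auto simp: av_relabel bv_relabel wv_relabel)
      then show ?L using d[of r r] d[of "Suc r" r] deco_pgraph_at[OF s, of r r] deco_pgraph_at[OF s, of "Suc r" r] by auto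
    qed
  qed
qed

lemma isomorphic_pgraph:
  assumes s: "simple u xs" "simple u' ys" and eq: "map fst xs = map fst ys"
  shows "isomorphic (pgraph u xs) (pgraph u' ys)"
proof -
  have len: "length ys = length xs" using eq by (metis length_map)
  have w: "wv ys t = wv xs t" if "t < length xs" for t
    using eq that len unfolding wv_def by (metis nth_map)
  define f where "f = restrict (\<lambda>i. av u' ys (the_inv_into {..length xs} (av u xs) i)) (verts_a (pgraph u xs))"
  define g where "g = restrict (\<lambda>i. bv ys (the_inv_into {..<length xs} (bv xs) i)) (verts_b (pgraph u xs))"
  have f: "f (av u xs t) = av u' ys t" if "t \<le> length xs" for t
    using that s(1) by (auto simp: f_def simple_iff the_inv_into_f_f)
  have g: "g (bv xs t) = bv ys t" if "t < length xs" for t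
    using that s(1) by (auto simp: g_def simple_iff the_inv_into_f_f)
  have "(f, g) \<in> isos (pgraph u xs) (pgraph u' ys)"
    unfolding isos_def
  proof (intro CollectI case_prodI conjI ballI)
    show "bij_betw f (verts_a (pgraph u xs)) (verts_a (pgraph u' ys))"
    proof (rule bij_betw_imageI)
      show "inj_on f (verts_a (pgraph u xs))"
        using f av_eq[OF s(2)] len by (auto simp: inj_on_def)
      show "f ` verts_a (pgraph u xs) = verts_a (pgraph u' ys)"
        unfolding verts_pgraph image_image len by (rule image_cong) (auto simp: f)
    qed
    show "bij_betw g (verts_b (pgraph u xs)) (verts_b (pgraph u' ys))"
    proof (rule bij_betw_imageI)
      show "inj_on g (verts_b (pgraph u xs))"
        using g bv_eq[OF s(2)] len by (auto simp: inj_on_def)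
      show "g ` verts_b (pgraph u xs) = verts_b (pgraph u' ys)"
        unfolding verts_pgraph image_image len by (rule image_cong) (auto simp: g)
    qed
    fix i j assume "i \<in> verts_a (pgraph u xs)" "j \<in> verts_b (pgraph u xs)"
    then obtain t r where "t \<le> length xs" "i = av u xs t" "r < length xs" "j = bv xs r" by auto
    then show "deco (pgraph u' ys) (f i, g j) = deco (pgraph u xs) (i, j)"
      using deco_pgraph_at[OF s(1), of t r] deco_pgraph_at[OF s(2), of t r] len by (simp add: f g w)
  qed (auto simp: f_def g_def)
  then show ?thesis unfolding isomorphic_def by blast
qed

lemma isomorphic_sym:
  assumes "isomorphic H H'"
  shows "isomorphic H' H"
proof -
  obtain f g where fg: "(f, g) \<in> isos H H'" using assms unfolding isomorphic_def by auto
  then have f: "bij_betw f (verts_a H) (verts_a H')" and g: "bij_betw g (verts_b H) (verts_b H')"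
    and d: "\<And>i j. i \<in> verts_a H \<Longrightarrow> j \<in> verts_b H \<Longrightarrow> deco H' (f i, g j) = deco H (i, j)"
    by (auto simp: isos_def)
  let ?f = "restrict (the_inv_into (verts_a H) f) (verts_a H')"
  let ?g = "restrict (the_inv_into (verts_b H) g) (verts_b H')"
  have "(?f, ?g) \<in> isos H' H"
    unfolding isos_def
  proof (intro CollectI case_prodI conjI ballI)
    show "bij_betw ?f (verts_a H') (verts_a H)" 
      using bij_betw_the_inv_into[OF f] by (simp cong: bij_betw_cong)
    show "bij_betw ?g (verts_b H') (verts_b H)"
      using bij_betw_the_inv_into[OF g] by (simp cong: bij_betw_cong)
    fix i j assume ij: "i \<in> verts_a H'" "j \<in> verts_b H'"
    then have "f (the_inv_into (verts_a H) f i) = i" "the_inv_into (verts_a H) f i \<in> verts_a H"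
      using f f_the_inv_into_f_bij_betw[OF f] bij_betw_the_inv_into[OF f] by (auto dest: bij_betwE)
    moreover have "g (the_inv_into (verts_b H) g j) = j" "the_inv_into (verts_b H) g j \<in> verts_b H"
      using ij g f_the_inv_into_f_bij_betw[OF g] bij_betw_the_inv_into[OF g] by (auto dest: bij_betwE)
    ultimately show "deco H (?f i, ?g j) = deco H' (i, j)"
      using d[of "the_inv_into (verts_a H) f i" "the_inv_into (verts_b H) g j"] ij by simp
  qed auto
  then show ?thesis unfolding isomorphic_def by blast
qed

section \<open>Words as names of the isomorphism classes\<close>

definition words :: "nat \<Rightarrow> decoration list set" where
  "words l = {w. length w = l \<and> w \<noteq> [] \<and> hd w = Bullet \<and> last w = Bullet}"

definition word_class :: "decoration list \<Rightarrow> (nat, nat) dbgraph set" where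
  "word_class w = {pgraph u xs | u xs. simple u xs \<and> map fst xs = w}"

lemma words_iff:
  "map fst xs \<in> words l \<longleftrightarrow> length xs = l \<and> xs \<noteq> [] \<and> wv xs 0 = Bullet \<and> wv xs (length xs - 1) = Bullet"
  by (auto simp: words_def wv_def hd_conv_nth last_conv_nth hd_map last_map)

lemma finite_words: "finite (words l)"
proof (rule finite_subset)
  show "words l \<subseteq> {w. set w \<subseteq> {Bullet, Circ} \<and> length w = l}"
    using decoration_cases by (auto simp: words_def)
  show "finite {w. set w \<subseteq> {Bullet, Circ} \<and> length w = l}" by (rule finite_lists_length_eq) simp
qed

text \<open>A concrete path with the prescribed word; it shows that every word class is inhabited
  and serves as a fixed member for comparisons.\<close>

definition canon :: "decoration list \<Rightarrow> pstep list" where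
  "canon w = map (\<lambda>t. (w ! t, t, Suc t)) [0..<length w]"

lemma canon: "simple 0 (canon w)" "map fst (canon w) = w"
proof -
  have "av 0 (canon w) t = t" if "t \<le> length w" for t
    using that by (cases t) (auto simp: av_def canon_def)
  moreover have "bv (canon w) t = t" if "t < length w" for t
    using that by (auto simp: bv_def canon_def)
  ultimately show "simple 0 (canon w)" unfolding simple_iff inj_on_def by (auto simp: canon_def)
  show "map fst (canon w) = w" by (rule nth_equalityI) (auto simp: canon_def)
qed

lemma iso_rel_class:
  assumes s: "simple u xs"
  shows "iso_rel `` {pgraph u xs} = word_class (map fst xs)"
proof (intro equalityI subsetI)
  fix H assume "H \<in> iso_rel `` {pgraph u xs}"
  then have H: "dbgraph H" "isomorphic (pgraph u xs) H" by (auto simp: iso_rel_def)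
  then obtain f g where "(f, g) \<in> isos (pgraph u xs) H" unfolding isomorphic_def by auto
  from isos_pgraph[OF s this H(1)] show "H \<in> word_class (map fst xs)"
    unfolding word_class_def using relabel_simps(2)[of f g xs] by blast
next
  fix H assume "H \<in> word_class (map fst xs)"
  then obtain u' ys where "H = pgraph u' ys" "simple u' ys" "map fst ys = map fst xs"
    unfolding word_class_def by blast
  then show "H \<in> iso_rel `` {pgraph u xs}"
    using isomorphic_pgraph[OF s, of u' ys] dbgraph_pgraph by (auto simp: iso_rel_def)
qed

text \<open>Only an image and not a bijection: reversing a path reverses its word without changing
  the graph, so a word and its reversal name the same class.\<close>

lemma path_classes_eq:
  assumes l: "l > 0"
  shows "path_classes l = word_class ` words l"
proof (intro equalityI subsetI)
  fix c assume "c \<in> path_classes l"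
  then obtain H where H: "H \<in> admissible_paths l" "c = iso_rel `` {H}"
    unfolding path_classes_def quotient_def by blast
  from admissible_pgraph[OF H(1) l] obtain u xs where xs: "simple u xs" "length xs = l" "H = pgraph u xs"
    "wv xs 0 = Bullet" "wv xs (l - 1) = Bullet" by blast
  then have "map fst xs \<in> words l" unfolding words_iff using l by auto
  then show "c \<in> word_class ` words l" using iso_rel_class[OF xs(1)] H xs by auto
next
  fix c assume "c \<in> word_class ` words l"
  then obtain w where w: "w \<in> words l" "c = word_class w" by blast
  have "map fst (canon w) \<in> words l" using w canon(2) by simp
  note this[unfolded words_iff]
  then have "pgraph 0 (canon w) \<in> admissible_paths l"
    using pgraph_admissible[OF canon(1)[of w]] by auto
  moreover have "c = iso_rel `` {pgraph 0 (canon w)}" using iso_rel_class[OF canon(1)] w canon(2) by simp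
  ultimately show "c \<in> path_classes l" unfolding path_classes_def quotient_def by blast
qed

lemma rep_in_class: "rep (word_class w) \<in> word_class w"
proof -
  have "pgraph 0 (canon w) \<in> word_class w" unfolding word_class_def using canon by blast
  then show ?thesis unfolding rep_def by (rule someI)
qed

lemma word_class_iff:
  assumes "H \<in> word_class w" "dbgraph S"
  shows "isomorphic S H \<longleftrightarrow> S \<in> word_class w"
proof
  assume "isomorphic S H"
  then have i: "isomorphic H S" by (rule isomorphic_sym)
  obtain u xs where "H = pgraph u xs" "simple u xs" "map fst xs = w" using assms unfolding word_class_def by blast
  then show "S \<in> word_class w" using iso_rel_class[of u xs] i assms dbgraph_pgraph by (auto simp: iso_rel_def)
next
  assume "S \<in> word_class w"
  then show "isomorphic S H" using assms(1) isomorphic_pgraph unfolding word_class_def by force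
qed

lemma word_class_disjoint:
  assumes "S \<in> word_class w" "S \<in> word_class w'"
  shows "word_class w = word_class w'"
proof -
  have db: "dbgraph T" if "T \<in> word_class v" for T v
    using that dbgraph_pgraph unfolding word_class_def by blast
  have "T \<in> word_class w \<longleftrightarrow> T \<in> word_class w'" for T
    using word_class_iff[OF assms(1)] word_class_iff[OF assms(2)] db by blast
  then show ?thesis by blast
qed

section \<open>Weights and the statistic in terms of lists\<close>

definition dval :: "real \<Rightarrow> real \<Rightarrow> decoration \<Rightarrow> real" where
  "dval lam mu d = (case d of Bullet \<Rightarrow> lam | Circ \<Rightarrow> mu)"

definition changes :: "decoration list \<Rightarrow> nat set" where
  "changes w = {t. 0 < t \<and> t < length w \<and> w ! (t - 1) \<noteq> w ! t}"

definition weight :: "real \<Rightarrow> real \<Rightarrow> real \<Rightarrow> decoration list \<Rightarrow> real" where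
  "weight lam mu rho w = (\<Prod>t<length w. dval lam mu (w ! t)) * rho ^ card (changes w)"

text \<open>The half-integer powers disappear because each step contributes two edges of equal
  decoration, so every square root occurs an even number of times.\<close>

lemma Upsilon_pgraph:
  assumes s: "simple u xs" and nn: "lam \<ge> 0" "mu \<ge> 0"
  shows "Upsilon lam mu rho (pgraph u xs) = weight lam mu rho (map fst xs)"
proof -
  let ?l = "length xs"
  have 1: "card (edges_with d (pgraph u xs)) = 2 * card {t \<in> {..<?l}. wv xs t = d}" for d
  proof -
    have "card (edges_with d (pgraph u xs)) = card {k \<in> {..<?l} \<times> (UNIV :: bool set). wv xs (fst k) = d}"
      unfolding edges_with_pgraph[OF s]
      by (rule card_image, rule inj_on_subset[OF path_edge_inj[OF s]]) auto
    also have "{k \<in> {..<?l} \<times> (UNIV :: bool set). wv xs (fst k) = d} = {t \<in> {..<?l}. wv xs t = d} \<times> UNIV" by auto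
    finally show ?thesis by (simp add: card_cartesian_product)
  qed
  have "(\<Prod>t<?l. dval lam mu (wv xs t)) = lam ^ card {t \<in> {..<?l}. wv xs t = Bullet} * mu ^ card {t \<in> {..<?l}. wv xs t = Circ}"
    unfolding dval_def by (subst prod_case_decoration) auto
  moreover have "sqrt x ^ (2 * m) = x ^ m" if "x \<ge> 0" for x :: real and m
    using that by (simp add: power_mult)
  moreover have "card (diff_verts (pgraph u xs)) = card (changes (map fst xs))"
  proof -
    have "{t. 0 < t \<and> t < ?l \<and> wv xs (t - 1) \<noteq> wv xs t} = changes (map fst xs)"
      by (auto simp: changes_def wv_def)
    moreover have "card (Inl ` av u xs ` {t. 0 < t \<and> t < ?l \<and> wv xs (t - 1) \<noteq> wv xs t} :: (nat + nat) set)
      = card {t. 0 < t \<and> t < ?l \<and> wv xs (t - 1) \<noteq> wv xs t}"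
      by (subst card_image, simp, rule card_image) (auto simp: inj_on_def av_eq[OF s])
    ultimately show ?thesis unfolding diff_verts_pgraph[OF s] by simp
  qed
  ultimately show ?thesis
    unfolding Upsilon_def 1 weight_def using nn by (simp add: wv_def)
qed

lemma Upsilon_rep:
  assumes "S \<in> word_class w" "lam \<ge> 0" "mu \<ge> 0"
  shows "Upsilon lam mu rho S = weight lam mu rho w"
  using assms Upsilon_pgraph unfolding word_class_def by blast

definition path_monomial where
  "path_monomial u xs X Y = (\<Prod>k\<in>{..<length xs} \<times> UNIV.
     (case wv xs (fst k) of Bullet \<Rightarrow> X | Circ \<Rightarrow> Y) (fst (path_edge u xs k)) (snd (path_edge u xs k)) :: real)"

lemma h_mon_pgraph:
  assumes s: "simple u xs"
  shows "h_mon (pgraph u xs) X Y = path_monomial u xs X Y"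
proof -
  have e: "(\<Prod>(i, j)\<in>edges_with d (pgraph u xs). F i j) =
    (\<Prod>k\<in>{k \<in> {..<length xs} \<times> UNIV. wv xs (fst k) = d}. F (fst (path_edge u xs k)) (snd (path_edge u xs k)))" for d and F :: "nat \<Rightarrow> nat \<Rightarrow> real"
    unfolding edges_with_pgraph[OF s]
    by (subst prod.reindex[OF inj_on_subset[OF path_edge_inj[OF s]]]) (auto simp: case_prod_unfold)
  have "path_monomial u xs X Y = (\<Prod>k\<in>{..<length xs} \<times> (UNIV :: bool set). case wv xs (fst k) of
    Bullet \<Rightarrow> X (fst (path_edge u xs k)) (snd (path_edge u xs k)) | Circ \<Rightarrow> Y (fst (path_edge u xs k)) (snd (path_edge u xs k)))"
    unfolding path_monomial_def by (intro prod.cong) (auto split: decoration.splits)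
  also have "\<dots> = h_mon (pgraph u xs) X Y"
    unfolding h_mon_def e by (subst prod_case_decoration) auto
  finally show ?thesis by simp
qed

definition paths :: "nat \<Rightarrow> nat \<Rightarrow> nat \<Rightarrow> nat \<Rightarrow> nat \<Rightarrow> pstep list set" where
  "paths n N l u v = {xs. simple u xs \<and> map fst xs \<in> words l \<and> av u xs l = v \<and>
     set (map (fst \<circ> snd) xs) \<subseteq> {..<N} \<and> set (map (snd \<circ> snd) xs) \<subseteq> {..<n}}"

lemma finite_paths: "finite (paths n N l u v)"
proof (rule finite_subset)
  show "paths n N l u v \<subseteq> {xs. set xs \<subseteq> UNIV \<times> {..<N} \<times> {..<n} \<and> length xs = l}"
    by (force simp: paths_def words_iff)
  show "finite {xs. set xs \<subseteq> (UNIV :: decoration set) \<times> {..<N} \<times> {..<n} \<and> length xs = l}"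
    by (intro finite_lists_length_eq finite_cartesian_product) auto
qed

text \<open>A subgraph whose leaves are the distinct vertices \<open>u\<close> and \<open>v\<close>
  has exactly one reading that starts at \<open>u\<close>. Hence the double sum over classes and
  their copies is a single sum over \<open>paths\<close> without multiplicities, although a class
  may have two words.\<close>

lemma Psi_sum:
  assumes l: "l > 0" and uv: "u < n" "v < n" "u \<noteq> v" and nn: "lam \<ge> 0" "mu \<ge> 0"
  shows "Psi lam mu rho l n N X Y u v = 1 / (real N ^ l * inverse (real n) * beta lam mu rho l) *
    (\<Sum>xs\<in>paths n N l u v. weight lam mu rho (map fst xs) * path_monomial u xs X Y)"
proof -
  define S where "S c = {S. S \<in> subgraphs n N \<and> S \<in> c \<and> leaves S = {Inl u, Inl v}}" for c
  have sub: "pgraph u' xs \<in> subgraphs n N \<longleftrightarrow> u' < n \<and> set (map (fst \<circ> snd) xs) \<subseteq> {..<N} \<and> set (map (snd \<circ> snd) xs) \<subseteq> {..<n}" for u' xs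
    unfolding subgraphs_def using dbgraph_pgraph by (auto simp: set_av set_bv)
  have un: "(\<Union>c\<in>path_classes l. S c) = pgraph u ` paths n N l u v"
  proof (intro equalityI subsetI)
    fix G assume "G \<in> (\<Union>c\<in>path_classes l. S c)"
    then obtain w where w: "w \<in> words l" "G \<in> word_class w" "G \<in> subgraphs n N" "leaves G = {Inl u, Inl v}"
      unfolding path_classes_eq[OF l] S_def by blast
    then obtain u' xs where xs: "G = pgraph u' xs" "simple u' xs" "map fst xs = w" unfolding word_class_def by blast
    have len: "length xs = l" "xs \<noteq> []" using xs w words_iff by auto
    have "{Inl u, Inl v} = ({Inl u', Inl (av u' xs l)} :: (nat + nat) set)"
      using leaves_pgraph[OF xs(2) len(2)] w xs len by simp
    then consider "u' = u" "av u' xs l = v" | "u' = v" "av u' xs l = u" using uv by (auto simp: doubleton_eq_iff)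
    then show "G \<in> pgraph u ` paths n N l u v"
    proof cases
      case 1
      then have "xs \<in> paths n N l u v" using xs w sub by (auto simp: paths_def)
      then show ?thesis using xs 1 by auto
    next
      \<comment> \<open>A reading from \<open>v\<close> to \<open>u\<close> is reversed; its
        reversed word again starts and ends with Bullet.\<close>
      case 2
      have g: "pgraph u (prev u' xs) = G" using pgraph_prev[OF xs(2)] 2 len xs by simp
      have "prev u' xs \<in> paths n N l u v"
      proof -
        have "simple u (prev u' xs)" using simple_prev[OF xs(2)] 2 len by simp
        moreover have "map fst (prev u' xs) \<in> words l"
          using w xs unfolding map_fst_prev by (auto simp: words_def hd_rev last_rev)
        moreover have "av u (prev u' xs) l = v" using av_prev[of l xs u'] 2 len by simp
        ultimately show ?thesis using sub[of u "prev u' xs"] g w by (auto simp: paths_def)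
      qed
      then show ?thesis using g by blast
    qed
  next
    fix G assume "G \<in> pgraph u ` paths n N l u v"
    then obtain xs where xs: "xs \<in> paths n N l u v" "G = pgraph u xs" by blast
    then have s: "simple u xs" "map fst xs \<in> words l" by (auto simp: paths_def)
    have "leaves G = {Inl u, Inl v}" using leaves_pgraph[OF s(1)] s(2) xs by (auto simp: words_iff paths_def)
    moreover have "G \<in> subgraphs n N" using xs sub uv by (auto simp: paths_def)
    ultimately have "G \<in> S (word_class (map fst xs))" unfolding S_def word_class_def using xs s by blast
    then show "G \<in> (\<Union>c\<in>path_classes l. S c)" unfolding path_classes_eq[OF l] using s by blast
  qed
  have fin: "finite (path_classes l)" "\<forall>c\<in>path_classes l. finite (S c)"
  proof -
    show "finite (path_classes l)" unfolding path_classes_eq[OF l] using finite_words by blast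
    have "finite (\<Union>c\<in>path_classes l. S c)" unfolding un using finite_paths by blast
    then show "\<forall>c\<in>path_classes l. finite (S c)" by (meson UN_upper finite_subset)
  qed
  have disj: "\<forall>c\<in>path_classes l. \<forall>c'\<in>path_classes l. c \<noteq> c' \<longrightarrow> S c \<inter> S c' = {}"
  proof (intro ballI impI)
    fix c c' assume c: "c \<in> path_classes l" "c' \<in> path_classes l" "c \<noteq> c'"
    then obtain w w' where "c = word_class w" "c' = word_class w'" unfolding path_classes_eq[OF l] by blast
    then show "S c \<inter> S c' = {}" using c(3) word_class_disjoint unfolding S_def by blast
  qed
  have "(\<Sum>c\<in>path_classes l. Upsilon lam mu rho (rep c) *
          (\<Sum>S | S \<in> subgraphs n N \<and> isomorphic S (rep c) \<and> leaves S = {Inl u, Inl v}. h_mon S X Y))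
     = (\<Sum>c\<in>path_classes l. \<Sum>T\<in>S c. Upsilon lam mu rho T * h_mon T X Y)"
  proof (rule sum.cong[OF refl])
    fix c assume "c \<in> path_classes l"
    then obtain w where w: "c = word_class w" unfolding path_classes_eq[OF l] by blast
    have "{S. S \<in> subgraphs n N \<and> isomorphic S (rep c) \<and> leaves S = {Inl u, Inl v}} = S c"
      unfolding S_def w using word_class_iff[OF rep_in_class[of w]] by (auto simp: subgraphs_def)
    moreover have "Upsilon lam mu rho T = Upsilon lam mu rho (rep c)" if "T \<in> S c" for T
    proof -
      have "T \<in> word_class w" using that w S_def by blast
      then show ?thesis using Upsilon_rep[OF _ nn] rep_in_class[of w] w by metis
    qed
    ultimately show "Upsilon lam mu rho (rep c) *
          (\<Sum>S | S \<in> subgraphs n N \<and> isomorphic S (rep c) \<and> leaves S = {Inl u, Inl v}. h_mon S X Y) =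
       (\<Sum>T\<in>S c. Upsilon lam mu rho T * h_mon T X Y)"
      by (simp add: sum_distrib_left)
  qed
  also have "\<dots> = (\<Sum>T\<in>(\<Union>c\<in>path_classes l. S c). Upsilon lam mu rho T * h_mon T X Y)"
    by (rule sum.UNION_disjoint[symmetric, OF fin disj])
  also have "\<dots> = (\<Sum>xs\<in>paths n N l u v. Upsilon lam mu rho (pgraph u xs) * h_mon (pgraph u xs) X Y)"
    unfolding un
  proof (rule sum.reindex[unfolded comp_def])
    show "inj_on (pgraph u) (paths n N l u v)"
    proof (rule inj_onI)
      fix xs ys assume "xs \<in> paths n N l u v" "ys \<in> paths n N l u v" "pgraph u xs = pgraph u ys"
      then show "xs = ys" using pgraph_inj[of u xs ys] by (auto simp: paths_def words_iff)
    qed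
  qed
  also have "\<dots> = (\<Sum>xs\<in>paths n N l u v. weight lam mu rho (map fst xs) * path_monomial u xs X Y)"
    by (intro sum.cong) (auto simp: paths_def Upsilon_pgraph[OF _ nn] h_mon_pgraph)
  finally show ?thesis using uv unfolding Psi_def by simp
qed

section \<open>Comparison of \<open>beta\<close> with a sum over words\<close>

text \<open>A substitute for \<open>beta\<close> without automorphism counts and without passing to
  classes. Summed letter by letter, it is governed by powers of a transfer matrix.\<close>

definition word_sum :: "real \<Rightarrow> real \<Rightarrow> real \<Rightarrow> nat \<Rightarrow> real" where
  "word_sum lam mu rho l = (\<Sum>w\<in>words l. (weight lam mu rho w)\<^sup>2)"

text \<open>An automorphism is determined by the reading to which it sends \<open>(u, xs)\<close>,
  and only the path itself and its reversal are available.\<close>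

lemma card_aut:
  assumes s: "simple u xs" and ne: "xs \<noteq> []"
  shows "finite (aut (pgraph u xs))" "1 \<le> card (aut (pgraph u xs))" "card (aut (pgraph u xs)) \<le> 2"
proof -
  let ?r = "\<lambda>(f, g). (f u, relabel f g xs)"
  have sub: "?r ` aut (pgraph u xs) \<subseteq> {(u, xs), (av u xs (length xs), prev u xs)}"
  proof
    fix y assume "y \<in> ?r ` aut (pgraph u xs)"
    then obtain f g where fg: "(f, g) \<in> isos (pgraph u xs) (pgraph u xs)" "y = (f u, relabel f g xs)"
      unfolding aut_def by auto
    from isos_pgraph[OF s fg(1) dbgraph_pgraph] pgraph_eq_cases[OF s, of "f u" "relabel f g xs"]
    show "y \<in> {(u, xs), (av u xs (length xs), prev u xs)}" using fg(2) ne by (auto simp: relabel_simps)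
  qed
  have inj: "inj_on ?r (aut (pgraph u xs))"
  proof (rule inj_onI, clarify)
    fix f g f' g' assume a: "(f, g) \<in> aut (pgraph u xs)" "(f', g') \<in> aut (pgraph u xs)"
      and eq: "f u = f' u" "relabel f g xs = relabel f' g' xs"
    have ext: "f \<in> extensional (verts_a (pgraph u xs))" "g \<in> extensional (verts_b (pgraph u xs))"
      "f' \<in> extensional (verts_a (pgraph u xs))" "g' \<in> extensional (verts_b (pgraph u xs))"
      using a by (auto simp: aut_def isos_def)
    have "f = f'"
    proof (rule extensionalityI[OF ext(1,3)])
      fix i assume "i \<in> verts_a (pgraph u xs)"
      then obtain t where "t \<le> length xs" "i = av u xs t" by auto
      then show "f i = f' i" using av_relabel[of t xs f u g] av_relabel[of t xs f' u g'] eq by simp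
    qed
    moreover have "g = g'"
    proof (rule extensionalityI[OF ext(2,4)])
      fix i assume "i \<in> verts_b (pgraph u xs)"
      then obtain t where "t < length xs" "i = bv xs t" by auto
      then show "g i = g' i" using bv_relabel[of t xs f g] bv_relabel[of t xs f' g'] eq by simp
    qed
    ultimately show "f = f' \<and> g = g'" by simp
  qed
  show fin: "finite (aut (pgraph u xs))"
    by (rule finite_imageD[OF finite_subset[OF sub] inj]) simp
  have "aut (pgraph u xs) \<noteq> {}"
    using isomorphic_pgraph[OF s s refl] unfolding aut_def isomorphic_def .
  then show "1 \<le> card (aut (pgraph u xs))" using fin by (simp add: Suc_le_eq card_gt_0_iff)
  have "card (aut (pgraph u xs)) = card (?r ` aut (pgraph u xs))" using inj by (simp add: card_image)
  also have "\<dots> \<le> card {(u, xs), (av u xs (length xs), prev u xs)}" by (rule card_mono[OF _ sub]) simp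
  also have "\<dots> \<le> 2" by (simp add: card_insert_if)
  finally show "card (aut (pgraph u xs)) \<le> 2" .
qed

text \<open>In the second inequality one factor 2 pays for the automorphisms and one for the two
  words of a class. The first one has constant 1, which later turns into the bound 1/2 for the first
  moment.\<close>

lemma beta_bounds:
  assumes l: "l > 0" and nn: "lam \<ge> 0" "mu \<ge> 0"
  shows "beta lam mu rho l \<le> word_sum lam mu rho l" "word_sum lam mu rho l \<le> 4 * beta lam mu rho l"
proof -
  define W where "W c = (Upsilon lam mu rho (rep c))\<^sup>2" for c
  have W: "W (word_class w) = (weight lam mu rho w)\<^sup>2" for w
    unfolding W_def using Upsilon_rep[OF rep_in_class nn] by simp
  have aut: "1 \<le> card (aut (rep (word_class w))) \<and> card (aut (rep (word_class w))) \<le> 2" if "w \<in> words l" for w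
  proof -
    obtain u xs where xs: "rep (word_class w) = pgraph u xs" "simple u xs" "map fst xs = w"
      using rep_in_class[of w] unfolding word_class_def by blast
    then have "xs \<noteq> []" using that words_iff[of xs l] by simp
    then show ?thesis using card_aut[OF xs(2)] xs(1) by simp
  qed
  have beta: "beta lam mu rho l = (\<Sum>c\<in>word_class ` words l. W c / real (card (aut (rep c))))"
    unfolding beta_def W_def path_classes_eq[OF l] ..
  have "beta lam mu rho l \<le> (\<Sum>c\<in>word_class ` words l. W c)"
    unfolding beta
  proof (rule sum_mono)
    fix c assume "c \<in> word_class ` words l"
    then have "1 \<le> card (aut (rep c))" using aut by blast
    then have "W c / real (card (aut (rep c))) \<le> W c / 1"
      unfolding W_def by (intro divide_left_mono) auto
    then show "W c / real (card (aut (rep c))) \<le> W c" by simp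
  qed
  also have "\<dots> \<le> (\<Sum>w\<in>words l. W (word_class w))"
    using sum_image_le[OF finite_words[of l], of W word_class] by (simp add: W_def comp_def)
  finally show "beta lam mu rho l \<le> word_sum lam mu rho l" by (simp add: W word_sum_def)
  have fiber: "card {w' \<in> words l. word_class w' = word_class w} \<le> 2" if w: "w \<in> words l" for w
  proof -
    have "{w' \<in> words l. word_class w' = word_class w} \<subseteq> {w, rev w}"
    proof
      fix w' assume "w' \<in> {w' \<in> words l. word_class w' = word_class w}"
      then have w': "w' \<in> words l" "word_class w' = word_class w" by auto
      have "pgraph 0 (canon w) \<in> word_class w" unfolding word_class_def using canon by blast
      then obtain u ys where ys: "pgraph 0 (canon w) = pgraph u ys" "simple u ys" "map fst ys = w'"
        using w'(2) unfolding word_class_def by blast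
      have "length ys = length (canon w)" "canon w \<noteq> []"
        using w w'(1) ys(3) by (auto simp: words_def canon_def)
      from pgraph_eq_cases[OF canon(1) ys(2) this ys(1)] have "ys = canon w \<or> ys = prev 0 (canon w)" by auto
      then show "w' \<in> {w, rev w}" using ys(3) canon(2)[of w] map_fst_prev[of 0 "canon w"] by auto
    qed
    then have "card {w' \<in> words l. word_class w' = word_class w} \<le> card {w, rev w}" by (rule card_mono[rotated]) simp
    also have "\<dots> \<le> 2" by (simp add: card_insert_if)
    finally show ?thesis .
  qed
  have "word_sum lam mu rho l = (\<Sum>c\<in>word_class ` words l. \<Sum>w\<in>{w \<in> words l. word_class w = c}. W (word_class w))"
    unfolding word_sum_def W[symmetric] by (rule sum.group[symmetric]) (auto simp: finite_words)
  also have "\<dots> \<le> (\<Sum>c\<in>word_class ` words l. 4 * (W c / real (card (aut (rep c)))))"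
  proof (rule sum_mono)
    fix c assume c: "c \<in> word_class ` words l"
    then obtain w where w: "w \<in> words l" "c = word_class w" by blast
    have "(\<Sum>w\<in>{w \<in> words l. word_class w = c}. W (word_class w)) = real (card {w' \<in> words l. word_class w' = c}) * W c"
      by simp
    also have "\<dots> \<le> 2 * W c"
      using fiber[OF w(1)] w(2) by (intro mult_right_mono) (auto simp: W_def)
    also have "\<dots> \<le> 4 * (W c / real (card (aut (rep c))))"
    proof -
      have "W c / 2 \<le> W c / real (card (aut (rep c)))"
        using aut[OF w(1)] w(2) by (intro divide_left_mono) (auto simp: W_def)
      then show ?thesis by simp
    qed
    finally show "(\<Sum>w\<in>{w \<in> words l. word_class w = c}. W (word_class w)) \<le> 4 * (W c / real (card (aut (rep c))))" .
  qed
  also have "\<dots> = 4 * beta lam mu rho l" unfolding beta sum_distrib_left ..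
  finally show "word_sum lam mu rho l \<le> 4 * beta lam mu rho l" .
qed

section \<open>Weighted walks relative to a reference path\<close>

type_synonym wstep = "decoration \<times> nat \<times> nat \<times> bool \<times> bool"

text \<open>A step \<open>(d, j, i, f, g)\<close> of T goes through \<open>j\<close> to \<open>i\<close>; the flags \<open>f\<close>, \<open>g\<close> tell whether its two edges are noise
  edges shared with the reference path S, which is given by \<open>a\<close>, \<open>b\<close>, \<open>w\<close>. The weights are relative to the weight of S and
  normalised by \<open>1 / N\<close> per step; \<open>Cq\<close> and \<open>Cb\<close> bound the moments at vertices shared with S.\<close>

locale ref_path =
  fixes n N l :: nat and a b :: "nat \<Rightarrow> nat" and w :: "nat \<Rightarrow> decoration"
    and lamd :: "decoration \<Rightarrow> real" and rho Cq Cb :: real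
  assumes n_pos: "n > 0" and N_pos: "N > 0"
    and inj_a: "inj_on a {..l}" and inj_b: "inj_on b {..<l}"
    and a_lt: "p \<le> l \<Longrightarrow> a p < n" and b_lt: "q < l \<Longrightarrow> b q < N"
    and lamd_pos: "lamd d > 0" and rho01: "0 < rho" "rho < 1" and Cq1: "Cq \<ge> 1" and Cb1: "Cb \<ge> 1"
begin

text \<open>The decoration has to agree as well, because the noises of the two observed matrices are
  independent.\<close>

definition on_path :: "decoration \<Rightarrow> nat \<Rightarrow> nat \<Rightarrow> bool" where
  "on_path d i j \<longleftrightarrow> (\<exists>q<l. w q = d \<and> b q = j \<and> (i = a q \<or> i = a (Suc q)))"

text \<open>With \<open>amp ^ 2 = lamd d / n\<close>, a signal edge of T contributes
  \<open>amp\<close>, while a shared noise edge contributes \<open>1 / amp\<close>, since it also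
  removes the amplitude of the same edge of S. Together with \<open>lamd d\<close> from the weight
  of T and the normalisation \<open>1 / N\<close>, two edges give these three values.\<close>

definition edge_wt :: "decoration \<Rightarrow> bool \<Rightarrow> bool \<Rightarrow> real" where
  "edge_wt d f g = (if f \<and> g then real n / real N else if f \<or> g then lamd d / real N
     else (lamd d)\<^sup>2 / (real n * real N))"

text \<open>The weight at the a-vertex between two steps. Off S a change of decoration yields
  \<open>rho\<close> twice, from the weight of T and from the moment of the prior. On S the crude
  constant \<open>Cq\<close> suffices, except while T follows S through noise edges: a constant
  there would replace \<open>gam ^ k\<close> by \<open>(Cq * gam) ^ k\<close>.\<close>

fun head_wt :: "wstep \<Rightarrow> decoration \<Rightarrow> bool \<Rightarrow> real" where
  "head_wt (d, j, i, f, g) d' f' =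
    (if i \<in> a ` {..l} then if g \<and> f' then 1 else Cq else if d = d' then 1 else rho\<^sup>2)"

text \<open>At a b-vertex shared with S each of the two Gaussian families has a moment of order at
  most 4, hence at most 3 in absolute value; this is why \<open>Cb\<close> becomes 9. As in
  \<open>head_wt\<close>, the weight is 1 while T follows the noise.\<close>

definition mid_wt :: "nat \<Rightarrow> bool \<Rightarrow> bool \<Rightarrow> real" where
  "mid_wt j f g = (if j \<in> b ` {..<l} \<and> \<not> (f \<and> g) then Cb else 1)"

text \<open>All that is kept of the self-avoidance of T: consecutive a-vertices differ, and so do
  consecutive b-vertices if the edges on both sides of the a-vertex between them are noise. This
  prevents a walk that follows S from turning round.\<close>

fun admits :: "wstep \<Rightarrow> wstep \<Rightarrow> bool" where
  "admits (d, j, i, f, g) (d', j', i', f', g') \<longleftrightarrow> (f' \<longrightarrow> on_path d' i j') \<and>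
     (g' \<longrightarrow> on_path d' i' j') \<and> (g \<and> f' \<longrightarrow> j' \<noteq> j) \<and> i' \<noteq> i"

fun step_wt :: "wstep \<Rightarrow> wstep \<Rightarrow> real" where
  "step_wt s (d', j', i', f', g') = (if admits s (d', j', i', f', g')
     then head_wt s d' f' * mid_wt j' f' g' * edge_wt d' f' g' else 0)"

fun end_wt :: "wstep \<Rightarrow> real" where
  "end_wt (d, j, i, f, g) = (if i = a l then if g then 1 else Cq else 0)"

definition steps :: "wstep set" where
  "steps = UNIV \<times> {..<N} \<times> {..<n} \<times> UNIV \<times> UNIV"

primrec walk_sum :: "nat \<Rightarrow> wstep \<Rightarrow> real" where
  "walk_sum 0 s = end_wt s"
| "walk_sum (Suc k) s = (\<Sum>s'\<in>steps. step_wt s s' * walk_sum k s')"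

lemma head_wt_nonneg: "head_wt s d' f' \<ge> 0"
  using Cq1 rho01 by (cases s) auto

lemma edge_wt_nonneg: "edge_wt d f g \<ge> 0"
  using lamd_pos[of d] by (auto simp: edge_wt_def)

lemma mid_wt_nonneg: "mid_wt j f g \<ge> 0"
  using Cb1 by (auto simp: mid_wt_def)

lemma step_wt_nonneg: "step_wt s s' \<ge> 0"
  by (cases s') (auto intro!: mult_nonneg_nonneg head_wt_nonneg edge_wt_nonneg mid_wt_nonneg)

lemma sum_steps:
  fixes F :: "wstep \<Rightarrow> real"
  shows "(\<Sum>s\<in>steps. F s) =
    (\<Sum>d\<in>UNIV. \<Sum>j<N. \<Sum>i<n. F (d, j, i, False, False)) + (\<Sum>d\<in>UNIV. \<Sum>j<N. \<Sum>i<n. F (d, j, i, False, True)) +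
    (\<Sum>d\<in>UNIV. \<Sum>j<N. \<Sum>i<n. F (d, j, i, True, False)) + (\<Sum>d\<in>UNIV. \<Sum>j<N. \<Sum>i<n. F (d, j, i, True, True))"
  unfolding steps_def
  by (simp only: sum.cartesian_product' UNIV_bool) (simp add: sum.distrib)

lemma sum3_delta_le:
  fixes c :: real and d0 :: decoration
  assumes "c \<ge> 0"
  shows "(\<Sum>d\<in>UNIV. \<Sum>j<N. \<Sum>i<n. if (d, j, i) = (d0, j0, i0) then c else 0) \<le> c"
proof -
  have "(\<Sum>d\<in>UNIV. \<Sum>j<N. \<Sum>i<n. if (d, j, i) = (d0, j0, i0) then c else 0)
     = (\<Sum>t\<in>UNIV \<times> {..<N} \<times> {..<n}. if t = (d0, j0, i0) then c else 0)"
    by (simp only: sum.cartesian_product')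
  also have "\<dots> \<le> c" using assms by (subst sum.delta) auto
  finally show ?thesis .
qed

lemma sum2_delta_le:
  fixes c :: real and d0 :: decoration
  assumes "c \<ge> 0"
  shows "(\<Sum>d\<in>UNIV. \<Sum>j<N. if (d, j) = (d0, j0) then c else 0) \<le> c"
proof -
  have "(\<Sum>d\<in>UNIV. \<Sum>j<N. if (d, j) = (d0, j0) then c else 0)
     = (\<Sum>t\<in>UNIV \<times> {..<N}. if t = (d0, j0) then c else 0)"
    by (simp only: sum.cartesian_product')
  also have "\<dots> \<le> c" using assms by (subst sum.delta) auto
  finally show ?thesis .
qed

lemma a_eq: "p \<le> l \<Longrightarrow> q \<le> l \<Longrightarrow> a p = a q \<longleftrightarrow> p = q"
  using inj_a by (auto simp: inj_on_def)

lemma b_eq: "p < l \<Longrightarrow> q < l \<Longrightarrow> b p = b q \<longleftrightarrow> p = q"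
  using inj_b by (auto simp: inj_on_def)

lemma on_path_a:
  assumes "p \<le> l"
  shows "on_path d (a p) j \<longleftrightarrow> (p < l \<and> d = w p \<and> j = b p) \<or> (0 < p \<and> d = w (p - 1) \<and> j = b (p - 1))"
proof
  assume "on_path d (a p) j"
  then obtain q where q: "q < l" "w q = d" "b q = j" "a p = a q \<or> a p = a (Suc q)"
    unfolding on_path_def by blast
  then have "p = q \<or> p = Suc q" using a_eq[of p q] a_eq[of p "Suc q"] assms by auto
  then show "(p < l \<and> d = w p \<and> j = b p) \<or> (0 < p \<and> d = w (p - 1) \<and> j = b (p - 1))" using q by auto
next
  assume "(p < l \<and> d = w p \<and> j = b p) \<or> (0 < p \<and> d = w (p - 1) \<and> j = b (p - 1))"
  then show "on_path d (a p) j"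
  proof
    assume "0 < p \<and> d = w (p - 1) \<and> j = b (p - 1)"
    then show ?thesis unfolding on_path_def using assms by (intro exI[of _ "p - 1"]) auto
  qed (auto simp: on_path_def)
qed

lemma on_path_in: "on_path d i j \<Longrightarrow> i \<in> a ` {..l} \<and> j \<in> b ` {..<l}"
  by (auto simp: on_path_def)

lemma on_path_ends:
  assumes "on_path d i j" "on_path d' i' j" "i' \<noteq> i" "i = a p" "p \<le> l"
  shows "(p < l \<and> (d', j, i') = (w p, b p, a (Suc p))) \<or>
         (0 < p \<and> (d', j, i') = (w (p - 1), b (p - 1), a (p - 1)))"
proof -
  obtain q where q: "q < l" "w q = d" "b q = j" "i = a q \<or> i = a (Suc q)"
    using assms(1) unfolding on_path_def by blast
  obtain q' where q': "q' < l" "w q' = d'" "b q' = j" "i' = a q' \<or> i' = a (Suc q')"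
    using assms(2) unfolding on_path_def by blast
  have "q' = q" using q q' b_eq by auto
  moreover have "p = q \<or> p = Suc q" using q assms(4,5) a_eq[of p q] a_eq[of p "Suc q"] by auto
  ultimately show ?thesis using q q' assms by auto
qed

lemma on_path_count:
  fixes c :: real
  assumes "c \<ge> 0"
  shows "(\<Sum>d\<in>UNIV. \<Sum>j<N. if on_path d i j then c else 0) \<le> (if i \<in> a ` {..l} then 2 * c else 0)"
proof (cases "i \<in> a ` {..l}")
  case True
  then obtain p where p: "p \<le> l" "i = a p" by auto
  have "(\<Sum>d\<in>UNIV. \<Sum>j<N. if on_path d i j then c else 0) \<le>
    (\<Sum>d\<in>UNIV. \<Sum>j<N. (if (d, j) = (w p, b p) then c else 0) + (if (d, j) = (w (p - 1), b (p - 1)) then c else 0))"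
    by (intro sum_mono) (use assms p on_path_a[OF p(1)] in auto)
  also have "\<dots> \<le> 2 * c"
    using sum2_delta_le[OF assms, of "w p" "b p"] sum2_delta_le[OF assms, of "w (p - 1)" "b (p - 1)"]
    by (simp add: sum.distrib)
  finally show ?thesis using True by simp
next
  case False
  then have "\<not> on_path d i j" for d j using on_path_in by blast
  then show ?thesis using False by simp
qed

lemma sum_a: 
  fixes c :: real
  assumes "c \<ge> 0"
  shows "(\<Sum>i<n. if i \<in> a ` {..l} then c else 0) = (real l + 1) * c"
proof -
  have "(\<Sum>i<n. if i \<in> a ` {..l} then c else 0) = (\<Sum>i\<in>a ` {..l}. c)"
    by (rule sum.mono_neutral_cong_right) (use a_lt in auto)
  then show ?thesis using card_image[OF inj_a] by simp
qed

lemma sum_mid_wt: "(\<Sum>j<N. mid_wt j f g) \<le> real N + Cb * real l"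
proof -
  have "(\<Sum>j<N. mid_wt j f g) \<le> (\<Sum>j<N. 1 + (if j \<in> b ` {..<l} then Cb else 0))"
    by (intro sum_mono) (use Cb1 in \<open>auto simp: mid_wt_def\<close>)
  also have "\<dots> = real N + (\<Sum>j<N. if j \<in> b ` {..<l} then Cb else 0)" by (simp add: sum.distrib)
  also have "(\<Sum>j<N. if j \<in> b ` {..<l} then Cb else 0) = (\<Sum>j\<in>b ` {..<l}. Cb)"
    by (rule sum.mono_neutral_cong_right) (use b_lt in auto)
  also have "\<dots> = Cb * real l" using card_image[OF inj_b] by simp
  finally show ?thesis .
qed

end

section \<open>A potential that dominates the walk sums\<close>

text \<open>The inequalities are those demanded by one induction step for \<open>pot\<close>. The
  constants \<open>c1\<close> and \<open>c2\<close> weigh vertices of S entered by a noise or by a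
  signal edge, \<open>c5\<close> pays for the fraction of order \<open>l / n\<close> of steps that
  meet S, and \<open>c6\<close> for jumps onto S at a position from which S is followed to its end.
  There is no circularity: \<open>c1\<close> needs only the gap \<open>A - gam\<close>,
  \<open>c2\<close> needs \<open>c1\<close>, and \<open>c5\<close>, \<open>c6\<close> need
  both.\<close>

locale walk_potential = ref_path +
  fixes A gam L Q H c1 c2 c5 c6 :: real and phi :: "decoration \<Rightarrow> real" and phim phiM :: real
  assumes gam: "real n = gam * real N" and L: "lamd d \<le> L"
    and A: "gam < A" and H: "(real l + 1) / real n \<le> H" and Q: "1 + Cb * gam * H \<le> Q"
    and phi: "0 < phim" "phim \<le> phi d" "phi d \<le> phiM"
    and eig: "(\<Sum>d'\<in>UNIV. (if d = d' then 1 else rho\<^sup>2) * (lamd d')\<^sup>2 * phi d') = A * phi d"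
    and c_nonneg: "c1 \<ge> 0" "c2 \<ge> 0" "c5 \<ge> 0" "c6 \<ge> 0"
    and c1: "(Cq * 2 * L\<^sup>2 * Q + 2 * Cq * Cb * L * gam) * phiM \<le> c1 * (A - gam)"
    and c2: "(Cq * 2 * L\<^sup>2 * Q + 2 * Cq * Cb * L * gam) * phiM + 2 * Cq * gam * c1 \<le> c2 * A"
    and c5_out: "Cb * gam * A * phiM + 2 * L\<^sup>2 * Q * c2 + 2 * Cb * L * gam * c1 \<le> c5 * phim"
    and c5_in1: "(Cq * 2 * L\<^sup>2 * Q + 2 * Cq * Cb * L * gam) * c2 + 2 * Cq * Cb * L * gam * c1 \<le> c1 * c5"
    and c5_in2: "(Cq * 2 * L\<^sup>2 * Q + 2 * Cq * Cb * L * gam) * c2 + 2 * Cq * Cb * L * gam * c1 \<le> c2 * c5"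
    and c6_out: "2 * L\<^sup>2 * Q * Cq + 2 * Cb * L * gam \<le> c6 * phim"
    and c6_in1: "(Cq * 2 * L\<^sup>2 * Q + 2 * Cq * Cb * L * gam) * Cq + 2 * Cq * Cb * L * gam \<le> c1 * c6"
    and c6_in2: "(Cq * 2 * L\<^sup>2 * Q + 2 * Cq * Cb * L * gam) * Cq + 2 * Cq * Cb * L * gam \<le> c2 * c6"
begin

lemma gam_pos: "gam > 0" 
proof -
  have "0 < gam * real N" using gam n_pos by (metis of_nat_0_less_iff)
  then show ?thesis using N_pos by (simp add: zero_less_mult_iff)
qed

lemma phi_nonneg: "phi d \<ge> 0"
  using phi(1) phi(2)[of d] by linarith

definition "h = (real l + 1) / real n"

lemma h: "0 \<le> h" "h \<le> H" using H by (auto simp: h_def)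

lemma inv_N: "x / real N = gam * x / real n"
  using gam n_pos N_pos gam_pos by (simp add: field_simps)

lemma L_pos: "L > 0" using lamd_pos[of Bullet] L[of Bullet] by linarith

text \<open>The amount \<open>al k * phi d / n\<close> is the potential off S with \<open>k\<close>
  steps left. One step multiplies it by the eigenvalue \<open>A\<close>; the corrections account for
  landings on S, and \<open>gam ^ k\<close> for a landing exactly \<open>k\<close> positions before
  the end of S.\<close>

primrec al :: "nat \<Rightarrow> real" where
  "al 0 = 1"
| "al (Suc k) = (A + c5 * h) * al k + c6 * gam ^ k"

lemma al_nonneg: "al k \<ge> 0"
  by (induction k) (use A gam_pos c_nonneg h in auto)

text \<open>The inhomogeneous term is geometric with ratio \<open>gam < A\<close>, so it costs only
  a bounded factor. The extra summand on the left makes the induction homogeneous.\<close>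

lemma al_le: "al k + c6 / (A - gam) * gam ^ k \<le> (A + c5 * h) ^ k * (1 + c6 / (A - gam))"
proof (induction k)
  case (Suc k)
  define e where "e = c6 / (A - gam)"
  have e: "e \<ge> 0" "e * (A - gam) = c6" using A c_nonneg by (auto simp: e_def)
  have "al (Suc k) + e * gam ^ Suc k = (A + c5 * h) * al k + (e * A) * gam ^ k"
    using e(2) by (simp add: algebra_simps)
  also have "\<dots> \<le> (A + c5 * h) * al k + (e * (A + c5 * h)) * gam ^ k"
    using e gam_pos h c_nonneg by (intro add_left_mono mult_right_mono mult_left_mono) auto
  also have "\<dots> = (A + c5 * h) * (al k + e * gam ^ k)" by (simp add: algebra_simps)
  also have "\<dots> \<le> (A + c5 * h) * ((A + c5 * h) ^ k * (1 + e))"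
    using Suc gam_pos A h c_nonneg unfolding e_def by (intro mult_left_mono) auto
  finally show ?case by (simp add: e_def mult.assoc)
qed simp

text \<open>Off the reference path the potential follows the eigenvector \<open>phi\<close>. The additional terms on the reference path account
  for the walk that follows it to its end; \<open>j \<noteq> b (l - k)\<close> says that the walk arrived from the other side.\<close>

fun pot :: "nat \<Rightarrow> wstep \<Rightarrow> real" where
  "pot k (d, j, i, f, g) =
    (if i \<notin> a ` {..l} then al k * phi d / real n
     else if g then c1 * al k / real n + (if k \<le> l \<and> i = a (l - k) \<and> (k = 0 \<or> j \<noteq> b (l - k)) then gam ^ k else 0)
     else c2 * al k / real n + (if k \<le> l \<and> i = a (l - k) then Cq * gam ^ k else 0))"

abbreviation "step_sum k s f g \<equiv> (\<Sum>d\<in>UNIV. \<Sum>j<N. \<Sum>i<n. step_wt s (d, j, i, f, g) * pot k (d, j, i, f, g))"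

lemma pot_nonneg: "pot k s \<ge> 0"
  using al_nonneg[of k] c_nonneg gam_pos Cq1 phi_nonneg
  by (cases s) (auto intro!: add_nonneg_nonneg mult_nonneg_nonneg divide_nonneg_nonneg)

text \<open>A step ending with a signal edge may land anywhere. The three terms count landings off
  S, on the \<open>l + 1\<close> vertices of S, and on the one vertex from which the remaining
  \<open>k\<close> steps can follow S to its end.\<close>

lemma sum_pot_out:
  "(\<Sum>i<n. pot k (d, j, i, f, False)) \<le> al k * phi d + h * c2 * al k + Cq * gam ^ k"
proof -
  have nn: "0 \<le> al k * phi d / real n" "0 \<le> c2 * al k / real n" "0 \<le> Cq * gam ^ k"
    using al_nonneg[of k] c_nonneg gam_pos Cq1 phi(1) phi(2)[of d] by auto
  have "(\<Sum>i<n. pot k (d, j, i, f, False)) \<le>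
    (\<Sum>i<n. al k * phi d / real n + (if i \<in> a ` {..l} then c2 * al k / real n else 0) +
       (if i = a (l - k) then Cq * gam ^ k else 0))"
    by (intro sum_mono) (use nn in auto)
  also have "\<dots> = al k * phi d + (real l + 1) * (c2 * al k / real n) + Cq * gam ^ k"
    using n_pos a_lt[of "l - k"] by (simp add: sum.distrib sum_a[OF nn(2)])
  finally show ?thesis by (simp add: h_def)
qed

lemma Q_ge: "1 + Cb * real l / real N \<le> 1 + Cb * gam * h" "1 + Cb * gam * h \<le> Q" "1 \<le> Q"
proof -
  have "Cb * real l / real N = gam * (Cb * real l) / real n" by (rule inv_N)
  also have "\<dots> \<le> Cb * gam * h"
    using gam_pos Cb1 n_pos by (simp add: h_def divide_right_mono algebra_simps)
  finally show "1 + Cb * real l / real N \<le> 1 + Cb * gam * h" by simp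
  have "Cb * gam * h \<le> Cb * gam * H" using h Cb1 gam_pos by (intro mult_left_mono) auto
  then show "1 + Cb * gam * h \<le> Q" using Q by simp
  moreover have "0 \<le> Cb * gam * h" using h Cb1 gam_pos by auto
  ultimately show "1 \<le> Q" by simp
qed

text \<open>Both vertices of the step are free. The \<open>N\<close> choices of \<open>j\<close>
  cancel \<open>1 / N\<close> in \<open>edge_wt\<close>, apart from the relative excess
  \<open>Cb * gam * h\<close> caused by the b-vertices of S; the remaining \<open>1 / n\<close> is
  the one that the potential carries.\<close>

lemma sum_FF:
  fixes hd :: "decoration \<Rightarrow> real"
  assumes hd: "\<And>d'. head_wt s d' False = hd d'"
  shows "step_sum k s False False \<le>
    (\<Sum>d\<in>UNIV. hd d * (lamd d)\<^sup>2 * (1 + Cb * gam * h) * (al k * phi d + h * c2 * al k + Cq * gam ^ k)) / real n"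
proof -
  have hd0: "hd d \<ge> 0" for d using head_wt_nonneg[of s d False] hd by simp
  have "(\<Sum>j<N. \<Sum>i<n. step_wt s (d, j, i, False, False) * pot k (d, j, i, False, False)) \<le>
     hd d * (lamd d)\<^sup>2 * (1 + Cb * gam * h) * (al k * phi d + h * c2 * al k + Cq * gam ^ k) / real n" for d
  proof -
    have "(\<Sum>j<N. \<Sum>i<n. step_wt s (d, j, i, False, False) * pot k (d, j, i, False, False)) \<le>
       (\<Sum>j<N. \<Sum>i<n. (hd d * mid_wt j False False * edge_wt d False False) * pot k (d, j, i, False, False))"
      using hd0[of d] mid_wt_nonneg edge_wt_nonneg
      by (intro sum_mono mult_right_mono pot_nonneg) (auto simp: hd)
    also have "\<dots> = (\<Sum>j<N. (hd d * mid_wt j False False * edge_wt d False False) * (\<Sum>i<n. pot k (d, j, i, False, False)))"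
      by (simp add: sum_distrib_left)
    also have "\<dots> \<le> (\<Sum>j<N. (hd d * mid_wt j False False * edge_wt d False False) * (al k * phi d + h * c2 * al k + Cq * gam ^ k))"
      using hd0[of d] mid_wt_nonneg edge_wt_nonneg
      by (intro sum_mono mult_left_mono sum_pot_out) auto
    also have "\<dots> = (\<Sum>j<N. mid_wt j False False) * (hd d * edge_wt d False False * (al k * phi d + h * c2 * al k + Cq * gam ^ k))"
      by (simp only: sum_distrib_right) (intro sum.cong, simp_all add: mult_ac)
    also have "\<dots> \<le> (real N * (1 + Cb * gam * h)) * (hd d * edge_wt d False False * (al k * phi d + h * c2 * al k + Cq * gam ^ k))"
    proof (rule mult_right_mono)
      have "real N + Cb * real l = real N * (1 + Cb * real l / real N)" using N_pos by (simp add: field_simps)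
      also have "\<dots> \<le> real N * (1 + Cb * gam * h)" by (intro mult_left_mono Q_ge) auto
      finally show "(\<Sum>j<N. mid_wt j False False) \<le> real N * (1 + Cb * gam * h)"
        using sum_mid_wt[of False False] by linarith
      show "0 \<le> hd d * edge_wt d False False * (al k * phi d + h * c2 * al k + Cq * gam ^ k)"
        using hd0[of d] edge_wt_nonneg[of d False False] al_nonneg[of k] phi(1) phi(2)[of d] h c_nonneg Cq1 gam_pos
        by (intro mult_nonneg_nonneg add_nonneg_nonneg) auto
    qed
    also have "\<dots> = hd d * (lamd d)\<^sup>2 * (1 + Cb * gam * h) * (al k * phi d + h * c2 * al k + Cq * gam ^ k) / real n"
      using N_pos n_pos by (simp add: edge_wt_def)
    finally show ?thesis .
  qed
  then show ?thesis unfolding sum_divide_distrib by (intro sum_mono) auto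
qed

text \<open>The step starts along S, which leaves at most two choices of \<open>j\<close>. The
  factor \<open>1 / N = gam / n\<close> is therefore not compensated by a sum, and this is the price
  of leaving S.\<close>

lemma sum_TF:
  "step_sum k s True False \<le>
    2 * Cq * Cb * L * gam * (al k * phiM + h * c2 * al k + Cq * gam ^ k) / real n
    \<and> (fst (snd (snd s)) \<notin> a ` {..l} \<longrightarrow> 
     step_sum k s True False = 0)"
proof -
  obtain d0 j0 i0 f0 g0 where s: "s = (d0, j0, i0, f0, g0)" by (metis prod.exhaust)
  define Y where "Y = al k * phiM + h * c2 * al k + Cq * gam ^ k"
  have phiM: "phiM \<ge> 0" using phi(1) phi(2,3)[of Bullet] by linarith
  have Y: "Y \<ge> 0" using phiM al_nonneg[of k] h c_nonneg Cq1 gam_pos unfolding Y_def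
    by (intro mult_nonneg_nonneg add_nonneg_nonneg) auto
  define c where "c = Cq * Cb * (L / real N) * Y"
  have c: "c \<ge> 0" unfolding c_def using Cq1 Cb1 L_pos Y by auto
  have "step_sum k s True False \<le>
     (\<Sum>d\<in>UNIV. \<Sum>j<N. if on_path d i0 j then c else 0)"
  proof (intro sum_mono)
    fix d j
    show "(\<Sum>i<n. step_wt s (d, j, i, True, False) * pot k (d, j, i, True, False)) \<le> (if on_path d i0 j then c else 0)"
    proof (cases "on_path d i0 j")
      case True
      have "(\<Sum>i<n. step_wt s (d, j, i, True, False) * pot k (d, j, i, True, False)) \<le>
         (\<Sum>i<n. (Cq * Cb * (L / real N)) * pot k (d, j, i, True, False))"
      proof (intro sum_mono mult_right_mono pot_nonneg)
        fix i
        have "head_wt s d True \<le> Cq" using Cq1 on_path_in[OF True] by (auto simp: s)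
        moreover have "mid_wt j True False \<le> Cb" using Cb1 by (auto simp: mid_wt_def)
        moreover have "edge_wt d True False \<le> L / real N" using L[of d] by (auto simp: edge_wt_def divide_right_mono)
        ultimately have "head_wt s d True * mid_wt j True False * edge_wt d True False \<le> Cq * Cb * (L / real N)"
          using head_wt_nonneg[of s] mid_wt_nonneg edge_wt_nonneg Cq1 Cb1
          by (intro mult_mono) auto
        then show "step_wt s (d, j, i, True, False) \<le> Cq * Cb * (L / real N)"
          using Cq1 Cb1 L_pos by auto
      qed
      also have "\<dots> \<le> (Cq * Cb * (L / real N)) * (al k * phi d + h * c2 * al k + Cq * gam ^ k)"
        unfolding sum_distrib_left[symmetric]
        using Cq1 Cb1 L_pos by (intro mult_left_mono sum_pot_out) auto
      also have "\<dots> \<le> c" unfolding c_def Y_def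
        using Cq1 Cb1 L_pos phi(3)[of d] al_nonneg[of k] by (intro mult_left_mono add_right_mono) auto
      finally show ?thesis using True by simp
    qed (auto simp: s)
  qed
  also note on_path_count[OF c, of i0]
  finally have 1: "step_sum k s True False \<le>
     (if i0 \<in> a ` {..l} then 2 * c else 0)" .
  have 2: "0 \<le> step_sum k s True False"
    by (intro sum_nonneg mult_nonneg_nonneg step_wt_nonneg pot_nonneg)
  have "2 * c = 2 * Cq * Cb * L * gam * Y / real n" by (simp add: c_def inv_N[of L])
  then show ?thesis using 1 2 c unfolding Y_def s by (auto split: if_splits)
qed

text \<open>The order of summation is exchanged: for a given endpoint \<open>i\<close> on S at most
  two pairs \<open>(d, j)\<close> lie on S, after which \<open>i\<close> runs over
  \<open>l + 1\<close> positions, one of which carries the term \<open>gam ^ k\<close>.\<close>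

lemma sum_FT:
  fixes hd :: real
  assumes hd: "\<And>d'. head_wt s d' False \<le> hd" 
  shows "step_sum k s False True \<le>
    hd * Cb * L * gam * (2 * h * c1 * al k + 2 * gam ^ k) / real n"
proof -
  have hd0: "hd \<ge> 0" using hd[of Bullet] head_wt_nonneg[of s Bullet False] by linarith
  define c where "c = hd * Cb * (L / real N)"
  have c: "c \<ge> 0" unfolding c_def using hd0 Cb1 L_pos by auto
  define U where "U i = (if i \<in> a ` {..l} then c1 * al k / real n else 0) + (if i = a (l - k) then gam ^ k else 0)" for i
  have nn: "0 \<le> c1 * al k / real n" "0 \<le> gam ^ k" using al_nonneg[of k] c_nonneg gam_pos by auto
  have U: "U i \<ge> 0" for i unfolding U_def using nn by auto
  have "step_sum k s False True \<le>
    (\<Sum>d\<in>UNIV. \<Sum>j<N. \<Sum>i<n. if on_path d i j then c * U i else 0)"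
  proof (intro sum_mono)
    fix d j i
    have 1: "head_wt s d False * mid_wt j False True * edge_wt d False True \<le> hd * Cb * (L / real N)"
      using head_wt_nonneg[of s] mid_wt_nonneg edge_wt_nonneg Cb1 hd[of d] hd0 L[of d] L_pos
      by (intro mult_mono) (auto simp: mid_wt_def edge_wt_def divide_right_mono less_imp_le[OF lamd_pos])
    have 2: "pot k (d, j, i, False, True) \<le> U i" if "on_path d i j"
      using on_path_in[OF that] nn by (auto simp: U_def)
    have "head_wt s d False * mid_wt j False True * edge_wt d False True * pot k (d, j, i, False, True) \<le> c * U i" if "on_path d i j"
      unfolding c_def by (rule mult_mono[OF 1 2[OF that] _ pot_nonneg]) (use hd0 Cb1 L_pos in auto)
    moreover have "admits s (d, j, i, False, True) \<Longrightarrow> on_path d i j" by (cases s) auto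
    moreover have "0 \<le> c * U i" using c U by simp
    ultimately show "step_wt s (d, j, i, False, True) * pot k (d, j, i, False, True) \<le> (if on_path d i j then c * U i else 0)"
      by auto
  qed
  also have "\<dots> = (\<Sum>i<n. \<Sum>d\<in>UNIV. \<Sum>j<N. if on_path d i j then c * U i else 0)"
    by (simp add: sum.swap[of _ "{..<n}"])
  also have "\<dots> \<le> (\<Sum>i<n. if i \<in> a ` {..l} then 2 * (c * U i) else 0)"
    by (intro sum_mono on_path_count) (use c U in auto)
  also have "\<dots> \<le> (\<Sum>i<n. 2 * c * ((if i \<in> a ` {..l} then c1 * al k / real n else 0) + (if i = a (l - k) then gam ^ k else 0)))"
    using c U by (intro sum_mono) (auto simp: U_def)
  also have "\<dots> = 2 * c * ((real l + 1) * (c1 * al k / real n) + gam ^ k)"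
    unfolding sum_distrib_left[symmetric] using a_lt[of "l - k"] by (simp add: sum.distrib sum_a[OF nn(1)])
  also have "\<dots> = hd * Cb * L * gam * (2 * h * c1 * al k + 2 * gam ^ k) / real n"
    by (simp add: c_def inv_N[of L] h_def field_simps)
  finally show ?thesis .
qed

text \<open>The alternative \<open>i = a 0\<close> admits the fictitious step before the start,
  which counts as an arrival by noise although no edge of S leads there.\<close>

fun valid_step :: "wstep \<Rightarrow> bool" where
  "valid_step (d, j, i, f, g) \<longleftrightarrow> (g \<longrightarrow> i = a 0 \<or> on_path d i j)"

text \<open>Following S moves one position at cost \<open>n / N = gam\<close>. After an arrival by
  noise the condition on consecutive b-vertices leaves a single direction, so the coefficient of
  \<open>c1\<close> is \<open>gam\<close> and not \<open>2 * gam\<close>; this matters because only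
  \<open>gam < A\<close> is available. After an arrival by signal both directions are possible, and
  the factor \<open>2 * Cq\<close> is absorbed in the choice of \<open>c2\<close>.\<close>

lemma sum_TT:
  assumes s: "s = (d0, j0, i0, f0, g0)" and v: "valid_step s" and p: "i0 = a p" "p \<le> l"
  shows "step_sum k s True True \<le>
    (if g0 then gam * c1 * al k / real n + (if Suc k \<le> l \<and> i0 = a (l - Suc k) \<and> j0 \<noteq> b (l - Suc k) then gam ^ Suc k else 0)
     else Cq * (2 * gam * c1 * al k / real n + (if Suc k \<le> l \<and> i0 = a (l - Suc k) then gam ^ Suc k else 0)))"
proof -
  have gN: "real n / real N = gam" using gam N_pos by simp
  define hd where "hd = (if g0 then 1 else Cq)"
  have hd: "hd \<ge> 1" using Cq1 by (simp add: hd_def)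
  \<comment> \<open>\<open>cp\<close> and \<open>cm\<close> say that a move forwards or backwards is
    possible. Only the forward move can earn \<open>E\<close>, the term for reaching the end of S in
    the remaining \<open>k\<close> steps.\<close>
  define cp where "cp \<longleftrightarrow> p < l \<and> (g0 \<longrightarrow> j0 \<noteq> b p)"
  define cm where "cm \<longleftrightarrow> 0 < p \<and> (g0 \<longrightarrow> j0 \<noteq> b (p - 1))"
  define X where "X = c1 * al k / real n"
  have X: "X \<ge> 0" using al_nonneg[of k] c_nonneg by (auto simp: X_def)
  define E where "E = (if Suc p + k = l then gam ^ k else 0)"
  have E: "E \<ge> 0" using gam_pos by (simp add: E_def)
  have "step_sum k s True True \<le>
    (\<Sum>d\<in>UNIV. \<Sum>j<N. \<Sum>i<n. (if (d, j, i) = (w p, b p, a (Suc p)) then if cp then hd * gam * (X + E) else 0 else 0) +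
        (if (d, j, i) = (w (p - 1), b (p - 1), a (p - 1)) then if cm then hd * gam * X else 0 else 0))"
  proof (intro sum_mono)
    fix d j i
    show "step_wt s (d, j, i, True, True) * pot k (d, j, i, True, True) \<le>
        (if (d, j, i) = (w p, b p, a (Suc p)) then if cp then hd * gam * (X + E) else 0 else 0) +
        (if (d, j, i) = (w (p - 1), b (p - 1), a (p - 1)) then if cm then hd * gam * X else 0 else 0)" (is "?l \<le> ?r")
    proof (cases "admits s (d, j, i, True, True)")
      case False
      then show ?thesis using hd gam_pos X E by auto
    next
      case True
      then have ad: "on_path d i0 j" "on_path d i j" "g0 \<longrightarrow> j \<noteq> j0" "i \<noteq> i0" by (auto simp: s)
      have wt: "step_wt s (d, j, i, True, True) = hd * gam"
        using True p by (simp add: s hd_def mid_wt_def edge_wt_def gN)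
      from on_path_ends[OF ad(1,2,4) p] show ?thesis
      proof
        assume 1: "p < l \<and> (d, j, i) = (w p, b p, a (Suc p))"
        then have cp using ad by (auto simp: cp_def)
        have "pot k (d, j, i, True, True) \<le> X + E"
          using 1 a_eq[of "Suc p" "l - k"] gam_pos by (auto simp: X_def E_def)
        then have "hd * gam * pot k (d, j, i, True, True) \<le> hd * gam * (X + E)"
          using hd gam_pos by (intro mult_left_mono) auto
        also have "\<dots> \<le> ?r" using 1 \<open>cp\<close> hd gam_pos X by simp
        finally show ?thesis unfolding wt .
      next
        assume 1: "0 < p \<and> (d, j, i) = (w (p - 1), b (p - 1), a (p - 1))"
        then have cm using ad by (auto simp: cm_def)
        \<comment> \<open>A backward move arrives through \<open>b (p - 1)\<close>, that is from the
          side towards the end of S, so the term \<open>gam ^ k\<close> is absent even if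
          \<open>p - 1 = l - k\<close>; the case \<open>k = 0\<close> would need
          \<open>p = l + 1\<close>.\<close>
        have "pot k (d, j, i, True, True) = X"
          using 1 p(2) a_eq[of "p - 1" "l - k"] by (auto simp: X_def)
        then have "hd * gam * pot k (d, j, i, True, True) = hd * gam * X" by simp
        also have "\<dots> \<le> ?r" using 1 \<open>cm\<close> hd gam_pos X E by simp
        finally show ?thesis unfolding wt .
      qed
    qed
  qed
  also have "\<dots> \<le> (if cp then hd * gam * (X + E) else 0) + (if cm then hd * gam * X else 0)"
    unfolding sum.distrib by (intro add_mono sum3_delta_le) (use hd gam_pos X E in auto)
  also have "\<dots> \<le> (if g0 then gam * X + (if cp then gam * E else 0) else Cq * (2 * gam * X + (if cp then gam * E else 0)))"
  proof (cases g0)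
    case True
    \<comment> \<open>If \<open>0 < p\<close>, the noise edge of arrival ends in one of the two
      b-vertices next to \<open>a p\<close> on S and blocks that direction; if \<open>p = 0\<close>,
      there is no backward move.\<close>
    have "\<not> (cp \<and> cm)"
    proof
      assume "cp \<and> cm"
      then have c: "0 < p" "p < l" "j0 \<noteq> b p" "j0 \<noteq> b (p - 1)" using True by (auto simp: cp_def cm_def)
      have "i0 \<noteq> a 0" using c p a_eq[of p 0] by auto
      then have "on_path d0 (a p) j0" using v True p by (simp add: s)
      then show False using on_path_a[OF p(2)] c by auto
    qed
    then show ?thesis using True gam_pos X E by (auto simp: hd_def algebra_simps)
  next
    case False
    then show ?thesis using gam_pos X E Cq1 by (auto simp: hd_def algebra_simps)
  qed
  also have "(if cp then gam * E else 0) = (if Suc k \<le> l \<and> i0 = a (l - Suc k) \<and> (g0 \<longrightarrow> j0 \<noteq> b (l - Suc k)) then gam ^ Suc k else 0)"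
  proof -
    have 1: "a p = a (l - Suc k) \<longleftrightarrow> p = l - Suc k" by (rule a_eq[OF p(2)]) simp
    have 2: "Suc p + k = l \<longleftrightarrow> Suc k \<le> l \<and> i0 = a (l - Suc k)" unfolding p(1) 1 by arith
    have 3: "Suc p + k = l \<Longrightarrow> l - Suc k = p \<and> p < l" by arith
    show ?thesis
    proof (cases "Suc p + k = l")
      case True
      then show ?thesis using 2 3 by (simp add: cp_def E_def)
    qed (use 2 in \<open>auto simp: E_def\<close>)
  qed
  finally have fin: "step_sum k s True True \<le>
    (if g0 then gam * X + (if Suc k \<le> l \<and> i0 = a (l - Suc k) \<and> (g0 \<longrightarrow> j0 \<noteq> b (l - Suc k)) then gam ^ Suc k else 0)
     else Cq * (2 * gam * X + (if Suc k \<le> l \<and> i0 = a (l - Suc k) \<and> (g0 \<longrightarrow> j0 \<noteq> b (l - Suc k)) then gam ^ Suc k else 0)))" .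
  show ?thesis
    by (rule order_trans[OF fin]) (simp add: X_def mult.assoc)
qed

text \<open>The eigenvector equation produces the main term with factor exactly \<open>A\<close>.
  What remains is either of relative size \<open>h\<close>, covered by \<open>c5\<close>, or
  proportional to \<open>gam ^ k\<close>, covered by \<open>c6\<close>.\<close>

lemma walk_sum_out:
  assumes s: "s = (d0, j0, i0, f0, g0)" and out: "i0 \<notin> a ` {..l}"
  shows "(\<Sum>s'\<in>steps. step_wt s s' * pot k s') \<le> pot (Suc k) s"
proof -
  let ?g = "gam ^ k"
  have nn: "al k \<ge> 0" "?g \<ge> 0" "h \<ge> 0" using al_nonneg gam_pos h by auto
  have phiM: "phiM \<ge> 0" using phi(1) phi(2,3)[of Bullet] by linarith
  let ?r = "\<lambda>d. if d0 = d then 1 else rho\<^sup>2"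
  have r: "0 \<le> ?r d" "?r d \<le> 1" for d using rho01 by (auto simp: power_le_one)
  have FF: "step_sum k s False False \<le>
    (\<Sum>d\<in>UNIV. ?r d * (lamd d)\<^sup>2 * (1 + Cb * gam * h) * (al k * phi d + h * c2 * al k + Cq * gam ^ k)) / real n"
    by (rule sum_FF) (use out in \<open>auto simp: s\<close>)
  have FT: "step_sum k s False True \<le>
    1 * Cb * L * gam * (2 * h * c1 * al k + 2 * gam ^ k) / real n"
    by (rule sum_FT) (use out rho01 in \<open>auto simp: s power_le_one\<close>)
  have TF: "step_sum k s True False = 0"
    using sum_TF[of s k] out by (simp add: s)
  have TT: "step_sum k s True True = 0"
  proof -
    have "\<not> on_path d i0 j" for d j using on_path_in out by blast
    then show ?thesis by (simp add: s)
  qed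
  \<comment> \<open>Only the main term keeps \<open>1 + Cb * gam * h\<close>, where it has to stay
    close to 1; in the small terms it is replaced by the constant \<open>Q\<close>.\<close>
  have "(\<Sum>d\<in>UNIV. ?r d * (lamd d)\<^sup>2 * (1 + Cb * gam * h) * (al k * phi d + h * c2 * al k + Cq * ?g)) \<le>
     (\<Sum>d\<in>UNIV. (?r d * (lamd d)\<^sup>2 * phi d) * (al k * (1 + Cb * gam * h)) + L\<^sup>2 * Q * (h * c2 * al k + Cq * ?g))"
  proof (intro sum_mono)
    fix d
    have "?r d * (lamd d)\<^sup>2 \<le> 1 * L\<^sup>2"
      by (intro mult_mono r power_mono) (use L[of d] lamd_pos[of d] in auto)
    then have "?r d * (lamd d)\<^sup>2 * (1 + Cb * gam * h) \<le> L\<^sup>2 * Q"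
      using Q_ge h Cb1 gam_pos by (intro mult_mono) auto
    then have "?r d * (lamd d)\<^sup>2 * (1 + Cb * gam * h) * (h * c2 * al k + Cq * ?g) \<le> L\<^sup>2 * Q * (h * c2 * al k + Cq * ?g)"
      using nn c_nonneg Cq1 by (intro mult_right_mono) auto
    then show "?r d * (lamd d)\<^sup>2 * (1 + Cb * gam * h) * (al k * phi d + h * c2 * al k + Cq * ?g) \<le>
      (?r d * (lamd d)\<^sup>2 * phi d) * (al k * (1 + Cb * gam * h)) + L\<^sup>2 * Q * (h * c2 * al k + Cq * ?g)"
      by (simp add: algebra_simps)
  qed
  also have "\<dots> = A * phi d0 * (al k * (1 + Cb * gam * h)) + 2 * L\<^sup>2 * Q * (h * c2 * al k + Cq * ?g)"
    unfolding sum.distrib sum_distrib_right[symmetric] eig by (simp add: UNIV_decoration)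
  also have "\<dots> \<le> A * phi d0 * al k + h * al k * (Cb * gam * A * phiM) + 2 * L\<^sup>2 * Q * (h * c2 * al k + Cq * ?g)"
  proof -
    have "(h * al k * (Cb * gam * A)) * phi d0 \<le> (h * al k * (Cb * gam * A)) * phiM"
      using nn Cb1 gam_pos A phi(3) by (intro mult_left_mono) auto
    then show ?thesis by (simp add: algebra_simps)
  qed
  finally have FF': "(\<Sum>d\<in>UNIV. ?r d * (lamd d)\<^sup>2 * (1 + Cb * gam * h) * (al k * phi d + h * c2 * al k + Cq * ?g)) / real n \<le>
    (A * phi d0 * al k + h * al k * (Cb * gam * A * phiM) + 2 * L\<^sup>2 * Q * (h * c2 * al k + Cq * ?g)) / real n"
    by (rule divide_right_mono) simp
  have "(\<Sum>s'\<in>steps. step_wt s s' * pot k s') \<le>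
    (A * phi d0 * al k + h * al k * (Cb * gam * A * phiM) + 2 * L\<^sup>2 * Q * (h * c2 * al k + Cq * ?g)) / real n +
     Cb * L * gam * (2 * h * c1 * al k + 2 * gam ^ k) / real n"
    using FF FF' FT TF TT sum_steps[of "\<lambda>s'. step_wt s s' * pot k s'"] unfolding mult_1 by linarith
  also have "\<dots> = (A * phi d0 * al k + h * al k * (Cb * gam * A * phiM + 2 * L\<^sup>2 * Q * c2 + 2 * Cb * L * gam * c1) +
      ?g * (2 * L\<^sup>2 * Q * Cq + 2 * Cb * L * gam)) / real n"
    by (simp add: add_divide_distrib[symmetric] algebra_simps)
  also have "\<dots> \<le> (A * phi d0 * al k + h * al k * (c5 * phi d0) + ?g * (c6 * phi d0)) / real n"
  proof (intro divide_right_mono add_mono mult_left_mono order_refl)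
    show "Cb * gam * A * phiM + 2 * L\<^sup>2 * Q * c2 + 2 * Cb * L * gam * c1 \<le> c5 * phi d0"
      using c5_out mult_left_mono[OF phi(2)[of d0] c_nonneg(3)] by linarith
    show "2 * L\<^sup>2 * Q * Cq + 2 * Cb * L * gam \<le> c6 * phi d0"
      using c6_out mult_left_mono[OF phi(2)[of d0] c_nonneg(4)] by linarith
  qed (use nn A gam_pos phi_nonneg in auto)
  also have "\<dots> = pot (Suc k) s" using out by (simp add: s algebra_simps)
  finally show ?thesis .
qed

lemma walk_sum_in:
  assumes s: "s = (d0, j0, i0, f0, g0)" and v: "valid_step s" and p: "i0 = a p" "p \<le> l"
  shows "(\<Sum>s'\<in>steps. step_wt s s' * pot k s') \<le> pot (Suc k) s"
proof -
  let ?g = "gam ^ k"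
  define E0 where "E0 = Cq * 2 * L\<^sup>2 * Q + 2 * Cq * Cb * L * gam"
  have nn: "al k \<ge> 0" "?g \<ge> 0" "h \<ge> 0" using al_nonneg gam_pos h by auto
  have phiM: "phiM \<ge> 0" using phi(1) phi(2,3)[of Bullet] by linarith
  define Y where "Y = al k * phiM + h * c2 * al k + Cq * ?g"
  have Y: "Y \<ge> 0" using phiM nn c_nonneg Cq1 unfolding Y_def
    by (intro mult_nonneg_nonneg add_nonneg_nonneg) auto
  have i0: "i0 \<in> a ` {..l}" using p by auto
  have FF: "step_sum k s False False \<le>
    (\<Sum>d\<in>UNIV. Cq * (lamd d)\<^sup>2 * (1 + Cb * gam * h) * (al k * phi d + h * c2 * al k + Cq * gam ^ k)) / real n"
    by (rule sum_FF) (use i0 in \<open>auto simp: s\<close>)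
  also have "\<dots> \<le> (\<Sum>d\<in>(UNIV::decoration set). Cq * L\<^sup>2 * Q * Y) / real n"
  proof (intro divide_right_mono sum_mono)
    fix d
    have 1: "(lamd d)\<^sup>2 \<le> L\<^sup>2" using L[of d] lamd_pos[of d] by (intro power_mono) auto
    have 2: "al k * phi d + h * c2 * al k + Cq * gam ^ k \<le> Y"
      unfolding Y_def using phi(3) nn by (intro add_mono mult_left_mono order_refl)
    have 3: "0 \<le> al k * phi d + h * c2 * al k + Cq * gam ^ k"
      using phi_nonneg nn c_nonneg Cq1 by (intro add_nonneg_nonneg mult_nonneg_nonneg) auto
    have 4: "0 \<le> 1 + Cb * gam * h" using nn Cb1 gam_pos by simp
    show "Cq * (lamd d)\<^sup>2 * (1 + Cb * gam * h) * (al k * phi d + h * c2 * al k + Cq * gam ^ k) \<le> Cq * L\<^sup>2 * Q * Y"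
      using Cq1 1 Q_ge(3) by (intro mult_mono Q_ge(2) 2 3 4) auto
  qed simp
  also have "\<dots> = Cq * 2 * L\<^sup>2 * Q * Y / real n" by (simp add: UNIV_decoration)
  finally have FF: "step_sum k s False False \<le>
    Cq * 2 * L\<^sup>2 * Q * Y / real n" .
  have FT: "step_sum k s False True \<le>
    Cq * Cb * L * gam * (2 * h * c1 * al k + 2 * gam ^ k) / real n"
    by (rule sum_FT) (use i0 in \<open>auto simp: s\<close>)
  have TF: "step_sum k s True False \<le>
    2 * Cq * Cb * L * gam * Y / real n"
    using sum_TF[of s k] unfolding Y_def by blast
  note TT = sum_TT[OF s v p, of k]
  have E: "step_sum k s False False +
     step_sum k s False True +
     step_sum k s True False \<le>
     (E0 * Y + Cq * Cb * L * gam * (2 * h * c1 * al k + 2 * ?g)) / real n"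
    using FF FT TF unfolding E0_def add_divide_distrib distrib_right by linarith
  also have "\<dots> = (al k * (E0 * phiM) + h * al k * (E0 * c2 + 2 * Cq * Cb * L * gam * c1) +
      ?g * (E0 * Cq + 2 * Cq * Cb * L * gam)) / real n"
    by (simp add: Y_def algebra_simps)
  finally have rest: "step_sum k s False False +
     step_sum k s False True +
     step_sum k s True False \<le>
     (al k * (E0 * phiM) + h * al k * (E0 * c2 + 2 * Cq * Cb * L * gam * c1) +
      ?g * (E0 * Cq + 2 * Cq * Cb * L * gam)) / real n" .
  show ?thesis
  proof (cases g0)
    case True
    have "(\<Sum>s'\<in>steps. step_wt s s' * pot k s') \<le> (al k * (E0 * phiM) + h * al k * (E0 * c2 + 2 * Cq * Cb * L * gam * c1) +
      ?g * (E0 * Cq + 2 * Cq * Cb * L * gam)) / real n + (gam * c1 * al k / real n +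
        (if Suc k \<le> l \<and> i0 = a (l - Suc k) \<and> j0 \<noteq> b (l - Suc k) then gam ^ Suc k else 0))"
      using rest TT sum_steps[of "\<lambda>s'. step_wt s s' * pot k s'"] unfolding if_P[OF True] by linarith
    also have "\<dots> = (al k * (E0 * phiM + gam * c1) + h * al k * (E0 * c2 + 2 * Cq * Cb * L * gam * c1) +
      ?g * (E0 * Cq + 2 * Cq * Cb * L * gam)) / real n +
        (if Suc k \<le> l \<and> i0 = a (l - Suc k) \<and> j0 \<noteq> b (l - Suc k) then gam ^ Suc k else 0)"
      by (simp add: add_divide_distrib[symmetric] algebra_simps)
    also have "\<dots> \<le> (al k * (c1 * A) + h * al k * (c1 * c5) + ?g * (c1 * c6)) / real n +
        (if Suc k \<le> l \<and> i0 = a (l - Suc k) \<and> j0 \<noteq> b (l - Suc k) then gam ^ Suc k else 0)"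
    proof (intro divide_right_mono add_mono mult_left_mono order_refl)
      show "E0 * phiM + gam * c1 \<le> c1 * A" using c1 by (simp add: E0_def algebra_simps)
    qed (use nn c5_in1 c6_in1 in \<open>auto simp: E0_def\<close>)
    also have "\<dots> = pot (Suc k) s" using i0 True by (simp add: s algebra_simps)
    finally show ?thesis .
  next
    case False
    have "(\<Sum>s'\<in>steps. step_wt s s' * pot k s') \<le> (al k * (E0 * phiM) + h * al k * (E0 * c2 + 2 * Cq * Cb * L * gam * c1) +
      ?g * (E0 * Cq + 2 * Cq * Cb * L * gam)) / real n + Cq * (2 * gam * c1 * al k / real n +
        (if Suc k \<le> l \<and> i0 = a (l - Suc k) then gam ^ Suc k else 0))"
      using rest TT sum_steps[of "\<lambda>s'. step_wt s s' * pot k s'"] unfolding if_not_P[OF False] by linarith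
    also have "\<dots> = (al k * (E0 * phiM + 2 * Cq * gam * c1) + h * al k * (E0 * c2 + 2 * Cq * Cb * L * gam * c1) +
      ?g * (E0 * Cq + 2 * Cq * Cb * L * gam)) / real n +
        (if Suc k \<le> l \<and> i0 = a (l - Suc k) then Cq * gam ^ Suc k else 0)"
      by (simp add: add_divide_distrib[symmetric] algebra_simps)
    also have "\<dots> \<le> (al k * (c2 * A) + h * al k * (c2 * c5) + ?g * (c2 * c6)) / real n +
        (if Suc k \<le> l \<and> i0 = a (l - Suc k) then Cq * gam ^ Suc k else 0)"
    proof (intro divide_right_mono add_mono mult_left_mono order_refl)
      show "E0 * phiM + 2 * Cq * gam * c1 \<le> c2 * A" using c2 by (simp add: E0_def algebra_simps)
    qed (use nn c5_in2 c6_in2 in \<open>auto simp: E0_def\<close>)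
    also have "\<dots> = pot (Suc k) s" using i0 False by (simp add: s algebra_simps)
    finally show ?thesis .
  qed
qed

lemma walk_sum_le_pot: "valid_step s \<Longrightarrow> walk_sum k s \<le> pot k s"
proof (induction k arbitrary: s)
  case 0
  obtain d0 j0 i0 f0 g0 where s: "s = (d0, j0, i0, f0, g0)" by (metis prod.exhaust)
  have "phi d0 \<ge> 0" using phi(1) phi(2)[of d0] by linarith
  then show ?case using c_nonneg by (auto simp: s)
next
  case (Suc k)
  obtain d0 j0 i0 f0 g0 where s: "s = (d0, j0, i0, f0, g0)" by (metis prod.exhaust)
  have "walk_sum (Suc k) s \<le> (\<Sum>s'\<in>steps. step_wt s s' * pot k s')"
  proof (simp, intro sum_mono)
    fix s' assume "s' \<in> steps"
    obtain d j i f g where s': "s' = (d, j, i, f, g)" by (metis prod.exhaust)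
    show "step_wt s s' * walk_sum k s' \<le> step_wt s s' * pot k s'"
    proof (cases "admits s s'")
      case True
      then have "valid_step s'" by (auto simp: s s')
      then show ?thesis by (intro mult_left_mono Suc step_wt_nonneg)
    qed (auto simp: s')
  qed
  also have "\<dots> \<le> pot (Suc k) s"
  proof (cases "i0 \<in> a ` {..l}")
    case True
    then obtain p where "i0 = a p" "p \<le> l" by blast
    then show ?thesis by (rule walk_sum_in[OF s Suc.prems])
  qed (rule walk_sum_out[OF s])
  finally show ?case .
qed

text \<open>The summand \<open>gam ^ l\<close> stands for the walk that follows S by noise from
  beginning to end; everything else has picked up a factor \<open>1 / n\<close>.\<close>

lemma walk_sum_start_le:
  "walk_sum l (d, j, a 0, f, True) \<le> c1 * ((A + c5 * h) ^ l * (1 + c6 / (A - gam))) / real n + gam ^ l"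
proof -
  have "walk_sum l (d, j, a 0, f, True) \<le> pot l (d, j, a 0, f, True)"
    using walk_sum_le_pot[of "(d, j, a 0, f, True)" l] by (simp only: valid_step.simps simp_thms)
  also have "\<dots> \<le> c1 * al l / real n + gam ^ l" using gam_pos by auto
  also have "\<dots> \<le> c1 * ((A + c5 * h) ^ l * (1 + c6 / (A - gam))) / real n + gam ^ l"
  proof (intro add_right_mono divide_right_mono mult_left_mono c_nonneg)
    have "0 \<le> c6 / (A - gam) * gam ^ l" using A c_nonneg gam_pos by auto
    then show "al l \<le> (A + c5 * h) ^ l * (1 + c6 / (A - gam))" using al_le[of l] by linarith
  qed auto
  finally show ?thesis .
qed

end

section \<open>Expectations of pairs of paths\<close>

lemma incident_a:
  assumes "simple u xs" "t \<le> length xs"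
  shows "{k \<in> {..<length xs} \<times> UNIV. fst (path_edge u xs k) = av u xs t} =
    (if t < length xs then {(t, False)} else {}) \<union> (if 0 < t then {(t - 1, True)} else {})"
  using assms av_eq[OF assms(1) _ assms(2)] by (auto simp: path_edge_def split: if_splits)

lemma incident_b:
  assumes "simple u xs" "t < length xs"
  shows "{k \<in> {..<length xs} \<times> UNIV. snd (path_edge u xs k) = bv xs t} = {(t, False), (t, True)}"
  using assms bv_eq[OF assms(1) _ assms(2)] by (auto simp: path_edge_def)

text \<open>The factor \<open>rho ^ card (changes w)\<close> distributed over the a-vertices, so
  that it can be compared with moments one vertex at a time.\<close>

definition change_wt :: "real \<Rightarrow> pstep list \<Rightarrow> nat \<Rightarrow> real" where
  "change_wt rho xs t = (if 0 < t \<and> t < length xs \<and> wv xs (t - 1) \<noteq> wv xs t then rho else 1)"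

lemma prod_change_wt: "(\<Prod>t\<le>length xs. change_wt rho xs t) = rho ^ card (changes (map fst xs))"
proof -
  have "(\<Prod>t\<le>length xs. change_wt rho xs t) = (\<Prod>t\<in>changes (map fst xs). rho)"
    by (rule prod.mono_neutral_cong_right) (auto simp: changes_def change_wt_def wv_def)
  then show ?thesis by simp
qed

lemma prod_vertex_delta:
  fixes f :: "nat \<Rightarrow> real"
  assumes "simple u xs" 
  shows "t \<le> length xs \<Longrightarrow> (\<Prod>r\<le>length xs. if av u xs r = av u xs t then f r else 1) = f t"
    and "i \<notin> av u xs ` {..length xs} \<Longrightarrow> (\<Prod>r\<le>length xs. if av u xs r = i then f r else 1) = 1"
proof -
  assume t: "t \<le> length xs"
  have "(\<Prod>r\<le>length xs. if av u xs r = av u xs t then f r else 1) = (\<Prod>r\<le>length xs. if t = r then f r else 1)"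
    by (intro prod.cong) (use av_eq[OF assms _ t] in auto)
  then show "(\<Prod>r\<le>length xs. if av u xs r = av u xs t then f r else 1) = f t" using t by simp
next
  assume i: "i \<notin> av u xs ` {..length xs}"
  then have "(if av u xs r = i then f r else 1) = 1" if "r \<le> length xs" for r using that by auto
  then show "(\<Prod>r\<le>length xs. if av u xs r = i then f r else 1) = 1" by (intro prod.neutral) auto
qed

text \<open>Spreads a product along a path over all vertex labels, so that factors of two different
  paths at the same label can be collected and estimated together.\<close>

lemma prod_over_vertices:
  fixes f :: "nat \<Rightarrow> real" and c :: "nat \<Rightarrow> nat" and n :: nat
  assumes "finite R" "\<And>r. r \<in> R \<Longrightarrow> c r < n"
  shows "(\<Prod>i<n. \<Prod>r\<in>R. if c r = i then f r else 1) = (\<Prod>r\<in>R. f r)"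
proof -
  have "(\<Prod>i<n. \<Prod>r\<in>R. if c r = i then f r else 1) = (\<Prod>r\<in>R. \<Prod>i<n. if c r = i then f r else 1)"
    by (rule prod.swap)
  also have "\<dots> = (\<Prod>r\<in>R. f r)" by (intro prod.cong) (use assms in \<open>auto simp: prod.delta'[OF finite_lessThan]\<close>)
  finally show ?thesis .
qed

lemma amp_pos: "lam > 0 \<Longrightarrow> mu > 0 \<Longrightarrow> n > 0 \<Longrightarrow> amp lam mu n d > 0"
  by (cases d) (auto simp: amp_def)

lemma amp_sq: "lam > 0 \<Longrightarrow> mu > 0 \<Longrightarrow> amp lam mu n d * amp lam mu n d = dval lam mu d / real n"
  by (cases d) (auto simp: amp_def dval_def)

lemma dval_pos: "lam > 0 \<Longrightarrow> mu > 0 \<Longrightarrow> dval lam mu d > 0"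
  by (cases d) (auto simp: dval_def)

lemma prod_bool_index:
  fixes f :: "nat \<times> bool \<Rightarrow> real"
  shows "(\<Prod>k\<in>{..<l} \<times> UNIV. f k) = (\<Prod>t<l. f (t, False) * f (t, True))"
  by (simp add: prod.cartesian_product' UNIV_bool mult.commute)

lemma prod_amp:
  assumes "lam > 0" "mu > 0"
  shows "(\<Prod>k\<in>{..<l} \<times> (UNIV :: bool set). amp lam mu n (w (fst k))) = (\<Prod>t<l. dval lam mu (w t)) / real n ^ l"
  unfolding prod_bool_index by (simp add: amp_sq[OF assms] prod_dividef)

lemma pathsD:
  assumes "xs \<in> paths n N l u v" "u < n" "l > 0"
  shows "simple u xs" "length xs = l" "av u xs l = v" "t \<le> l \<Longrightarrow> av u xs t < n" "t < l \<Longrightarrow> bv xs t < N"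
    "wv xs 0 = Bullet" "wv xs (l - 1) = Bullet"
proof -
  show "simple u xs" "length xs = l" "av u xs l = v" "wv xs 0 = Bullet" "wv xs (l - 1) = Bullet"
    using assms by (auto simp: paths_def words_iff)
  have "av u xs ` {..length xs} \<subseteq> {..<n}" using assms unfolding set_av by (auto simp: paths_def)
  then show "t \<le> l \<Longrightarrow> av u xs t < n" using \<open>length xs = l\<close> by auto
  have "bv xs ` {..<length xs} \<subseteq> {..<N}" using assms unfolding set_bv by (auto simp: paths_def)
  then show "t < l \<Longrightarrow> bv xs t < N" using \<open>length xs = l\<close> by auto
qed

abbreviation "obs_path lam mu n u xs \<omega> \<equiv> path_monomial u xs (obs_X lam n \<omega>) (obs_Y mu n \<omega>)"

abbreviation "Psi_obs lam mu rho l n N \<omega> \<equiv> Psi lam mu rho l n N (obs_X lam n \<omega>) (obs_Y mu n \<omega>)"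

lemma path_monomial_obs:
  "obs_path lam mu n u xs \<omega> =
   (\<Prod>k\<in>{..<length xs} \<times> UNIV. obs lam mu n \<omega> (wv xs (fst k)) (fst (path_edge u xs k)) (snd (path_edge u xs k)))"
  unfolding path_monomial_def obs_def by (intro prod.cong) (auto split: decoration.splits)

section \<open>The expanded expectation for two fixed paths\<close>

text \<open>The exponent \<open>e\<close> treats two claims at once: 0 gives the plain second
  moment, 2 the one weighted by the squares of the spike at both ends.\<close>

locale path_pair =
  fixes n N l :: nat and u v :: nat and xs ys :: "pstep list" and lam mu rho C :: real
    and P :: "(real \<times> real) measure" and e :: nat
  assumes n_pos: "n > 0" and N_pos: "N > 0" and l_pos: "l > 0" and uv: "u < n" "v < n" "u \<noteq> v"
    and xs: "xs \<in> paths n N l u v" and ys: "ys \<in> paths n N l u v"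
    and lam_pos: "lam > 0" and mu_pos: "mu > 0" and rho01: "0 < rho" "rho < 1"
    and prior: "prior rho C P" and e: "e = 0 \<or> e = 2"
begin

definition "Cm = 1 + 2 * \<bar>C\<bar>"
text \<open>The division by \<open>rho\<close> compensates the factor \<open>change_wt\<close> of S,
  which belongs to the other side of the local estimate and may be as small as
  \<open>rho\<close>.\<close>

definition "Cq = Cm / rho"

lemma Cq1: "Cq \<ge> 1"
  using rho01 unfolding Cq_def Cm_def by (simp add: field_simps)

sublocale ref_path n N l "av u xs" "bv xs" "wv xs" "dval lam mu" rho Cq 9
proof
  note D = pathsD[OF xs uv(1) l_pos]
  show "inj_on (av u xs) {..l}" "inj_on (bv xs) {..<l}" using D(1,2) by (auto simp: simple_iff)
qed (use pathsD[OF xs uv(1) l_pos] n_pos N_pos rho01 Cq1 dval_pos[OF lam_pos mu_pos] in auto)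

lemmas XD = pathsD[OF xs uv(1) l_pos]
lemmas YD = pathsD[OF ys uv(1) l_pos]

definition I :: "(nat \<times> bool) set" where "I = {..<l} \<times> UNIV"
definition K :: "(bool \<times> nat \<times> bool) set" where "K = UNIV \<times> I"
definition pth :: "bool \<Rightarrow> pstep list" where "pth x = (if x then ys else xs)"
definition dd where "dd k = wv (pth (fst k)) (fst (snd k))"
definition ii where "ii k = fst (path_edge u (pth (fst k)) (snd k))"
definition jj where "jj k = snd (path_edge u (pth (fst k)) (snd k))"
definition gg :: "nat \<Rightarrow> nat" where "gg k = (if k < e then u else v)"
definition G :: "nat set" where "G = {..<2 * e}"
definition "T B = obs_term lam mu n N P dd ii jj gg K G B"

definition deco_edge :: "pstep list \<Rightarrow> nat \<times> bool \<Rightarrow> (nat \<times> nat) \<times> decoration" where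
  "deco_edge zs k = (path_edge u zs k, wv zs (fst k))"

lemma finite_I [simp]: "finite I" by (simp add: I_def)
lemma finite_K [simp]: "finite K" by (simp add: K_def)

lemma deco_edge_inj: "inj_on (deco_edge xs) I" "inj_on (deco_edge ys) I"
  using path_edge_inj[OF XD(1)] path_edge_inj[OF YD(1)] unfolding XD(2) YD(2) I_def[symmetric]
  by (auto simp: inj_on_def deco_edge_def)

lemma ends_same: 
  assumes "p \<le> l" "t \<le> l" "av u xs p = av u ys t"
  shows "p = 0 \<longleftrightarrow> t = 0" "p = l \<longleftrightarrow> t = l"
proof -
  have "p = 0 \<longleftrightarrow> av u xs p = u" using av_eq[OF XD(1), of p 0] assms XD(2) by auto
  also have "\<dots> \<longleftrightarrow> t = 0" using av_eq[OF YD(1), of t 0] assms YD(2) by auto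
  finally show "p = 0 \<longleftrightarrow> t = 0" .
  have "p = l \<longleftrightarrow> av u xs p = v" using av_eq[OF XD(1), of p l] assms XD(2,3) by auto
  also have "\<dots> \<longleftrightarrow> t = l" using av_eq[OF YD(1), of t l] assms YD(2,3) by auto
  finally show "p = l \<longleftrightarrow> t = l" .
qed

lemma card_G: "card {k \<in> G. gg k = i} = (if i = u then e else 0) + (if i = v then e else 0)"
proof -
  have "{k \<in> G. gg k = i} = (if i = u then {..<e} else {}) \<union> (if i = v then {e..<2 * e} else {})"
    using uv by (auto simp: G_def gg_def split: if_splits)
  then show ?thesis using uv by (auto simp: card_Un_disjoint)
qed

lemma inc_a:
  assumes "zs \<in> {xs, ys}" "t \<le> l"
  shows "{k \<in> I. fst (path_edge u zs k) = av u zs t} = (if t < l then {(t, False)} else {}) \<union> (if 0 < t then {(t - 1, True)} else {})"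
proof -
  have "simple u zs" "length zs = l" using assms(1) XD(1,2) YD(1,2) by auto
  then show ?thesis using incident_a[of u zs t] assms(2) unfolding I_def by simp
qed

lemma inc_b:
  assumes "zs \<in> {xs, ys}" "t < l"
  shows "{k \<in> I. snd (path_edge u zs k) = bv zs t} = {(t, False), (t, True)}"
proof -
  have "simple u zs" "length zs = l" using assms(1) XD(1,2) YD(1,2) by auto
  then show ?thesis using incident_b[of u zs t] assms(2) unfolding I_def by simp
qed

lemma edge_in:
  assumes "k \<in> I"
  shows "\<exists>t\<le>l. fst (path_edge u zs k) = av u zs t" "\<exists>t<l. snd (path_edge u zs k) = bv zs t"
proof -
  obtain t s where k: "k = (t, s)" "t < l" using assms by (auto simp: I_def)
  then show "\<exists>t\<le>l. fst (path_edge u zs k) = av u zs t"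
    by (intro exI[of _ "if s then Suc t else t"]) (auto simp: path_edge_def)
  show "\<exists>t<l. snd (path_edge u zs k) = bv zs t" using k by (auto simp: path_edge_def)
qed

lemma card_inc_a:
  assumes "zs \<in> {xs, ys}"
  shows "card {k \<in> I. fst (path_edge u zs k) = i} \<le> 2"
    and "i = u \<or> i = v \<Longrightarrow> card {k \<in> I. fst (path_edge u zs k) = i} \<le> 1"
proof -
  show "card {k \<in> I. fst (path_edge u zs k) = i} \<le> 2"
  proof (cases "\<exists>t\<le>l. i = av u zs t")
    case True
    then obtain t where "t \<le> l" "i = av u zs t" by blast
    then show ?thesis using inc_a[OF assms, of t] by (auto simp: card_insert_if)
  next
    case False
    then have "fst (path_edge u zs k) \<noteq> i" if "k \<in> I" for k using edge_in(1)[OF that, of zs] by auto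
    then have "{k \<in> I. fst (path_edge u zs k) = i} = {}" by auto
    then show ?thesis by (metis card.empty le0)
  qed
  assume "i = u \<or> i = v"
  then have "i = av u zs 0 \<or> i = av u zs l" using assms XD(3) YD(3) by auto
  then show "card {k \<in> I. fst (path_edge u zs k) = i} \<le> 1"
    using inc_a[OF assms, of 0] inc_a[OF assms, of l] by auto
qed

lemma bool_index:
  "{k \<in> K - B. Q k} = Pair False ` {k \<in> I. (False, k) \<notin> B \<and> Q (False, k)} \<union> Pair True ` {k \<in> I. (True, k) \<notin> B \<and> Q (True, k)}"
  by (auto simp: K_def image_iff) (metis (full_types))+

lemma card_bool_index:
  "card {k \<in> K - B. Q k} = card {k \<in> I. (False, k) \<notin> B \<and> Q (False, k)} + card {k \<in> I. (True, k) \<notin> B \<and> Q (True, k)}"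
  unfolding bool_index by (subst card_Un_disjoint) (auto simp: card_image inj_on_def)

lemma prod_bool_index2:
  fixes f :: "bool \<times> nat \<times> bool \<Rightarrow> real"
  shows "(\<Prod>k\<in>{k \<in> K - B. Q k}. f k) = (\<Prod>k\<in>{k \<in> I. (False, k) \<notin> B \<and> Q (False, k)}. f (False, k)) *
    (\<Prod>k\<in>{k \<in> I. (True, k) \<notin> B \<and> Q (True, k)}. f (True, k))"
  unfolding bool_index by (subst prod.union_disjoint) (auto simp: prod.reindex inj_on_def)

lemma ii_simps: "ii (False, k) = fst (path_edge u xs k)" "ii (True, k) = fst (path_edge u ys k)"
  "jj (False, k) = snd (path_edge u xs k)" "jj (True, k) = snd (path_edge u ys k)"
  "dd (False, k) = wv xs (fst k)" "dd (True, k) = wv ys (fst k)"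
  by (auto simp: ii_def jj_def dd_def pth_def)

lemma ranges: "ii ` K \<subseteq> {..<n}" "jj ` K \<subseteq> {..<N}" "gg ` G \<subseteq> {..<n}"
proof -
  have "ii (x, k) < n \<and> jj (x, k) < N" if k: "k \<in> I" for x k
    using edge_in[OF k, of xs] edge_in[OF k, of ys] XD(4,5) YD(4,5) by (cases x) (auto simp: ii_simps)
  then show "ii ` K \<subseteq> {..<n}" "jj ` K \<subseteq> {..<N}" by (auto simp: K_def)
  show "gg ` G \<subseteq> {..<n}" using uv by (auto simp: gg_def)
qed

lemma degree: "card {k \<in> K - B. ii k = i} + card {k \<in> G. gg k = i} \<le> 4"
proof -
  have "card {k \<in> I. (False, k) \<notin> B \<and> ii (False, k) = i} \<le> card {k \<in> I. fst (path_edge u xs k) = i}"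
    "card {k \<in> I. (True, k) \<notin> B \<and> ii (True, k) = i} \<le> card {k \<in> I. fst (path_edge u ys k) = i}"
    by (auto intro!: card_mono simp: ii_simps)
  then show ?thesis
    unfolding card_bool_index card_G using card_inc_a[of xs i] card_inc_a[of ys i] e uv by auto
qed

lemma product_eq:
  "obs_path lam mu n u xs \<omega> * obs_path lam mu n u ys \<omega> *
     (spike_x \<omega> u ^ e * spike_x \<omega> v ^ e) =
   (\<Prod>k\<in>K. obs lam mu n \<omega> (dd k) (ii k) (jj k)) * (\<Prod>k\<in>G. spike_x \<omega> (gg k))"
proof -
  have "(\<Prod>k\<in>K. obs lam mu n \<omega> (dd k) (ii k) (jj k)) = (\<Prod>k\<in>{k \<in> K - {}. True}. obs lam mu n \<omega> (dd k) (ii k) (jj k))"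
    by simp
  also have "\<dots> = obs_path lam mu n u xs \<omega> * obs_path lam mu n u ys \<omega>"
    unfolding prod_bool_index2 path_monomial_obs by (simp add: ii_simps I_def XD(2) YD(2))
  moreover have "(\<Prod>k\<in>G. spike_x \<omega> (gg k)) = spike_x \<omega> u ^ e * spike_x \<omega> v ^ e"
  proof -
    have "G = {..<e} \<union> {e..<2 * e}" by (auto simp: G_def)
    then have "(\<Prod>k\<in>G. spike_x \<omega> (gg k)) = (\<Prod>k<e. spike_x \<omega> (gg k)) * (\<Prod>k=e..<2 * e. spike_x \<omega> (gg k))"
      by (simp only:) (rule prod.union_disjoint, auto)
    also have "\<dots> = (\<Prod>k<e. spike_x \<omega> u) * (\<Prod>k=e..<2 * e. spike_x \<omega> v)"
      by (intro arg_cong2[of _ _ _ _ "(*)"] prod.cong) (auto simp: gg_def)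
    finally show ?thesis by simp
  qed
  ultimately show ?thesis by simp
qed

lemma pair_expectation:
  defines "F \<equiv> (\<lambda>\<omega>. obs_path lam mu n u xs \<omega> * obs_path lam mu n u ys \<omega> *
     (spike_x \<omega> u ^ e * spike_x \<omega> v ^ e))"
  shows "integrable (planted P n N) F" "(\<integral>\<omega>. F \<omega> \<partial>planted P n N) = (\<Sum>B\<in>Pow K. T B)"
proof -
  have deg: "card {k \<in> K. ii k = i} + card {k \<in> G. gg k = i} \<le> 4" for i
    using degree[of "{}" i] by simp
  have G: "finite G" by (simp add: G_def)
  note ob = obs_expectation[OF prior finite_K G ranges deg, where lam = lam and mu = mu and dd = dd]
  show "integrable (planted P n N) F" unfolding F_def product_eq by (rule ob(1))
  show "(\<integral>\<omega>. F \<omega> \<partial>planted P n N) = (\<Sum>B\<in>Pow K. T B)" unfolding F_def product_eq T_def by (rule ob(2))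
qed

definition valid :: "(nat \<times> bool) set \<Rightarrow> bool" where
  "valid F \<longleftrightarrow> F \<subseteq> I \<and> deco_edge ys ` F \<subseteq> deco_edge xs ` I"

definition shared :: "(nat \<times> bool) set \<Rightarrow> (nat \<times> bool) set" where
  "shared F = {k \<in> I. deco_edge xs k \<in> deco_edge ys ` F}"

text \<open>\<open>F\<close> is the set of edges of \<open>ys\<close> at which noise is chosen; it forces the choice on \<open>xs\<close>.\<close>

definition noise :: "(nat \<times> bool) set \<Rightarrow> (bool \<times> nat \<times> bool) set" where
  "noise F = Pair False ` shared F \<union> Pair True ` F"

lemma noise_iff: "(False, k) \<in> noise F \<longleftrightarrow> k \<in> shared F" "(True, k) \<in> noise F \<longleftrightarrow> k \<in> F"
  by (auto simp: noise_def)

text \<open>A noise entry occurring once has mean zero, so each chosen factor needs a partner with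
  the same entry and decoration. The edges of one path are distinct, so the partner lies on the
  other path.\<close>

lemma term_nonzero:
  assumes B: "B \<subseteq> K" and nz: "T B \<noteq> 0"
  shows "\<exists>F. valid F \<and> B = noise F"
proof -
  have other: "\<exists>k'\<in>B. k' \<noteq> k \<and> dd k' = dd k \<and> ii k' = ii k \<and> jj k' = jj k" if k: "k \<in> B" for k
  proof (rule ccontr)
    assume "\<not> ?thesis"
    then have "{k' \<in> B. dd k' = dd k \<and> (ii k', jj k') = (ii k, jj k)} = {k}" using k by auto
    then have 0: "normal_moment (card {k' \<in> B. dd k' = dd k \<and> (ii k', jj k') = (ii k, jj k)}) = 0" by simp
    have "(ii k, jj k) \<in> {..<n} \<times> {..<N}" using ranges(1,2) B k by (auto simp: image_subset_iff)
    then have "(\<Prod>e\<in>{..<n} \<times> {..<N}. normal_moment (card {k' \<in> B. dd k' = dd k \<and> (ii k', jj k') = e})) = 0"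
      using 0 by (intro prod_zero) auto
    then show False using nz unfolding T_def obs_term_def by (cases "dd k") auto
  qed
  have de: "dd k' = dd k \<and> ii k' = ii k \<and> jj k' = jj k \<longleftrightarrow>
    deco_edge (pth (fst k')) (snd k') = deco_edge (pth (fst k)) (snd k)" for k k'
    by (simp add: dd_def ii_def jj_def deco_edge_def prod_eq_iff) blast
  define F where "F = {k. (True, k) \<in> B}"
  have FI: "F \<subseteq> I" using B by (auto simp: F_def K_def)
  have 1: "\<exists>k'. (False, k') \<in> B \<and> deco_edge xs k' = deco_edge ys k" if k: "(True, k) \<in> B" for k
  proof -
    obtain k2 where "k2 \<in> B" "k2 \<noteq> (True, k)" "deco_edge (pth (fst k2)) (snd k2) = deco_edge (pth True) k"
      using other[OF k] unfolding de fst_conv snd_conv by blast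
    then obtain x k' where o: "(x, k') \<in> B" "(x, k') \<noteq> (True, k)" "deco_edge (pth x) k' = deco_edge ys k"
      by (cases k2) (auto simp: pth_def)
    have "\<not> x"
    proof
      assume x: x
      then have "k' = k" using o B k deco_edge_inj(2) by (auto simp: inj_on_def K_def pth_def)
      then show False using o x by simp
    qed
    then show ?thesis using o by (intro exI[of _ k']) (simp add: pth_def)
  qed
  have 2: "\<exists>k'. (True, k') \<in> B \<and> deco_edge ys k' = deco_edge xs k" if k: "(False, k) \<in> B" for k
  proof -
    obtain k2 where "k2 \<in> B" "k2 \<noteq> (False, k)" "deco_edge (pth (fst k2)) (snd k2) = deco_edge (pth False) k"
      using other[OF k] unfolding de fst_conv snd_conv by blast
    then obtain x k' where o: "(x, k') \<in> B" "(x, k') \<noteq> (False, k)" "deco_edge (pth x) k' = deco_edge xs k"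
      by (cases k2) (auto simp: pth_def)
    have x
    proof (rule ccontr)
      assume x: "\<not> x"
      then have "k' = k" using o B k deco_edge_inj(1) by (auto simp: inj_on_def K_def pth_def)
      then show False using o x by simp
    qed
    then show ?thesis using o by (intro exI[of _ k']) (simp add: pth_def)
  qed
  have "valid F" unfolding valid_def
  proof (intro conjI FI subsetI)
    fix z assume "z \<in> deco_edge ys ` F"
    then obtain k where "(True, k) \<in> B" "z = deco_edge ys k" by (auto simp: F_def)
    then obtain k' where "(False, k') \<in> B" "deco_edge xs k' = z" using 1[of k] by blast
    then show "z \<in> deco_edge xs ` I" using B by (intro image_eqI[of _ _ k']) (auto simp: K_def)
  qed
  moreover have "(False, k) \<in> B \<longleftrightarrow> k \<in> shared F" for k
  proof
    assume k: "(False, k) \<in> B"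
    then obtain k' where "(True, k') \<in> B" "deco_edge ys k' = deco_edge xs k" using 2[of k] by blast
    then have "deco_edge xs k \<in> deco_edge ys ` F" by (intro image_eqI[of _ _ k']) (auto simp: F_def)
    then show "k \<in> shared F" using k B by (auto simp: shared_def K_def)
  next
    assume "k \<in> shared F"
    then obtain k' where k': "k \<in> I" "deco_edge xs k = deco_edge ys k'" "(True, k') \<in> B" by (auto simp: shared_def F_def)
    then obtain k2 where k2: "(False, k2) \<in> B" "deco_edge xs k2 = deco_edge ys k'" using 1 by blast
    then have "k2 \<in> I" using B by (auto simp: K_def)
    then have "k2 = k" using inj_onD[OF deco_edge_inj(1), of k2 k] k2(2) k'(1,2) by simp
    then show "(False, k) \<in> B" using k2(1) by simp
  qed
  note FS = this
  have "x \<in> B \<longleftrightarrow> x \<in> noise F" for x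
  proof -
    obtain c k where "x = (c, k)" by (cases x) auto
    then show ?thesis using FS[of k] by (cases c) (simp_all add: noise_iff F_def)
  qed
  then have "B = noise F" by blast
  ultimately show ?thesis by blast
qed

lemma abs_sum_terms_le: "\<bar>\<Sum>B\<in>Pow K. T B\<bar> \<le> (\<Sum>F\<in>{F \<in> Pow I. valid F}. \<bar>T (noise F)\<bar>)"
proof -
  have "\<bar>\<Sum>B\<in>Pow K. T B\<bar> \<le> (\<Sum>B\<in>Pow K. \<bar>T B\<bar>)" by (rule sum_abs)
  also have "\<dots> = (\<Sum>B\<in>{B \<in> Pow K. T B \<noteq> 0}. \<bar>T B\<bar>)"
    by (rule sum.mono_neutral_right) auto
  also have "\<dots> \<le> (\<Sum>B\<in>noise ` {F \<in> Pow I. valid F}. \<bar>T B\<bar>)"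
  proof (rule sum_mono2)
    show "{B \<in> Pow K. T B \<noteq> 0} \<subseteq> noise ` {F \<in> Pow I. valid F}"
    proof
      fix B assume "B \<in> {B \<in> Pow K. T B \<noteq> 0}"
      then obtain F where "valid F" "B = noise F" using term_nonzero[of B] by auto
      then show "B \<in> noise ` {F \<in> Pow I. valid F}" by (intro image_eqI[of _ _ F]) (auto simp: valid_def)
    qed
  qed auto
  also have "\<dots> \<le> (\<Sum>F\<in>{F \<in> Pow I. valid F}. \<bar>T (noise F)\<bar>)"
    using sum_image_le[of "{F \<in> Pow I. valid F}" "\<lambda>B. \<bar>T B\<bar>" noise] by (simp add: comp_def)
  finally show ?thesis .
qed

end

section \<open>Terms of the expansion as weighted walks\<close>

definition flag_list :: "nat \<Rightarrow> pstep list \<Rightarrow> (nat \<times> bool) set \<Rightarrow> wstep list" where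
  "flag_list u ys F = map (\<lambda>t. (wv ys t, bv ys t, av u ys (Suc t), (t, False) \<in> F, (t, True) \<in> F)) [0..<length ys]"

context path_pair begin

lemma valid_edge:
  assumes "valid F" "k \<in> F"
  shows "\<exists>k'\<in>shared F. deco_edge xs k' = deco_edge ys k"
proof -
  have "deco_edge ys k \<in> deco_edge xs ` I" using assms by (auto simp: valid_def)
  then obtain k' where "k' \<in> I" "deco_edge ys k = deco_edge xs k'" by (rule imageE)
  moreover have "deco_edge ys k \<in> deco_edge ys ` F" using assms(2) by (rule imageI)
  ultimately show ?thesis by (intro bexI[of _ k']) (simp_all add: shared_def)
qed

lemma shared_edge:
  assumes "k \<in> shared F"
  shows "\<exists>k'\<in>F. deco_edge xs k = deco_edge ys k'"
  using assms unfolding shared_def by auto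

lemma deco_edge_eqD:
  "deco_edge zs k = deco_edge zs' k' \<Longrightarrow> fst (path_edge u zs k) = fst (path_edge u zs' k') \<and>
     snd (path_edge u zs k) = snd (path_edge u zs' k') \<and> wv zs (fst k) = wv zs' (fst k')"
  by (auto simp: deco_edge_def)

text \<open>At an endpoint of T the missing edge counts as noise: it contributes no signal
  factor.\<close>

definition arr :: "(nat \<times> bool) set \<Rightarrow> nat \<Rightarrow> bool" where "arr F t \<longleftrightarrow> t = 0 \<or> (t - 1, True) \<in> F"
definition dep :: "(nat \<times> bool) set \<Rightarrow> nat \<Rightarrow> bool" where "dep F t \<longleftrightarrow> t = l \<or> (t, False) \<in> F"

definition vertex_a :: "(nat \<times> bool) set \<Rightarrow> nat \<Rightarrow> real" where
  "vertex_a F t = (if av u ys t \<in> av u xs ` {..l} then if arr F t \<and> dep F t then 1 else Cq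
     else (change_wt rho ys t)\<^sup>2)"

definition mom :: "(nat \<times> bool) set \<Rightarrow> nat \<Rightarrow> real" where
  "mom F i = (\<integral>p. (\<Prod>k\<in>{k \<in> K - noise F. ii k = i}. coord (dd k) p) * fst p ^ card {k \<in> G. gg k = i} \<partial>P)"

definition SA where "SA F i = {k \<in> I. k \<notin> shared F \<and> fst (path_edge u xs k) = i}"
definition TA where "TA F i = {k \<in> I. k \<notin> F \<and> fst (path_edge u ys k) = i}"

lemma mom_eq: "mom F i = (\<integral>p. (\<Prod>k\<in>SA F i. coord (wv xs (fst k)) p) * (\<Prod>k\<in>TA F i. coord (wv ys (fst k)) p) *
    fst p ^ ((if i = u then e else 0) + (if i = v then e else 0)) \<partial>P)"
  unfolding mom_def prod_bool_index2 SA_def TA_def noise_iff ii_simps card_G by simp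

lemma abs_mom_le: "\<bar>mom F i\<bar> \<le> Cm"
  unfolding mom_def Cm_def by (rule prior_moment(2)[OF prior]) (use degree in auto)

lemma prod_incident:
  assumes zs: "zs \<in> {xs, ys}" and t: "0 < t" "t < l"
    and A: "A = {k \<in> I. fst (path_edge u zs k) = av u zs t}"
  shows "(\<integral>p. (\<Prod>k\<in>A. coord (wv zs (fst k)) p) \<partial>P) = change_wt rho zs t"
proof -
  have "A = {(t, False), (t - 1, True)}" unfolding A using inc_a[OF zs, of t] t by auto
  then have "(\<Prod>k\<in>A. coord (wv zs (fst k)) p) = coord (wv zs t) p * coord (wv zs (t - 1)) p" for p
    by simp
  then show ?thesis using zs t XD(2) YD(2) by (auto simp: prior_second_moment[OF prior] change_wt_def)
qed

lemma end_vertices: "u \<in> av u xs ` {..l}" "v \<in> av u xs ` {..l}" "u \<in> av u ys ` {..l}" "v \<in> av u ys ` {..l}"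
proof -
  show "u \<in> av u xs ` {..l}" "u \<in> av u ys ` {..l}" by (rule image_eqI[of _ _ 0]; simp)+
  show "v \<in> av u xs ` {..l}" by (rule image_eqI[of _ _ l]) (simp_all add: XD(3))
  show "v \<in> av u ys ` {..l}" by (rule image_eqI[of _ _ l]) (simp_all add: YD(3))
qed

lemma interior:
  assumes "zs \<in> {xs, ys}" "t \<le> l" "av u zs t \<noteq> u" "av u zs t \<noteq> v"
  shows "0 < t" "t < l"
proof -
  have "t \<noteq> 0" using assms by (metis av_0)
  moreover have "t \<noteq> l" using assms XD(3) YD(3) by auto
  ultimately show "0 < t" "t < l" using assms by auto
qed

lemma prior_one: "(\<integral>p. 1 \<partial>P) = (1::real)" "(\<integral>p. fst p ^ e \<partial>P) = 1"
proof -
  interpret prob_space P by (rule priorD(1)[OF prior])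
  show "(\<integral>p. 1 \<partial>P) = (1::real)" by (simp add: prob_space)
  then show "(\<integral>p. fst p ^ e \<partial>P) = 1" using e priorD(5)[OF prior] by auto
qed

text \<open>The change factor of T stands on the left and that of S on the right, so that the
  product over all vertices turns the weight of T into the weight of S. On T only, moment and weight
  give the square of the change factor; on S only, the moment is the change factor of S. At a common
  vertex \<open>Cm = rho * Cq\<close> suffices, unless both edges of T are noise: then S has the
  same edges there, no signal is left, and both paths change decoration or neither does.\<close>

lemma mom_le:
  assumes F: "valid F" and i: "i < n"
  shows "\<bar>mom F i\<bar> * (\<Prod>t\<le>l. if av u ys t = i then change_wt rho ys t else 1) \<le>
    (\<Prod>p\<le>l. if av u xs p = i then change_wt rho xs p else 1) * (\<Prod>t\<le>l. if av u ys t = i then vertex_a F t else 1)"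
proof -
  have dx: "p \<le> l \<Longrightarrow> i = av u xs p \<Longrightarrow> (\<Prod>p\<le>l. if av u xs p = i then f p else 1) = f p"
    "i \<notin> av u xs ` {..l} \<Longrightarrow> (\<Prod>p\<le>l. if av u xs p = i then f p else 1) = 1" for p and f :: "nat \<Rightarrow> real"
    using prod_vertex_delta[OF XD(1)] XD(2) by auto
  have dy: "p \<le> l \<Longrightarrow> i = av u ys p \<Longrightarrow> (\<Prod>p\<le>l. if av u ys p = i then f p else 1) = f p"
    "i \<notin> av u ys ` {..l} \<Longrightarrow> (\<Prod>p\<le>l. if av u ys p = i then f p else 1) = 1" for p and f :: "nat \<Rightarrow> real"
    using prod_vertex_delta[OF YD(1)] YD(2) by auto
  have ch: "0 < change_wt rho zs t" "change_wt rho zs t \<le> 1" "rho \<le> change_wt rho zs t" for zs t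
    using rho01 by (auto simp: change_wt_def)
  have noX: "SA F i = {}" if "i \<notin> av u xs ` {..l}"
    using that edge_in(1)[of _ xs] by (fastforce simp: SA_def)
  have noY: "TA F i = {}" if "i \<notin> av u ys ` {..l}"
    using that edge_in(1)[of _ ys] by (force simp: TA_def)
  show ?thesis
  proof (cases "i \<in> av u xs ` {..l}")
    case False
    then have iuv: "i \<noteq> u" "i \<noteq> v" using end_vertices by auto
    show ?thesis
    proof (cases "i \<in> av u ys ` {..l}")
      case False
      then show ?thesis using noX noY \<open>i \<notin> av u xs ` {..l}\<close> iuv prior_one dx dy by (simp add: mom_eq)
    next
      case True
      then obtain t where t: "t \<le> l" "i = av u ys t" by auto
      have t': "0 < t" "t < l" using interior[of ys t] t iuv by auto
      have "k \<notin> F" if "k \<in> I" "fst (path_edge u ys k) = i" for k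
      proof
        assume "k \<in> F"
        then obtain k' where k': "k' \<in> shared F" "deco_edge xs k' = deco_edge ys k" using valid_edge[OF F] by blast
        then have "i = fst (path_edge u xs k')" "k' \<in> I"
          using deco_edge_eqD[OF k'(2)] that(2) k'(1) by (simp_all add: shared_def)
        then show False using edge_in(1)[of k' xs] False by auto
      qed
      then have "TA F i = {k \<in> I. fst (path_edge u ys k) = av u ys t}" using t by (auto simp: TA_def)
      then have "mom F i = change_wt rho ys t"
        unfolding mom_eq using prod_incident[of ys t] t' iuv noX[OF False] by simp
      then show ?thesis using dx(2)[OF False] dy(1)[OF t] ch[of ys t] False t
        by (simp add: vertex_a_def power2_eq_square)
    qed
  next
    case True
    then obtain p where p: "p \<le> l" "i = av u xs p" by auto
    show ?thesis
    proof (cases "i \<in> av u ys ` {..l}")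
      case False
      then have iuv: "i \<noteq> u" "i \<noteq> v" using end_vertices by auto
      have p': "0 < p" "p < l" using interior[of xs p] p iuv by auto
      have "k \<notin> shared F" if "k \<in> I" "fst (path_edge u xs k) = i" for k
      proof
        assume "k \<in> shared F"
        then obtain k' where k': "k' \<in> F" "deco_edge xs k = deco_edge ys k'" using shared_edge by blast
        then have "i = fst (path_edge u ys k')" "k' \<in> I"
          using deco_edge_eqD[OF k'(2)] that(2) F by (auto simp: valid_def)
        then show False using edge_in(1)[of k' ys] False by auto
      qed
      then have "SA F i = {k \<in> I. fst (path_edge u xs k) = av u xs p}" using p by (auto simp: SA_def)
      then have "mom F i = change_wt rho xs p"
        unfolding mom_eq using prod_incident[of xs p] p' iuv noY[OF False] by simp
      then show ?thesis using dx(1)[OF p] dy(2)[OF False] ch[of xs p] by simp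
    next
      case True
      then obtain t where t: "t \<le> l" "i = av u ys t" by auto
      have same: "av u xs p = av u ys t" using p t by simp
      have iS: "av u ys t \<in> av u xs ` {..l}" using p t by auto
      show ?thesis
      proof (cases "arr F t \<and> dep F t")
        case False
        have "\<bar>mom F i\<bar> * change_wt rho ys t \<le> Cm * 1"
          using abs_mom_le ch[of ys t] by (intro mult_mono) (auto simp: Cm_def)
        also have "\<dots> = rho * Cq" using rho01 by (simp add: Cq_def)
        also have "\<dots> \<le> change_wt rho xs p * Cq" using ch[of xs p] Cq1 by (intro mult_right_mono) auto
        finally show ?thesis unfolding dx(1)[OF p] dy(1)[OF t] using False iS by (auto simp: vertex_a_def)
      next
        case flagged: True
        let ?iX = "{k \<in> I. fst (path_edge u xs k) = i}" and ?iY = "{k \<in> I. fst (path_edge u ys k) = i}"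
        have iX: "?iX = (if p < l then {(p, False)} else {}) \<union> (if 0 < p then {(p - 1, True)} else {})"
          using inc_a[of xs p] p by simp
        have iY: "?iY = (if t < l then {(t, False)} else {}) \<union> (if 0 < t then {(t - 1, True)} else {})"
          using inc_a[of ys t] t by simp
        have YF: "?iY \<subseteq> F" unfolding iY using flagged by (auto simp: arr_def dep_def)
        have sub: "deco_edge ys ` ?iY \<subseteq> deco_edge xs ` ?iX"
        proof
          fix z assume "z \<in> deco_edge ys ` ?iY"
          then obtain k where k: "k \<in> ?iY" "z = deco_edge ys k" by blast
          then obtain k' where k': "k' \<in> shared F" "deco_edge xs k' = deco_edge ys k" using valid_edge[OF F] YF by blast
          then have "k' \<in> ?iX" using k deco_edge_eqD[OF k'(2)] by (auto simp: shared_def)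
          then show "z \<in> deco_edge xs ` ?iX" unfolding k(2) k'(2)[symmetric] by (rule imageI)
        qed
        \<comment> \<open>The paths share their endpoints, so the vertex is an end of both or
          interior to both, and an inclusion between edge sets of equal size is an equality.\<close>
        have "card ?iY = card ?iX"
          unfolding iX iY using ends_same[OF p(1) t(1) same] p t by auto
        then have "card (deco_edge ys ` ?iY) = card (deco_edge xs ` ?iX)"
          using card_image[OF inj_on_subset[OF deco_edge_inj(1), of ?iX]] card_image[OF inj_on_subset[OF deco_edge_inj(2), of ?iY]]
          by auto
        then have eq: "deco_edge ys ` ?iY = deco_edge xs ` ?iX"
          using sub by (intro card_subset_eq) auto
        have "SA F i = {}"
        proof -
          have "k \<in> shared F" if "k \<in> ?iX" for k
          proof -
            have "deco_edge xs k \<in> deco_edge ys ` ?iY" using eq that by blast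
            then show ?thesis using YF that by (auto simp: shared_def)
          qed
          then show ?thesis by (auto simp: SA_def)
        qed
        moreover have "TA F i = {}" using YF by (auto simp: TA_def)
        ultimately have "mom F i = 1" unfolding mom_eq using prior_one uv by auto
        moreover have "change_wt rho ys t = change_wt rho xs p"
        proof (cases "0 < t \<and> t < l")
          case False
          then have "\<not> (0 < p \<and> p < l)" using ends_same[OF p(1) t(1) same] p t by auto
          then show ?thesis using False XD(2) YD(2) unfolding change_wt_def by auto
        next
          case True
          then have p': "0 < p" "p < l" using ends_same[OF p(1) t(1) same] p t by auto
          \<comment> \<open>The decorations are compared as unordered pairs, because T may run along
            S in the opposite direction.\<close>
          have "(snd \<circ> deco_edge ys) ` ?iY = (snd \<circ> deco_edge xs) ` ?iX" unfolding image_comp[symmetric] eq ..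
          then have "{wv ys t, wv ys (t - 1)} = {wv xs p, wv xs (p - 1)}"
            unfolding iX iY using True p' by (auto simp: deco_edge_def)
          then have "wv ys (t - 1) = wv ys t \<longleftrightarrow> wv xs (p - 1) = wv xs p" by (auto simp: doubleton_eq_iff)
          then show ?thesis using True p' XD(2) YD(2) by (simp add: change_wt_def)
        qed
        ultimately show ?thesis unfolding dx(1)[OF p] dy(1)[OF t] using flagged iS by (simp add: vertex_a_def)
      qed
    qed
  qed
qed

definition mom_b :: "(nat \<times> bool) set \<Rightarrow> nat \<Rightarrow> real" where
  "mom_b F j = normal_moment (card {k \<in> K - noise F. dd k = Bullet \<and> jj k = j}) *
     normal_moment (card {k \<in> K - noise F. dd k = Circ \<and> jj k = j})"

definition vertex_b :: "(nat \<times> bool) set \<Rightarrow> nat \<Rightarrow> real" where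
  "vertex_b F t = mid_wt (bv ys t) ((t, False) \<in> F) ((t, True) \<in> F)"

lemma inc_b_empty:
  assumes "j \<notin> bv zs ` {..<l}"
  shows "{k \<in> I. snd (path_edge u zs k) = j} = {}"
proof -
  have "snd (path_edge u zs k) \<noteq> j" if "k \<in> I" for k
    using assms edge_in(2)[OF that, of zs] by auto
  then show ?thesis by blast
qed

text \<open>Each path has at most two edges at a b-vertex. If at most two signal factors remain,
  every Gaussian moment is at most 1; otherwise there are at most four, and each of the two families
  contributes at most 3.\<close>

lemma abs_mom_b_le:
  "\<bar>mom_b F j\<bar> \<le> (\<Prod>t<l. if bv ys t = j then vertex_b F t else 1)"
proof -
  let ?iX = "{k \<in> I. snd (path_edge u xs k) = j}" and ?iY = "{k \<in> I. k \<notin> F \<and> snd (path_edge u ys k) = j}"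
  have dec: "card {k \<in> K - noise F. dd k = d \<and> jj k = j} \<le> card ?iX + card ?iY" for d
    unfolding card_bool_index by (intro add_mono card_mono) (auto simp: ii_simps noise_iff)
  have one: "\<bar>mom_b F j\<bar> \<le> 1" if "card ?iX + card ?iY \<le> 2"
  proof -
    have "\<bar>mom_b F j\<bar> \<le> 1 * 1" unfolding mom_b_def abs_mult
      using dec[of Bullet] dec[of Circ] that by (intro mult_mono abs_normal_moment_le_1) auto
    then show ?thesis by simp
  qed
  have cX: "card ?iX \<le> 2"
  proof (cases "j \<in> bv xs ` {..<l}")
    case True
    then obtain t where t: "t < l" "j = bv xs t" by auto
    then show ?thesis using inc_b[of xs t] by (simp add: card_insert_if)
  next
    case False
    then have "?iX = {}" by (rule inc_b_empty)
    then show ?thesis by (metis card.empty le0)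
  qed
  show ?thesis
  proof (cases "j \<in> bv ys ` {..<l}")
    case False
    then have "(\<Prod>t<l. if bv ys t = j then vertex_b F t else 1) = 1" by (intro prod.neutral) auto
    moreover have "?iY = {}" using inc_b_empty[OF False] by auto
    then have "card ?iY = 0" by (simp only: card.empty)
    then have "\<bar>mom_b F j\<bar> \<le> 1" using cX by (intro one) linarith
    ultimately show ?thesis by simp
  next
    case True
    then obtain t where t: "t < l" "j = bv ys t" by auto
    have "(\<Prod>r<l. if bv ys r = j then vertex_b F r else 1) = (\<Prod>r<l. if t = r then vertex_b F r else 1)"
      using bv_eq[OF YD(1)] YD(2) t by (intro prod.cong) auto
    then have r: "(\<Prod>r<l. if bv ys r = j then vertex_b F r else 1) = vertex_b F t" using t by simp
    have iY: "?iY \<subseteq> {k \<in> {(t, False), (t, True)}. k \<notin> F}" using inc_b[of ys t] t by auto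
    have cY: "card ?iY \<le> card {k \<in> {(t, False), (t, True)}. k \<notin> F}" by (rule card_mono[OF _ iY]) simp
    have cY2: "card {k \<in> {(t, False), (t, True)}. k \<notin> F} \<le> card {(t, False), (t, True)}" by (rule card_mono) auto
    show ?thesis
    proof (cases "j \<in> bv xs ` {..<l} \<and> \<not> ((t, False) \<in> F \<and> (t, True) \<in> F)")
      case True
      have "\<bar>mom_b F j\<bar> \<le> 3 * 3" unfolding mom_b_def abs_mult
        using dec[of Bullet] dec[of Circ] cX cY cY2 by (intro mult_mono abs_normal_moment_le_3) auto
      then show ?thesis unfolding r using True t by (simp add: vertex_b_def mid_wt_def)
    next
      case False
      have "card ?iX + card ?iY \<le> 2"
      proof (cases "j \<in> bv xs ` {..<l}")
        case True
        then have "(t, s) \<in> F" for s using False by (cases s) auto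
        then have "{k \<in> {(t, False), (t, True)}. k \<notin> F} = {}" by blast
        then have "card {k \<in> {(t, False), (t, True)}. k \<notin> F} = 0" by (simp only: card.empty)
        then have "card ?iY = 0" using cY by linarith
        then show ?thesis using cX by linarith
      next
        case F2: False
        then have "?iX = {}" by (rule inc_b_empty)
        then have "card ?iX = 0" by (simp only: card.empty)
        moreover have "card {(t, False), (t, True)} = 2" by simp
        ultimately show ?thesis using cY cY2 by linarith
      qed
      then show ?thesis unfolding r using one False t by (auto simp: vertex_b_def mid_wt_def)
    qed
  qed
qed

text \<open>Each entry is used at most once by each path, so no noise moment of order above 2
  occurs.\<close>

lemma noise_factor_le:
  assumes "valid F"
  shows "\<bar>\<Prod>e\<in>{..<n} \<times> {..<N}. normal_moment (card {k \<in> noise F. dd k = d \<and> (ii k, jj k) = e})\<bar> \<le> 1"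
  unfolding abs_prod
proof (rule prod_le_1, intro conjI abs_ge_zero abs_normal_moment_le_1)
  fix e :: "nat \<times> nat"
  have FI: "F \<subseteq> I" using assms by (simp add: valid_def)
  have 1: "card {k \<in> A. path_edge u zs k = e} \<le> 1" if "A \<subseteq> I" "zs \<in> {xs, ys}" for A zs
  proof -
    have "inj_on (path_edge u zs) A"
      using inj_on_subset[of "path_edge u zs" I A] path_edge_inj[OF XD(1)] path_edge_inj[OF YD(1)] XD(2) YD(2) that
      by (auto simp: I_def)
    then have "k = k'" if "k \<in> {k \<in> A. path_edge u zs k = e}" "k' \<in> {k \<in> A. path_edge u zs k = e}" for k k'
      using that by (auto simp: inj_on_def)
    then show ?thesis by (intro card_le_Suc0_iff_eq[THEN iffD2, unfolded One_nat_def[symmetric]]) (use that finite_subset[OF _ finite_I] in auto)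
  qed
  have "{k \<in> noise F. dd k = d \<and> (ii k, jj k) = e} \<subseteq>
    Pair False ` {k \<in> shared F. path_edge u xs k = e} \<union> Pair True ` {k \<in> F. path_edge u ys k = e}"
    by (auto simp: noise_def ii_simps)
  then have "card {k \<in> noise F. dd k = d \<and> (ii k, jj k) = e} \<le>
    card (Pair False ` {k \<in> shared F. path_edge u xs k = e} \<union> Pair True ` {k \<in> F. path_edge u ys k = e})"
    using FI finite_subset[OF _ finite_I] by (intro card_mono) (auto simp: shared_def)
  also have "\<dots> \<le> card (Pair False ` {k \<in> shared F. path_edge u xs k = e}) + card (Pair True ` {k \<in> F. path_edge u ys k = e})"
    by (rule card_Un_le)
  also have "\<dots> \<le> 1 + 1"
    using 1[of "shared F" xs] 1[OF FI, of ys] by (intro add_mono) (auto simp: card_image inj_on_def shared_def)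
  finally show "card {k \<in> noise F. dd k = d \<and> (ii k, jj k) = e} \<le> 2" by simp
qed

text \<open>Shared noise edges have the same decoration, hence the same amplitude, on both paths.
  The amplitudes missing from S can therefore be charged to T, which leaves the full product for S
  and makes all later weights relative to S.\<close>

lemma amp_product:
  assumes "valid F"
  shows "(\<Prod>k\<in>K - noise F. amp lam mu n (dd k)) = (\<Prod>t<l. dval lam mu (wv xs t)) / real n ^ l *
     (\<Prod>k\<in>I. if k \<in> F then 1 / amp lam mu n (wv ys (fst k)) else amp lam mu n (wv ys (fst k)))"
proof -
  let ?h = "amp lam mu n"
  have h: "?h d > 0" for d by (rule amp_pos[OF lam_pos mu_pos n_pos])
  have FI: "F \<subseteq> I" using assms by (simp add: valid_def)
  have "(\<Prod>k\<in>K - noise F. ?h (dd k)) = (\<Prod>k\<in>{k \<in> K - noise F. True}. ?h (dd k))"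
    by (intro prod.cong) auto
  also have "\<dots> = (\<Prod>k\<in>I - shared F. ?h (wv xs (fst k))) * (\<Prod>k\<in>I - F. ?h (wv ys (fst k)))"
    unfolding prod_bool_index2 by (simp add: noise_iff ii_simps set_diff_eq)
  also have "(\<Prod>k\<in>I - shared F. ?h (wv xs (fst k))) = (\<Prod>k\<in>I. ?h (wv xs (fst k))) / (\<Prod>k\<in>shared F. ?h (wv xs (fst k)))"
    using h by (intro prod_diff) (auto simp: shared_def less_imp_neq[THEN not_sym])
  also have "(\<Prod>k\<in>shared F. ?h (wv xs (fst k))) = (\<Prod>k\<in>F. ?h (wv ys (fst k)))"
  proof -
    have im: "deco_edge xs ` shared F = deco_edge ys ` F"
    proof (intro equalityI subsetI)
      fix z assume "z \<in> deco_edge xs ` shared F"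
      then show "z \<in> deco_edge ys ` F" by (auto simp: shared_def)
    next
      fix z assume "z \<in> deco_edge ys ` F"
      then obtain k where k: "k \<in> F" "z = deco_edge ys k" by blast
      then show "z \<in> deco_edge xs ` shared F" using valid_edge[OF assms k(1)] by (metis imageI)
    qed
    have "(\<Prod>k\<in>shared F. ?h (wv xs (fst k))) = (\<Prod>z\<in>deco_edge xs ` shared F. ?h (snd z))"
      by (subst prod.reindex[OF inj_on_subset[OF deco_edge_inj(1)]]) (auto simp: shared_def deco_edge_def)
    also have "\<dots> = (\<Prod>k\<in>F. ?h (wv ys (fst k)))" unfolding im
      by (subst prod.reindex[OF inj_on_subset[OF deco_edge_inj(2) FI]]) (auto simp: deco_edge_def)
    finally show ?thesis .
  qed
  also have "(\<Prod>k\<in>I. ?h (wv xs (fst k))) = (\<Prod>t<l. dval lam mu (wv xs t)) / real n ^ l"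
    unfolding I_def by (rule prod_amp[OF lam_pos mu_pos])
  also have "(\<Prod>t<l. dval lam mu (wv xs t)) / real n ^ l / (\<Prod>k\<in>F. ?h (wv ys (fst k))) * (\<Prod>k\<in>I - F. ?h (wv ys (fst k)))
    = (\<Prod>t<l. dval lam mu (wv xs t)) / real n ^ l * ((\<Prod>k\<in>F. 1 / ?h (wv ys (fst k))) * (\<Prod>k\<in>I - F. ?h (wv ys (fst k))))"
    by (simp add: prod_dividef)
  also have "(\<Prod>k\<in>F. 1 / ?h (wv ys (fst k))) * (\<Prod>k\<in>I - F. ?h (wv ys (fst k))) =
    (\<Prod>k\<in>I. if k \<in> F then 1 / ?h (wv ys (fst k)) else ?h (wv ys (fst k)))"
  proof -
    have "(\<Prod>k\<in>I. if k \<in> F then 1 / ?h (wv ys (fst k)) else ?h (wv ys (fst k))) =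
      (\<Prod>k\<in>I \<inter> F. 1 / ?h (wv ys (fst k))) * (\<Prod>k\<in>I \<inter> - F. ?h (wv ys (fst k)))"
      by (subst prod.If_cases) (auto simp: Int_def)
    then show ?thesis using FI by (simp add: Int_absorb1 Diff_eq)
  qed
  finally show ?thesis .
qed

lemma edge_product:
  "(\<Prod>t<l. dval lam mu (wv ys t)) * (\<Prod>k\<in>I. if k \<in> F then 1 / amp lam mu n (wv ys (fst k)) else amp lam mu n (wv ys (fst k)))
   = real N ^ l * (\<Prod>t<l. edge_wt (wv ys t) ((t, False) \<in> F) ((t, True) \<in> F))"
proof -
  have "real N ^ l * (\<Prod>t<l. edge_wt (wv ys t) ((t, False) \<in> F) ((t, True) \<in> F)) =
    (\<Prod>t<l. real N * edge_wt (wv ys t) ((t, False) \<in> F) ((t, True) \<in> F))"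
    by (simp add: prod.distrib)
  also have "\<dots> = (\<Prod>t<l. dval lam mu (wv ys t) * ((if (t, False) \<in> F then 1 / amp lam mu n (wv ys t) else amp lam mu n (wv ys t)) *
     (if (t, True) \<in> F then 1 / amp lam mu n (wv ys t) else amp lam mu n (wv ys t))))"
  proof (rule prod.cong[OF refl])
    fix t
    let ?a = "amp lam mu n (wv ys t)" and ?d = "dval lam mu (wv ys t)"
    have a: "?a > 0" by (rule amp_pos[OF lam_pos mu_pos n_pos])
    have d: "?d = real n * (?a * ?a)" using amp_sq[OF lam_pos mu_pos, of n "wv ys t"] n_pos by simp
    show "real N * edge_wt (wv ys t) ((t, False) \<in> F) ((t, True) \<in> F) = ?d * ((if (t, False) \<in> F then 1 / ?a else ?a) *
     (if (t, True) \<in> F then 1 / ?a else ?a))"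
      unfolding edge_wt_def using N_pos n_pos a by (simp add: d power2_eq_square)
  qed
  also have "\<dots> = (\<Prod>t<l. dval lam mu (wv ys t)) * (\<Prod>k\<in>I. if k \<in> F then 1 / amp lam mu n (wv ys (fst k)) else amp lam mu n (wv ys (fst k)))"
    unfolding I_def prod_bool_index by (simp add: prod.distrib cong: if_cong)
  finally show ?thesis by simp
qed

lemma term_le:
  assumes F: "valid F"
  shows "weight lam mu rho (map fst ys) * \<bar>T (noise F)\<bar> \<le> weight lam mu rho (map fst xs) / real n ^ l * real N ^ l *
    ((\<Prod>t<l. edge_wt (wv ys t) ((t, False) \<in> F) ((t, True) \<in> F) * vertex_b F t) * (\<Prod>t\<le>l. vertex_a F t))"
proof -
  let ?h = "amp lam mu n"
  define E where "E = (\<Prod>k\<in>I. if k \<in> F then 1 / ?h (wv ys (fst k)) else ?h (wv ys (fst k)))"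
  have h: "?h d > 0" for d by (rule amp_pos[OF lam_pos mu_pos n_pos])
  have dv: "0 < dval lam mu d" for d by (rule dval_pos[OF lam_pos mu_pos])
  have E: "E \<ge> 0" unfolding E_def using h by (intro prod_nonneg) (auto simp: less_imp_le)
  define Dx where "Dx = (\<Prod>t<l. dval lam mu (wv xs t))"
  define Dy where "Dy = (\<Prod>t<l. dval lam mu (wv ys t))"
  have D: "Dx \<ge> 0" "Dy \<ge> 0" unfolding Dx_def Dy_def using dv by (auto intro!: prod_nonneg simp: less_imp_le)
  have wx: "weight lam mu rho (map fst xs) = Dx * (\<Prod>t\<le>l. change_wt rho xs t)"
    and wy: "weight lam mu rho (map fst ys) = Dy * (\<Prod>t\<le>l. change_wt rho ys t)"
    using prod_change_wt[of rho xs] prod_change_wt[of rho ys] XD(2) YD(2)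
    by (simp_all add: weight_def Dx_def Dy_def wv_def)
  have a: "(\<Prod>i<n. \<bar>mom F i\<bar>) * (\<Prod>t\<le>l. change_wt rho ys t) \<le> (\<Prod>t\<le>l. change_wt rho xs t) * (\<Prod>t\<le>l. vertex_a F t)"
  proof -
    have "(\<Prod>i<n. \<bar>mom F i\<bar> * (\<Prod>t\<le>l. if av u ys t = i then change_wt rho ys t else 1)) \<le>
      (\<Prod>i<n. (\<Prod>p\<le>l. if av u xs p = i then change_wt rho xs p else 1) * (\<Prod>t\<le>l. if av u ys t = i then vertex_a F t else 1))"
    proof (rule prod_mono, intro conjI)
      fix i assume "i \<in> {..<n}"
      then show "\<bar>mom F i\<bar> * (\<Prod>t\<le>l. if av u ys t = i then change_wt rho ys t else 1) \<le>
        (\<Prod>p\<le>l. if av u xs p = i then change_wt rho xs p else 1) * (\<Prod>t\<le>l. if av u ys t = i then vertex_a F t else 1)"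
        using mom_le[OF F] by simp
      show "0 \<le> \<bar>mom F i\<bar> * (\<Prod>t\<le>l. if av u ys t = i then change_wt rho ys t else 1)"
        using rho01 by (intro mult_nonneg_nonneg prod_nonneg) (auto simp: change_wt_def)
    qed
    moreover have "(\<Prod>i<n. \<Prod>t\<le>l. if av u ys t = i then f t else 1) = (\<Prod>t\<le>l. f t)" for f :: "nat \<Rightarrow> real"
      by (rule prod_over_vertices) (use YD(4) in auto)
    moreover have "(\<Prod>i<n. \<Prod>t\<le>l. if av u xs t = i then f t else 1) = (\<Prod>t\<le>l. f t)" for f :: "nat \<Rightarrow> real"
      by (rule prod_over_vertices) (use XD(4) in auto)
    ultimately show ?thesis by (simp add: prod.distrib)
  qed
  have b: "(\<Prod>j<N. \<bar>mom_b F j\<bar>) \<le> (\<Prod>t<l. vertex_b F t)"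
  proof -
    have "(\<Prod>j<N. \<bar>mom_b F j\<bar>) \<le> (\<Prod>j<N. \<Prod>t<l. if bv ys t = j then vertex_b F t else 1)"
      by (rule prod_mono) (use abs_mom_b_le in auto)
    also have "\<dots> = (\<Prod>t<l. vertex_b F t)" by (rule prod_over_vertices) (use YD(5) in auto)
    finally show ?thesis .
  qed
  have va: "0 \<le> (\<Prod>t\<le>l. vertex_a F t)" using Cq1 by (intro prod_nonneg) (auto simp: vertex_a_def)
  have vb: "0 \<le> (\<Prod>t<l. vertex_b F t)" using mid_wt_nonneg by (intro prod_nonneg) (auto simp: vertex_b_def)
  define Nz where "Nz = (\<Prod>e\<in>{..<n} \<times> {..<N}. normal_moment (card {k \<in> noise F. dd k = Bullet \<and> (ii k, jj k) = e})) *
      (\<Prod>e\<in>{..<n} \<times> {..<N}. normal_moment (card {k \<in> noise F. dd k = Circ \<and> (ii k, jj k) = e}))"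
  have Nz: "\<bar>Nz\<bar> \<le> 1"
    unfolding Nz_def abs_mult using mult_mono[OF noise_factor_le[OF F] noise_factor_le[OF F]] by simp
  have TF: "T (noise F) = (Dx / real n ^ l * E) * (\<Prod>i<n. mom F i) * (\<Prod>j<N. mom_b F j) * Nz"
    unfolding T_def obs_term_def Nz_def amp_product[OF F] E_def[symmetric] Dx_def[symmetric] mom_def[symmetric]
    by (simp add: mom_b_def prod.distrib)
  have cw: "0 \<le> (\<Prod>t\<le>l. change_wt rho zs t)" for zs
    using rho01 by (intro prod_nonneg) (auto simp: change_wt_def)
  have "weight lam mu rho (map fst ys) * \<bar>T (noise F)\<bar> =
    (Dy * Dx / real n ^ l * E) * (((\<Prod>i<n. \<bar>mom F i\<bar>) * (\<Prod>t\<le>l. change_wt rho ys t)) * (\<Prod>j<N. \<bar>mom_b F j\<bar>)) * \<bar>Nz\<bar>"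
    unfolding wy TF abs_mult abs_prod using D E by (simp add: abs_of_nonneg)
  also have "\<dots> \<le> (Dy * Dx / real n ^ l * E) * (((\<Prod>t\<le>l. change_wt rho xs t) * (\<Prod>t\<le>l. vertex_a F t)) * (\<Prod>t<l. vertex_b F t)) * 1"
  proof (rule mult_mono[OF mult_left_mono[OF mult_mono[OF a b]] Nz])
    show "0 \<le> (\<Prod>t\<le>l. change_wt rho xs t) * (\<Prod>t\<le>l. vertex_a F t)"
      using cw va by (rule mult_nonneg_nonneg)
    show "0 \<le> (\<Prod>j<N. \<bar>mom_b F j\<bar>)" by (intro prod_nonneg) auto
    show "0 \<le> Dy * Dx / real n ^ l * E" using D E by simp
    show "0 \<le> (Dy * Dx / real n ^ l * E) * (((\<Prod>t\<le>l. change_wt rho xs t) * (\<Prod>t\<le>l. vertex_a F t)) * (\<Prod>t<l. vertex_b F t))"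
      using D E by (intro mult_nonneg_nonneg divide_nonneg_nonneg cw va vb) auto
  qed simp_all
  also have "\<dots> = Dx * (\<Prod>t\<le>l. change_wt rho xs t) / real n ^ l * (Dy * E) * ((\<Prod>t<l. vertex_b F t) * (\<Prod>t\<le>l. vertex_a F t))"
    by simp
  also have "Dy * E = real N ^ l * (\<Prod>t<l. edge_wt (wv ys t) ((t, False) \<in> F) ((t, True) \<in> F))"
    unfolding Dy_def E_def by (rule edge_product)
  finally show ?thesis unfolding wx by (simp add: prod.distrib mult_ac)
qed

abbreviation "step_list F \<equiv> flag_list u ys F"

lemma step_list_def: "step_list F = map (\<lambda>t. (wv ys t, bv ys t, av u ys (Suc t), (t, False) \<in> F, (t, True) \<in> F)) [0..<l]"
  by (simp add: flag_list_def YD(2))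

text \<open>The b-vertex \<open>N\<close> does not exist, so the first step is not restricted by it.\<close>

abbreviation start :: wstep where "start \<equiv> (Bullet, N, u, True, True)"

lemma step_wt_eq:
  assumes F: "valid F" and t: "t < l"
  shows "step_wt ((start # step_list F) ! t) (step_list F ! t) =
    edge_wt (wv ys t) ((t, False) \<in> F) ((t, True) \<in> F) * vertex_b F t * vertex_a F t"
proof -
  define s where "s = (start # step_list F) ! t"
  have on: "on_path (wv ys (fst k)) (fst (path_edge u ys k)) (snd (path_edge u ys k))" if kF: "k \<in> F" for k
  proof -
    obtain k' where k': "k' \<in> shared F" "deco_edge xs k' = deco_edge ys k" using valid_edge[OF F kF] by blast
    obtain r b where r: "k' = (r, b)" by fastforce
    then have "r < l" using k' by (auto simp: shared_def I_def)
    then show ?thesis using deco_edge_eqD[OF k'(2)] r unfolding on_path_def path_edge_def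
      by (intro exI[of _ r]) (auto split: if_splits)
  qed
  obtain d0 j0 i0 f0 g0 where s: "s = (d0, j0, i0, f0, g0)" by (metis prod.exhaust)
  have nth: "step_list F ! t = (wv ys t, bv ys t, av u ys (Suc t), (t, False) \<in> F, (t, True) \<in> F)"
    using t by (simp add: step_list_def)
  have s': "i0 = av u ys t \<and> g0 = arr F t \<and> (t > 0 \<longrightarrow> d0 = wv ys (t - 1) \<and> j0 = bv ys (t - 1)) \<and> (t = 0 \<longrightarrow> j0 = N)"
  proof (cases t)
    case 0
    then show ?thesis using s by (auto simp: s_def arr_def)
  next
    case (Suc r)
    then show ?thesis using s t by (auto simp: s_def step_list_def arr_def)
  qed
  have "admits s (step_list F ! t)"
    unfolding s nth admits.simps
  proof (intro conjI impI)
    show "on_path (wv ys t) i0 (bv ys t)" if "(t, False) \<in> F"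
      using on[OF that] s' by (simp add: path_edge_def)
    show "on_path (wv ys t) (av u ys (Suc t)) (bv ys t)" if "(t, True) \<in> F"
      using on[OF that] by (simp add: path_edge_def)
    show "av u ys (Suc t) \<noteq> i0" using s' av_eq[OF YD(1), of "Suc t" t] t YD(2) by auto
    show "bv ys t \<noteq> j0" if "g0 \<and> (t, False) \<in> F"
    proof (cases "t = 0")
      case True
      then show ?thesis using s' YD(5)[OF t] by auto
    next
      case False
      then show ?thesis using s' bv_eq[OF YD(1), of t "t - 1"] t YD(2) by auto
    qed
  qed
  then have "step_wt s (step_list F ! t) = head_wt s (wv ys t) ((t, False) \<in> F) * vertex_b F t * edge_wt (wv ys t) ((t, False) \<in> F) ((t, True) \<in> F)"
    unfolding nth vertex_b_def by simp
  moreover have "head_wt s (wv ys t) ((t, False) \<in> F) = vertex_a F t"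
  proof (cases "i0 \<in> av u xs ` {..l}")
    case True
    then show ?thesis using s' t by (auto simp: s vertex_a_def dep_def)
  next
    case False
    then have "t > 0" using s' end_vertices(1) by (cases t) auto
    then show ?thesis using s' t False YD(2) by (auto simp: s vertex_a_def change_wt_def)
  qed
  ultimately show ?thesis unfolding s_def by simp
qed

lemma end_wt_eq: "end_wt (last (start # step_list F)) = vertex_a F l"
proof -
  have ne: "step_list F \<noteq> []" using l_pos by (auto simp: step_list_def)
  then have "last (start # step_list F) = step_list F ! (l - 1)"
    by (simp add: last_conv_nth) (simp add: step_list_def)
  then show ?thesis using l_pos XD(3) YD(3) end_vertices(2) by (auto simp: step_list_def vertex_a_def arr_def dep_def)
qed

end

section \<open>From single walks to the row bound\<close>

context ref_path begin

primrec chain :: "wstep \<Rightarrow> wstep list \<Rightarrow> real" where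
  "chain s [] = end_wt s"
| "chain s (s' # ss) = step_wt s s' * chain s' ss"

lemma chain_eq: "chain s ss = (\<Prod>t<length ss. step_wt ((s # ss) ! t) (ss ! t)) * end_wt (last (s # ss))"
  by (induction ss arbitrary: s) (simp_all add: prod.lessThan_Suc_shift del: prod.lessThan_Suc)

lemma chain_nonneg: "chain s ss \<ge> 0"
proof (induction ss arbitrary: s)
  case Nil
  show ?case using Cq1 by (cases s) auto
qed (simp add: step_wt_nonneg)

lemma walk_sum_eq: "walk_sum k s = (\<Sum>ss\<in>{ss. set ss \<subseteq> steps \<and> length ss = k}. chain s ss)"
proof (induction k arbitrary: s)
  case 0
  have "{ss. set ss \<subseteq> steps \<and> length ss = 0} = {[]}" by auto
  then show ?case by simp
next
  case (Suc k)
  have "{ss. set ss \<subseteq> steps \<and> length ss = Suc k} =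
    (\<lambda>(x, ss). x # ss) ` (steps \<times> {ss. set ss \<subseteq> steps \<and> length ss = k})"
    by (auto simp: image_iff length_Suc_conv)
  moreover have "inj_on (\<lambda>(x, ss). x # ss) (steps \<times> {ss. set ss \<subseteq> steps \<and> length ss = k})"
    by (auto simp: inj_on_def)
  ultimately have "(\<Sum>ss\<in>{ss. set ss \<subseteq> steps \<and> length ss = Suc k}. chain s ss) =
     (\<Sum>(x, ss)\<in>steps \<times> {ss. set ss \<subseteq> steps \<and> length ss = k}. chain s (x # ss))"
    by (simp add: sum.reindex case_prod_unfold)
  also have "\<dots> = (\<Sum>x\<in>steps. \<Sum>ss\<in>{ss. set ss \<subseteq> steps \<and> length ss = k}. chain s (x # ss))"
    by (rule sum.cartesian_product[symmetric])
  also have "\<dots> = walk_sum (Suc k) s" by (simp add: Suc sum_distrib_left)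
  finally show ?case by simp
qed

end

context path_pair begin

lemma chain_step_list:
  assumes "valid F"
  shows "chain start (step_list F) =
    (\<Prod>t<l. edge_wt (wv ys t) ((t, False) \<in> F) ((t, True) \<in> F) * vertex_b F t) * (\<Prod>t\<le>l. vertex_a F t)"
proof -
  have len: "length (step_list F) = l" by (simp add: step_list_def)
  have "(\<Prod>t\<le>l. vertex_a F t) = (\<Prod>t<l. vertex_a F t) * vertex_a F l"
    by (simp add: lessThan_Suc_atMost[symmetric])
  then show ?thesis
    unfolding chain_eq len end_wt_eq by (simp add: step_wt_eq[OF assms] prod.distrib)
qed

lemma pair_expectation_le:
  defines "E \<equiv> (\<integral>\<omega>. obs_path lam mu n u xs \<omega> * obs_path lam mu n u ys \<omega> *
     (spike_x \<omega> u ^ e * spike_x \<omega> v ^ e) \<partial>planted P n N)"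
  shows "weight lam mu rho (map fst ys) * \<bar>E\<bar> \<le> weight lam mu rho (map fst xs) / real n ^ l * real N ^ l *
    (\<Sum>F\<in>{F \<in> Pow I. valid F}. chain start (step_list F))"
proof -
  have w: "0 \<le> weight lam mu rho (map fst ys)"
    unfolding weight_def using dval_pos[OF lam_pos mu_pos] rho01
    by (intro mult_nonneg_nonneg prod_nonneg) (auto intro: less_imp_le)
  have "\<bar>E\<bar> \<le> (\<Sum>F\<in>{F \<in> Pow I. valid F}. \<bar>T (noise F)\<bar>)"
    unfolding E_def pair_expectation(2) by (rule abs_sum_terms_le)
  then have "weight lam mu rho (map fst ys) * \<bar>E\<bar> \<le> (\<Sum>F\<in>{F \<in> Pow I. valid F}. weight lam mu rho (map fst ys) * \<bar>T (noise F)\<bar>)"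
    unfolding sum_distrib_left[symmetric] using w by (rule mult_left_mono)
  also have "\<dots> \<le> (\<Sum>F\<in>{F \<in> Pow I. valid F}. weight lam mu rho (map fst xs) / real n ^ l * real N ^ l * chain start (step_list F))"
    by (rule sum_mono) (use term_le chain_step_list in auto)
  finally show ?thesis by (simp add: sum_distrib_left)
qed

lemma step_list_mem: "set (step_list F) \<subseteq> steps" "length (step_list F) = l"
  using YD(4,5) by (auto simp: step_list_def steps_def)

end

text \<open>The pair of T and its noise set can be recovered from the flagged list, so distinct
  terms give distinct walks. As all walk weights are nonnegative, the sum may be enlarged to all
  walks, including those that are not self-avoiding.\<close>

lemma row_bound:
  assumes pos: "n > 0" "N > 0" "l > 0" and uv: "u < n" "v < n" "u \<noteq> v"
    and xs: "xs \<in> paths n N l u v"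
    and lm: "lam > 0" "mu > 0" and rho01: "0 < rho" "rho < 1"
    and prior: "prior rho C P" and e: "e = 0 \<or> e = 2"
  shows "(\<Sum>ys\<in>paths n N l u v. weight lam mu rho (map fst ys) *
      \<bar>\<integral>\<omega>. obs_path lam mu n u xs \<omega> * obs_path lam mu n u ys \<omega> *
     (spike_x \<omega> u ^ e * spike_x \<omega> v ^ e) \<partial>planted P n N\<bar>)
    \<le> weight lam mu rho (map fst xs) / real n ^ l * real N ^ l *
      ref_path.walk_sum n N l (av u xs) (bv xs) (wv xs) (dval lam mu) rho (path_pair.Cq rho C) 9 l (Bullet, N, u, True, True)"
    (is "?lhs \<le> ?c * _")
proof -
  have pp: "path_pair n N l u v xs ys lam mu rho C P e" if "ys \<in> paths n N l u v" for ys
    by unfold_locales (use assms that in auto)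
  interpret R: path_pair n N l u v xs xs lam mu rho C P e by (rule pp[OF xs])
  let ?V = "\<lambda>ys. {F \<in> Pow R.I. path_pair.valid l u xs ys F}"
  have c: "?c \<ge> 0"
    unfolding weight_def using dval_pos[OF lm] rho01
    by (intro mult_nonneg_nonneg divide_nonneg_nonneg prod_nonneg) (auto intro: less_imp_le)
  have fin: "finite (?V ys)" for ys by simp
  have "?lhs \<le> (\<Sum>ys\<in>paths n N l u v. ?c * (\<Sum>F\<in>?V ys. R.chain (Bullet, N, u, True, True) (flag_list u ys F)))"
  proof (rule sum_mono)
    fix ys assume ys: "ys \<in> paths n N l u v"
    interpret Q: path_pair n N l u v xs ys lam mu rho C P e by (rule pp[OF ys])
    show "weight lam mu rho (map fst ys) *
      \<bar>\<integral>\<omega>. obs_path lam mu n u xs \<omega> * obs_path lam mu n u ys \<omega> *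
     (spike_x \<omega> u ^ e * spike_x \<omega> v ^ e) \<partial>planted P n N\<bar> \<le> ?c * (\<Sum>F\<in>?V ys. R.chain (Bullet, N, u, True, True) (flag_list u ys F))"
      by (rule Q.pair_expectation_le)
  qed
  also have "\<dots> = ?c * (\<Sum>ys\<in>paths n N l u v. \<Sum>F\<in>?V ys. R.chain (Bullet, N, u, True, True) (flag_list u ys F))"
    by (simp add: sum_distrib_left)
  also have "\<dots> \<le> ?c * R.walk_sum l (Bullet, N, u, True, True)"
  proof (rule mult_left_mono[OF _ c])
    let ?S = "SIGMA ys : paths n N l u v. ?V ys"
    have inj: "inj_on (\<lambda>(ys, F). flag_list u ys F) ?S"
    proof (rule inj_onI, clarify)
      fix ys F ys' F'
      assume a: "ys \<in> paths n N l u v" "ys' \<in> paths n N l u v" "F \<subseteq> R.I" "F' \<subseteq> R.I"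
        and eq: "flag_list u ys F = flag_list u ys' F'"
      have len: "length ys = l" "length ys' = l" using a by (auto simp: paths_def words_iff)
      have at: "flag_list u zs G ! t = (wv zs t, bv zs t, av u zs (Suc t), (t, False) \<in> G, (t, True) \<in> G)"
        if "t < l" "length zs = l" for zs t G
        using that by (simp add: flag_list_def)
      have all: "wv ys t = wv ys' t \<and> bv ys t = bv ys' t \<and> av u ys (Suc t) = av u ys' (Suc t) \<and>
         ((t, False) \<in> F \<longleftrightarrow> (t, False) \<in> F') \<and> ((t, True) \<in> F \<longleftrightarrow> (t, True) \<in> F')" if "t < l" for t
        using at[OF that len(1), of F] at[OF that len(2), of F'] eq by simp
      have "ys = ys'" by (rule list_eqI[of _ _ u u]) (use len all in auto)
      moreover have "(t, s) \<in> F \<longleftrightarrow> (t, s) \<in> F'" for t s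
        using all[of t] a(3,4) by (cases s) (auto simp: R.I_def)
      ultimately show "ys = ys' \<and> F = F'" by auto
    qed
    have "(\<Sum>ys\<in>paths n N l u v. \<Sum>F\<in>?V ys. R.chain (Bullet, N, u, True, True) (flag_list u ys F)) =
      (\<Sum>(ys, F)\<in>?S. R.chain (Bullet, N, u, True, True) (flag_list u ys F))"
      by (rule sum.Sigma) (use finite_paths fin in auto)
    also have "\<dots> = (\<Sum>ss\<in>(\<lambda>(ys, F). flag_list u ys F) ` ?S. R.chain (Bullet, N, u, True, True) ss)"
      by (subst sum.reindex[OF inj]) (simp add: case_prod_unfold)
    also have "\<dots> \<le> (\<Sum>ss\<in>{ss. set ss \<subseteq> R.steps \<and> length ss = l}. R.chain (Bullet, N, u, True, True) ss)"
    proof (rule sum_mono2)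
      show "finite {ss. set ss \<subseteq> R.steps \<and> length ss = l}"
        by (rule finite_lists_length_eq) (simp add: R.steps_def)
      show "(\<lambda>(ys, F). flag_list u ys F) ` ?S \<subseteq> {ss. set ss \<subseteq> R.steps \<and> length ss = l}"
      proof clarify
        fix ys F assume ys: "ys \<in> paths n N l u v"
        interpret Q: path_pair n N l u v xs ys lam mu rho C P e by (rule pp[OF ys])
        show "set (flag_list u ys F) \<subseteq> R.steps \<and> length (flag_list u ys F) = l"
          using Q.step_list_mem[of F] by simp
      qed
    qed (rule R.chain_nonneg)
    also have "\<dots> = R.walk_sum l (Bullet, N, u, True, True)" by (rule R.walk_sum_eq[symmetric])
    finally show "(\<Sum>ys\<in>paths n N l u v. \<Sum>F\<in>?V ys. R.chain (Bullet, N, u, True, True) (flag_list u ys F))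
      \<le> R.walk_sum l (Bullet, N, u, True, True)" .
  qed
  finally show ?thesis .
qed

section \<open>Growth of the walk sums\<close>

text \<open>The characteristic equation of the matrix with rows \<open>(lam^2, rho^2 * mu^2)\<close>
  and \<open>(rho^2 * lam^2, mu^2)\<close>, which adds one letter to a word in the sum of squared
  weights.\<close>

lemma A_plus_root:
  assumes "0 < rho" "rho < 1"
  shows "(A_plus lam mu rho - lam\<^sup>2) * (A_plus lam mu rho - mu\<^sup>2) = rho ^ 4 * lam\<^sup>2 * mu\<^sup>2"
proof -
  define D where "D = lam ^ 4 + mu ^ 4 - (2 - 4 * rho ^ 4) * lam\<^sup>2 * mu\<^sup>2"
  have D: "D = (lam\<^sup>2 - mu\<^sup>2)\<^sup>2 + 4 * rho ^ 4 * lam\<^sup>2 * mu\<^sup>2"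
    unfolding D_def by (simp add: power2_eq_square power4_eq_xxxx algebra_simps)
  then have "D \<ge> 0" by simp
  then have s: "sqrt D * sqrt D = D" by simp
  have A: "A_plus lam mu rho = (lam\<^sup>2 + mu\<^sup>2 + sqrt D) / 2" by (simp add: A_plus_def D_def)
  have "(A_plus lam mu rho - lam\<^sup>2) * (A_plus lam mu rho - mu\<^sup>2) = (sqrt D * sqrt D - (lam\<^sup>2 - mu\<^sup>2)\<^sup>2) / 4"
    unfolding A by (simp add: field_simps power2_eq_square)
  then show ?thesis unfolding s D by simp
qed

text \<open>Read off the Bullet row of the matrix. Both entries are positive because
  \<open>lam^2 <= gam < A_plus\<close>.\<close>

definition eigvec :: "real \<Rightarrow> real \<Rightarrow> real \<Rightarrow> decoration \<Rightarrow> real" where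
  "eigvec lam mu rho d = (case d of Bullet \<Rightarrow> rho\<^sup>2 * mu\<^sup>2 | Circ \<Rightarrow> A_plus lam mu rho - lam\<^sup>2)"

lemma eigvec:
  assumes "0 < rho" "rho < 1"
  shows "(\<Sum>d'\<in>UNIV. (if d = d' then 1 else rho\<^sup>2) * (dval lam mu d')\<^sup>2 * eigvec lam mu rho d') =
    A_plus lam mu rho * eigvec lam mu rho d"
proof (cases d)
  case Bullet
  then show ?thesis by (simp add: UNIV_decoration dval_def eigvec_def algebra_simps)
next
  case Circ
  have "rho ^ 4 * lam\<^sup>2 * mu\<^sup>2 + mu\<^sup>2 * (A_plus lam mu rho - lam\<^sup>2) = A_plus lam mu rho * (A_plus lam mu rho - lam\<^sup>2)"
    using A_plus_root[OF assms, of lam mu] by (simp add: algebra_simps)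
  then show ?thesis using Circ
    by (simp add: UNIV_decoration dval_def eigvec_def power2_eq_square power4_eq_xxxx algebra_simps)
qed

lemma eigvec_pos:
  assumes "0 < rho" "mu > 0" "lam\<^sup>2 < A_plus lam mu rho"
  shows "eigvec lam mu rho d > 0"
  using assms by (cases d) (auto simp: eigvec_def)

text \<open>Bounds the exponent in \<open>(1 + c5 * h / A) ^ l <= exp (c5 * l * h / A)\<close>; the
  logarithm is compared with a square root, which is just enough for a bounded result.\<close>

lemma length_bound:
  assumes "n > 0" "real l \<le> K * ln (real n)"
  shows "(real l + 1)\<^sup>2 / real n \<le> (2 * \<bar>K\<bar> + 1)\<^sup>2"
proof -
  have s: "1 \<le> sqrt (real n)" using assms by simp
  have "ln (real n) = 2 * ln (sqrt (real n))" using assms by (simp add: ln_sqrt)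
  also have "ln (sqrt (real n)) \<le> sqrt (real n)" using s ln_le_minus_one[of "sqrt (real n)"] by linarith
  finally have ln: "ln (real n) \<le> 2 * sqrt (real n)" by simp
  have "real l \<le> \<bar>K\<bar> * ln (real n)"
    using assms by (intro order_trans[OF assms(2)] mult_right_mono) auto
  also have "\<dots> \<le> \<bar>K\<bar> * (2 * sqrt (real n))" by (intro mult_left_mono ln) auto
  finally have "real l + 1 \<le> \<bar>K\<bar> * (2 * sqrt (real n)) + sqrt (real n)" using s by linarith
  also have "\<dots> = (2 * \<bar>K\<bar> + 1) * sqrt (real n)" by (simp add: algebra_simps)
  finally have "real l + 1 \<le> (2 * \<bar>K\<bar> + 1) * sqrt (real n)" .
  then have "(real l + 1)\<^sup>2 \<le> ((2 * \<bar>K\<bar> + 1) * sqrt (real n))\<^sup>2" by (intro power_mono) auto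
  also have "\<dots> = (2 * \<bar>K\<bar> + 1)\<^sup>2 * real n" by (simp add: power_mult_distrib)
  finally show ?thesis using assms(1) by (simp only: pos_divide_le_eq of_nat_0_less_iff)
qed

lemma walk_sum_bound:
  fixes gam rho lam mu \<delta> C K :: real
  assumes gam: "gam > 0" and rho01: "0 < rho" "rho < 1" and lm: "lam > 0" "mu > 0"
    and lamg: "lam\<^sup>2 \<le> gam" and \<delta>: "0 < \<delta>" and A: "A_plus lam mu rho > (1 + \<delta>) * gam" and Cq: "Cq \<ge> 1"
  shows "\<exists>R>0. \<forall>n N l a b w d j f. real n = gam * real N \<longrightarrow> real l \<le> K * ln (real n) \<longrightarrow> (1 + \<delta>) ^ l \<ge> (real n)\<^sup>2 \<longrightarrow>
     ref_path n N l a b (dval lam mu) rho Cq 9 \<longrightarrow>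
     ref_path.walk_sum n N l a b w (dval lam mu) rho Cq 9 l (d, j, a 0, f, True) \<le> R * A_plus lam mu rho ^ l / real n"
proof -
  define A where "A = A_plus lam mu rho"
  have Ag: "gam < A"
    using assms(8) \<delta> gam unfolding A_def by (smt (verit) mult_less_cancel_right1)
  have A0: "A > 0" using Ag gam by simp
  define phi where "phi = eigvec lam mu rho"
  have phi_pos: "phi d > 0" for d unfolding phi_def by (rule eigvec_pos) (use rho01 lm lamg Ag A_def in auto)
  define phim where "phim = min (phi Bullet) (phi Circ)"
  define phiM where "phiM = max (phi Bullet) (phi Circ)"
  have phim: "0 < phim" "phim \<le> phi d" "phi d \<le> phiM" "0 < phiM" for d
    using phi_pos[of Bullet] phi_pos[of Circ] by (cases d; auto simp: phim_def phiM_def)+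
  define L where "L = max lam mu"
  have L: "dval lam mu d \<le> L" "L > 0" for d using lm by (cases d; auto simp: L_def dval_def)+
  define H where "H = (2 * \<bar>K\<bar> + 1)\<^sup>2"
  define Q where "Q = 1 + 9 * gam * H"
  have H: "H \<ge> 0" by (simp add: H_def)
  have Q: "Q \<ge> 1" using gam H by (simp add: Q_def)
  define E0 where "E0 = Cq * 2 * L\<^sup>2 * Q + 2 * Cq * 9 * L * gam"
  have E0: "E0 > 0" unfolding E0_def using Cq L Q gam by (intro add_pos_pos mult_pos_pos) auto
  define c1 where "c1 = E0 * phiM / (A - gam)"
  have c1: "c1 > 0" "c1 * (A - gam) = E0 * phiM" using E0 phim Ag by (auto simp: c1_def)
  define c2 where "c2 = (E0 * phiM + 2 * Cq * gam * c1) / A"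
  have c2: "c2 > 0" "c2 * A = E0 * phiM + 2 * Cq * gam * c1"
    using E0 phim A0 c1 Cq gam by (auto simp: c2_def intro!: divide_pos_pos add_pos_pos mult_pos_pos)
  define x1 where "x1 = 9 * gam * A * phiM + 2 * L\<^sup>2 * Q * c2 + 2 * 9 * L * gam * c1"
  define x2 where "x2 = E0 * c2 + 2 * Cq * 9 * L * gam * c1"
  define y1 where "y1 = 2 * L\<^sup>2 * Q * Cq + 2 * 9 * L * gam"
  define y2 where "y2 = E0 * Cq + 2 * Cq * 9 * L * gam"
  have x: "x1 \<ge> 0" "x2 \<ge> 0" "y1 \<ge> 0" "y2 \<ge> 0"
    unfolding x1_def x2_def y1_def y2_def using Cq L Q gam E0 c1 c2 phim A0
    by (auto intro!: add_nonneg_nonneg mult_nonneg_nonneg)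
  \<comment> \<open>Each of \<open>c5\<close> and \<open>c6\<close> has three lower bounds to meet;
    the sum of the three quotients meets them all at once.\<close>
  define c5 where "c5 = x1 / phim + x2 / c1 + x2 / c2"
  define c6 where "c6 = y1 / phim + y2 / c1 + y2 / c2"
  have c56: "c5 \<ge> 0" "c6 \<ge> 0" unfolding c5_def c6_def using x phim(1) c1 c2 by auto
  have ge: "p \<le> c * (p / c + q + r)" "p \<le> c * (q + p / c + r)" "p \<le> c * (q + r + p / c)"
    if "c > 0" "q \<ge> 0" "r \<ge> 0" for p q r c :: real
    using that by (auto simp: algebra_simps)
  have nn: "0 \<le> x1 / phim" "0 \<le> x2 / c1" "0 \<le> x2 / c2" "0 \<le> y1 / phim" "0 \<le> y2 / c1" "0 \<le> y2 / c2"
    using x phim(1) c1 c2 by auto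
  \<comment> \<open>The exponential bounds the growth caused by meeting S, the next factor comes
    from \<open>al_le\<close>, and the final 1 pays for \<open>gam ^ l\<close>.\<close>
  define R where "R = c1 * (exp (c5 * H / A) * (1 + c6 / (A - gam))) + 1"
  have R: "R > 0" unfolding R_def using c1 c56 Ag by (intro add_nonneg_pos mult_nonneg_nonneg) auto
  show ?thesis
  proof (intro exI[of _ R] conjI R allI impI)
    fix n N l a b w d j f
    assume nN: "real n = gam * real N" and lK: "real l \<le> K * ln (real n)" and ln2: "(1 + \<delta>) ^ l \<ge> (real n)\<^sup>2"
      and rp: "ref_path n N l a b (dval lam mu) rho Cq 9"
    interpret ref_path n N l a b w "dval lam mu" rho Cq 9 by fact
    have lH: "(real l + 1)\<^sup>2 / real n \<le> H" unfolding H_def by (rule length_bound[OF n_pos lK])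
    have "real l + 1 \<le> (real l + 1)\<^sup>2" by (simp add: power2_eq_square)
    then have lH1: "(real l + 1) / real n \<le> H" using lH by (meson divide_right_mono of_nat_0_le_iff order_trans)
    interpret walk_potential n N l a b w "dval lam mu" rho Cq 9 A gam L Q H c1 c2 c5 c6 phi phim phiM
    proof
      show "1 + 9 * gam * H \<le> Q" by (simp add: Q_def)
      show "(\<Sum>d'\<in>UNIV. (if d = d' then 1 else rho\<^sup>2) * (dval lam mu d')\<^sup>2 * phi d') = A * phi d" for d
        unfolding phi_def A_def by (rule eigvec[OF rho01])
      show "(Cq * 2 * L\<^sup>2 * Q + 2 * Cq * 9 * L * gam) * phiM \<le> c1 * (A - gam)"
        using c1 by (simp add: E0_def)
      show "(Cq * 2 * L\<^sup>2 * Q + 2 * Cq * 9 * L * gam) * phiM + 2 * Cq * gam * c1 \<le> c2 * A"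
        using c2 by (simp add: E0_def)
      show "9 * gam * A * phiM + 2 * L\<^sup>2 * Q * c2 + 2 * 9 * L * gam * c1 \<le> c5 * phim"
        unfolding x1_def[symmetric] c5_def using ge(1)[OF phim(1) nn(2,3), of x1] by (simp add: mult.commute)
      show "(Cq * 2 * L\<^sup>2 * Q + 2 * Cq * 9 * L * gam) * c2 + 2 * Cq * 9 * L * gam * c1 \<le> c1 * c5"
        unfolding E0_def[symmetric] x2_def[symmetric] c5_def by (rule ge(2)[OF c1(1) nn(1,3)])
      show "(Cq * 2 * L\<^sup>2 * Q + 2 * Cq * 9 * L * gam) * c2 + 2 * Cq * 9 * L * gam * c1 \<le> c2 * c5"
        unfolding E0_def[symmetric] x2_def[symmetric] c5_def by (rule ge(3)[OF c2(1) nn(1,2)])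
      show "2 * L\<^sup>2 * Q * Cq + 2 * 9 * L * gam \<le> c6 * phim"
        unfolding y1_def[symmetric] c6_def using ge(1)[OF phim(1) nn(5,6), of y1] by (simp add: mult.commute)
      show "(Cq * 2 * L\<^sup>2 * Q + 2 * Cq * 9 * L * gam) * Cq + 2 * Cq * 9 * L * gam \<le> c1 * c6"
        unfolding E0_def[symmetric] y2_def[symmetric] c6_def by (rule ge(2)[OF c1(1) nn(4,6)])
      show "(Cq * 2 * L\<^sup>2 * Q + 2 * Cq * 9 * L * gam) * Cq + 2 * Cq * 9 * L * gam \<le> c2 * c6"
        unfolding E0_def[symmetric] y2_def[symmetric] c6_def by (rule ge(3)[OF c2(1) nn(4,5)])
    qed (use nN L Ag lH1 phim c1 c2 c56 in auto)
    have "(A + c5 * h) ^ l = A ^ l * (1 + c5 * h / A) ^ l"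
      using A0 by (simp add: power_mult_distrib[symmetric] field_simps)
    also have "\<dots> \<le> A ^ l * exp (c5 * h / A) ^ l"
      using A0 c56 local.h by (intro mult_left_mono power_mono exp_ge_add_one_self) auto
    also have "exp (c5 * h / A) ^ l = exp (real l * (c5 * h / A))" by (rule exp_of_nat_mult[symmetric])
    also have "\<dots> \<le> exp (c5 * H / A)"
    proof -
      have "real l * h \<le> (real l + 1)\<^sup>2 / real n"
        using n_pos by (simp add: h_def power2_eq_square divide_right_mono)
      then have "real l * h \<le> H" using lH by linarith
      then have "c5 * (real l * h) / A \<le> c5 * H / A" using c56 A0 by (intro divide_right_mono mult_left_mono) auto
      then show ?thesis by (simp add: mult_ac)
    qed
    finally have pw: "(A + c5 * h) ^ l \<le> A ^ l * exp (c5 * H / A)" using A0 by (simp add: mult_left_mono)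
    \<comment> \<open>Over \<open>l\<close> steps the gap \<open>A > (1 + \<delta>) * gam\<close>
      gains the power \<open>(1 + \<delta>) ^ l\<close>, which outweighs \<open>n\<close>.\<close>
    have "gam ^ l \<le> A ^ l / real n"
    proof -
      have n1: "real n * 1 \<le> real n * real n" using n_pos by (intro mult_left_mono) auto
      have g0: "0 \<le> gam ^ l" using assms(1) by simp
      have "real n * gam ^ l \<le> (real n)\<^sup>2 * gam ^ l"
        by (rule mult_right_mono[OF _ g0]) (use n1 in \<open>simp add: power2_eq_square\<close>)
      also have "\<dots> \<le> (1 + \<delta>) ^ l * gam ^ l" using ln2 g0 by (intro mult_right_mono) auto
      also have "\<dots> = ((1 + \<delta>) * gam) ^ l" by (simp add: power_mult_distrib)
      also have "\<dots> \<le> A ^ l" using assms(8) \<delta> assms(1) unfolding A_def by (intro power_mono) auto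
      finally show ?thesis using n_pos by (simp add: field_simps)
    qed
    moreover have "c1 * ((A + c5 * h) ^ l * (1 + c6 / (A - gam))) / real n \<le>
      c1 * ((A ^ l * exp (c5 * H / A)) * (1 + c6 / (A - gam))) / real n"
      using pw c_nonneg Ag by (intro divide_right_mono mult_left_mono mult_right_mono) auto
    ultimately have "walk_sum l (d, j, a 0, f, True) \<le>
      c1 * ((A ^ l * exp (c5 * H / A)) * (1 + c6 / (A - gam))) / real n + A ^ l / real n"
      using walk_sum_start_le[of d j f] by linarith
    also have "\<dots> = R * A ^ l / real n" by (simp add: R_def algebra_simps add_divide_distrib)
    finally show "walk_sum l (d, j, a 0, f, True) \<le> R * A_plus lam mu rho ^ l / real n" unfolding A_def .
  qed
qed

section \<open>Exponential lower bound for the word sum\<close>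

text \<open>The squared weight of the letters that follow \<open>d\<close>. The empty tail vanishes
  after Circ, which encodes that words end with Bullet.\<close>

primrec tail_wt :: "real \<Rightarrow> real \<Rightarrow> real \<Rightarrow> decoration \<Rightarrow> decoration list \<Rightarrow> real" where
  "tail_wt lam mu rho d [] = (if d = Bullet then 1 else 0)"
| "tail_wt lam mu rho d (d' # w) = (if d = d' then 1 else rho\<^sup>2) * (dval lam mu d')\<^sup>2 * tail_wt lam mu rho d' w"

lemma card_changes_Cons:
  "card (changes (d # d' # w)) = (if d = d' then 0 else 1) + card (changes (d' # w))"
proof -
  have "changes (d # d' # w) = (if d = d' then {} else {1}) \<union> Suc ` changes (d' # w)"
  proof (rule set_eqI)
    fix t
    show "t \<in> changes (d # d' # w) \<longleftrightarrow> t \<in> (if d = d' then {} else {1}) \<union> Suc ` changes (d' # w)"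
    proof (cases t)
      case (Suc r)
      then show ?thesis by (cases r) (auto simp: changes_def image_iff)
    qed (auto simp: changes_def)
  qed
  moreover have "finite (changes (d' # w))" "1 \<notin> Suc ` changes (d' # w)" by (auto simp: changes_def)
  ultimately show ?thesis by (simp add: card_image)
qed

lemma weight_Cons:
  "(if last (d # w) = Bullet then (weight lam mu rho (d # w))\<^sup>2 else 0) = (dval lam mu d)\<^sup>2 * tail_wt lam mu rho d w"
proof (induction w arbitrary: d)
  case Nil
  have "changes [d] = {}" for d by (auto simp: changes_def)
  then show ?case by (simp add: weight_def)
next
  case (Cons d' w)
  have "(weight lam mu rho (d # d' # w))\<^sup>2 = (dval lam mu d)\<^sup>2 * (if d = d' then 1 else rho\<^sup>2) * (weight lam mu rho (d' # w))\<^sup>2"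
    unfolding weight_def card_changes_Cons
    by (simp add: prod.lessThan_Suc_shift power_mult_distrib power_add power2_eq_square del: prod.lessThan_Suc)
  then show ?case using Cons[of d'] by (auto split: if_splits)
qed

primrec tail_sum :: "real \<Rightarrow> real \<Rightarrow> real \<Rightarrow> nat \<Rightarrow> decoration \<Rightarrow> real" where
  "tail_sum lam mu rho 0 d = (if d = Bullet then 1 else 0)"
| "tail_sum lam mu rho (Suc k) d = (\<Sum>d'\<in>UNIV. (if d = d' then 1 else rho\<^sup>2) * (dval lam mu d')\<^sup>2 * tail_sum lam mu rho k d')"

lemma finite_decoration_lists: "finite {w :: decoration list. length w = k}"
  using finite_lists_length_eq[OF finite_decoration, of UNIV k] by simp

lemma tail_sum_eq: "tail_sum lam mu rho k d = (\<Sum>w | length w = k. tail_wt lam mu rho d w)"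
proof (induction k arbitrary: d)
  case (Suc k)
  have "{w :: decoration list. length w = Suc k} = (\<lambda>(d, w). d # w) ` (UNIV \<times> {w. length w = k})"
    by (auto simp: image_iff length_Suc_conv)
  moreover have "inj_on (\<lambda>(d, w). d # w) (UNIV \<times> {w :: decoration list. length w = k})"
    by (auto simp: inj_on_def)
  ultimately have "(\<Sum>w | length w = Suc k. tail_wt lam mu rho d w) =
    (\<Sum>(d', w)\<in>UNIV \<times> {w. length w = k}. tail_wt lam mu rho d (d' # w))"
    by (simp add: sum.reindex case_prod_unfold)
  also have "\<dots> = (\<Sum>d'\<in>UNIV. \<Sum>w | length w = k. tail_wt lam mu rho d (d' # w))"
    by (rule sum.cartesian_product[symmetric])
  also have "\<dots> = tail_sum lam mu rho (Suc k) d" by (simp add: Suc sum_distrib_left)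
  finally show ?case by simp
qed simp

lemma word_sum_Suc: "word_sum lam mu rho (Suc k) = lam\<^sup>2 * tail_sum lam mu rho k Bullet"
proof -
  have w: "words (Suc k) = (\<lambda>w. Bullet # w) ` {w \<in> {w. length w = k}. last (Bullet # w) = Bullet}"
    by (auto simp: words_def image_iff length_Suc_conv split: if_splits)
  have "word_sum lam mu rho (Suc k) =
    (\<Sum>w\<in>{w \<in> {w. length w = k}. last (Bullet # w) = Bullet}. (weight lam mu rho (Bullet # w))\<^sup>2)"
    unfolding word_sum_def w by (subst sum.reindex) (auto simp: inj_on_def)
  also have "\<dots> = (\<Sum>w | length w = k. if last (Bullet # w) = Bullet then (weight lam mu rho (Bullet # w))\<^sup>2 else 0)"
    by (rule sum.inter_filter[OF finite_decoration_lists])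
  also have "\<dots> = (\<Sum>w | length w = k. lam\<^sup>2 * tail_wt lam mu rho Bullet w)"
    unfolding weight_Cons by (simp add: dval_def)
  finally show ?thesis by (simp add: tail_sum_eq sum_distrib_left)
qed

text \<open>A nonnegative matrix preserves the comparison with its eigenvector, so one initial
  inequality propagates. It starts at \<open>Suc 0\<close> because at 0 the Circ entry vanishes and
  cannot dominate a positive vector; words of length 1 are therefore treated apart and account for
  the minimum in \<open>c\<close>.\<close>

lemma word_sum_lower:
  assumes rho01: "0 < rho" "rho < 1" and lm: "lam > 0" "mu > 0" and A: "lam\<^sup>2 < A_plus lam mu rho"
  shows "\<exists>c>0. \<forall>l>0. word_sum lam mu rho l \<ge> c * A_plus lam mu rho ^ l"
proof -
  define A where "A = A_plus lam mu rho"
  have A0: "A > 0" using assms(5) unfolding A_def by (smt (verit) zero_le_power2)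
  define phi where "phi = eigvec lam mu rho"
  have phi_pos: "phi d > 0" for d unfolding phi_def by (rule eigvec_pos) (use assms in auto)
  define phiM where "phiM = max (phi Bullet) (phi Circ)"
  have phiM: "phi d \<le> phiM" "0 < phiM" for d
    using phi_pos[of Bullet] by (cases d; auto simp: phiM_def)+
  define c0 where "c0 = rho\<^sup>2 * lam\<^sup>2 / phiM"
  have c0: "c0 > 0" using rho01 lm phiM by (auto simp: c0_def)
  have low: "c0 * A ^ k * phi d \<le> tail_sum lam mu rho (Suc k) d" for k d
  proof (induction k arbitrary: d)
    case 0
    have "c0 * phi d \<le> c0 * phiM" using phiM c0 by (intro mult_left_mono) auto
    also have "\<dots> = rho\<^sup>2 * lam\<^sup>2" using phiM by (simp add: c0_def)
    also have "\<dots> \<le> (if d = Bullet then 1 else rho\<^sup>2) * lam\<^sup>2"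
      using rho01 by (intro mult_right_mono) (auto simp: power_le_one)
    also have "\<dots> = tail_sum lam mu rho (Suc 0) d" by (simp add: UNIV_decoration dval_def)
    finally show ?case by simp
  next
    case (Suc k)
    have "c0 * A ^ Suc k * phi d = c0 * A ^ k * (A * phi d)" by simp
    also have "A * phi d = (\<Sum>d'\<in>UNIV. (if d = d' then 1 else rho\<^sup>2) * (dval lam mu d')\<^sup>2 * phi d')"
      unfolding A_def phi_def by (rule eigvec[OF rho01, symmetric])
    also have "c0 * A ^ k * \<dots> = (\<Sum>d'\<in>UNIV. (if d = d' then 1 else rho\<^sup>2) * (dval lam mu d')\<^sup>2 * (c0 * A ^ k * phi d'))"
      unfolding sum_distrib_left by (intro sum.cong) auto
    also have "\<dots> \<le> (\<Sum>d'\<in>UNIV. (if d = d' then 1 else rho\<^sup>2) * (dval lam mu d')\<^sup>2 * tail_sum lam mu rho (Suc k) d')"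
      by (intro sum_mono mult_left_mono Suc) auto
    finally show ?case by simp
  qed
  define c where "c = min (lam\<^sup>2 / A) (lam\<^sup>2 * c0 * phi Bullet / A\<^sup>2)"
  have c: "c > 0" using lm A0 c0 phi_pos[of Bullet] by (auto simp: c_def)
  show ?thesis
  proof (intro exI[of _ c] conjI c allI impI)
    fix l :: nat assume "l > 0"
    then obtain k where l: "l = Suc k" by (cases l) auto
    show "c * A_plus lam mu rho ^ l \<le> word_sum lam mu rho l"
    proof (cases k)
      case 0
      have "c * A \<le> lam\<^sup>2 / A * A" using A0 by (intro mult_right_mono) (auto simp: c_def)
      then show ?thesis using A0 by (simp add: l 0 word_sum_Suc A_def)
    next
      case (Suc r)
      have "c * A ^ l \<le> (lam\<^sup>2 * c0 * phi Bullet / A\<^sup>2) * A ^ l" using A0 by (intro mult_right_mono) (auto simp: c_def)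
      also have "\<dots> = lam\<^sup>2 * (c0 * A ^ r * phi Bullet)" using A0 by (simp add: l Suc power2_eq_square)
      also have "\<dots> \<le> lam\<^sup>2 * tail_sum lam mu rho (Suc r) Bullet" by (intro mult_left_mono low) auto
      also have "\<dots> = word_sum lam mu rho l" unfolding l Suc by (rule word_sum_Suc[symmetric])
      finally show ?thesis by (simp add: A_def)
    qed
  qed
qed

section \<open>Counting paths\<close>

text \<open>The falling factorial divided by \<open>m ^ k\<close> is a product of factors
  \<open>1 - (i + r) / m\<close>, to which the Weierstrass inequality applies. The offset
  \<open>r\<close> is 2 for the a side, where both endpoints are excluded but the comparison is with
  powers of \<open>n\<close>.\<close>

lemma card_distinct_lists_lower:
  assumes A: "finite A" and k: "k \<le> card A" and m: "card A + r = m" and m0: "m > 0"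
  shows "real m ^ k * (1 - real k * (real k + real r) / real m) \<le>
    real (card {xs. length xs = k \<and> distinct xs \<and> set xs \<subseteq> A})"
proof -
  define M where "M = card A"
  have "(\<Prod>{M - k + 1..M}) = (\<Prod>i<k. M - i)"
    by (rule prod.reindex_bij_witness[of _ "\<lambda>i. M - i" "\<lambda>j. M - j"]) (use k in \<open>auto simp: M_def\<close>)
  then have c: "card {xs. length xs = k \<and> distinct xs \<and> set xs \<subseteq> A} = (\<Prod>i<k. M - i)"
    using card_lists_distinct_length_eq[OF A k] by (simp add: M_def)
  have f: "(real i + real r) / real m \<in> {0..1}" if "i < k" for i
    using that k m m0 by (auto simp: field_simps)
  have "1 - real k * (real k + real r) / real m \<le> 1 - (\<Sum>i<k. (real i + real r) / real m)"
  proof -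
    have "(\<Sum>i<k. (real i + real r) / real m) \<le> (\<Sum>i<k. (real k + real r) / real m)"
      by (intro sum_mono divide_right_mono) auto
    then show ?thesis by simp
  qed
  also have "\<dots> \<le> (\<Prod>i<k. 1 - (real i + real r) / real m)"
    by (rule Weierstrass_prod_ineq) (use f in auto)
  finally have "real m ^ k * (1 - real k * (real k + real r) / real m) \<le> real m ^ k * (\<Prod>i<k. 1 - (real i + real r) / real m)"
    by (rule mult_left_mono) simp
  also have "\<dots> = (\<Prod>i<k. real m * (1 - (real i + real r) / real m))"
    by (simp only: prod.distrib prod_constant card_lessThan)
  also have "\<dots> = (\<Prod>i<k. real (M - i))"
  proof (rule prod.cong[OF refl])
    fix i assume "i \<in> {..<k}"
    then have "real (M - i) = real m - (real i + real r)" using k m by (auto simp: M_def)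
    then show "real m * (1 - (real i + real r) / real m) = real (M - i)" using m0 by (simp add: right_diff_distrib)
  qed
  finally show ?thesis unfolding c by simp
qed

lemma card_distinct_lists_upper:
  assumes "finite A"
  shows "card {xs. length xs = k \<and> distinct xs \<and> set xs \<subseteq> A} \<le> card A ^ k"
proof -
  have "card {xs. length xs = k \<and> distinct xs \<and> set xs \<subseteq> A} \<le> card {xs. set xs \<subseteq> A \<and> length xs = k}"
    by (rule card_mono[OF finite_lists_length_eq[OF assms]]) auto
  then show ?thesis using card_lists_length_eq[OF assms] by simp
qed

lemma card_paths_word:
  assumes w: "w \<in> words l" and uv: "u < n" "v < n" "u \<noteq> v"
  shows "card {xs \<in> paths n N l u v. map fst xs = w} =
    card {bs. length bs = l \<and> distinct bs \<and> set bs \<subseteq> {..<N}} *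
    card {as. length as = l - 1 \<and> distinct as \<and> set as \<subseteq> {..<n} - {u, v}}"
proof -
  let ?B = "{bs. length bs = l \<and> distinct bs \<and> set bs \<subseteq> {..<N}}"
  let ?A = "{as. length as = l - 1 \<and> distinct as \<and> set as \<subseteq> {..<n} - {u, v}}"
  define f :: "nat list \<times> nat list \<Rightarrow> pstep list" where "f = (\<lambda>(bs, as). zip w (zip bs (as @ [v])))"
  have lw: "length w = l" "l > 0" using w by (auto simp: words_def)
  have maps: "length (f (bs, as)) = l" "map fst (f (bs, as)) = w" "map (fst \<circ> snd) (f (bs, as)) = bs"
    "map (snd \<circ> snd) (f (bs, as)) = as @ [v]" if "bs \<in> ?B" "as \<in> ?A" for bs as
  proof -
    have len: "length bs = l" "length (as @ [v]) = l" using that lw by auto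
    then have len2: "length (zip bs (as @ [v])) = l" by simp
    show "length (f (bs, as)) = l" using lw len2 by (simp add: f_def)
    show "map fst (f (bs, as)) = w" using lw len2 by (simp add: f_def)
    have s: "map snd (f (bs, as)) = zip bs (as @ [v])" using lw len2 by (simp add: f_def)
    show "map (fst \<circ> snd) (f (bs, as)) = bs" unfolding map_map[symmetric] s using len by simp
    show "map (snd \<circ> snd) (f (bs, as)) = as @ [v]" unfolding map_map[symmetric] s using len by simp
  qed
  have inj: "inj_on f (?B \<times> ?A)"
  proof (rule inj_onI)
    fix p q assume p: "p \<in> ?B \<times> ?A" "q \<in> ?B \<times> ?A" "f p = f q"
    obtain bs as bs' as' where pq: "p = (bs, as)" "q = (bs', as')" by fastforce
    show "p = q" using maps(3,4)[of bs as] maps(3,4)[of bs' as'] p unfolding pq by auto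
  qed
  have "f ` (?B \<times> ?A) = {xs \<in> paths n N l u v. map fst xs = w}"
  proof (intro equalityI subsetI)
    fix xs assume "xs \<in> f ` (?B \<times> ?A)"
    then obtain bs as where ba: "bs \<in> ?B" "as \<in> ?A" "xs = f (bs, as)" by auto
    note m = maps[OF ba(1,2), folded ba(3)]
    have "length as = l - 1" using ba by auto
    then have "(u # as @ [v]) ! l = v" using lw by (cases l) (auto simp: nth_append)
    then have "av u xs l = v" by (simp add: av_def m)
    moreover have "simple u xs" unfolding simple_def m using ba uv by auto
    moreover have "set (map (fst \<circ> snd) xs) \<subseteq> {..<N}" unfolding m using ba by auto
    moreover have "set (map (snd \<circ> snd) xs) \<subseteq> {..<n}" unfolding m using ba uv by auto
    ultimately show "xs \<in> {xs \<in> paths n N l u v. map fst xs = w}"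
      unfolding paths_def mem_Collect_eq m(2) using w by blast
  next
    fix xs assume "xs \<in> {xs \<in> paths n N l u v. map fst xs = w}"
    then have xs: "simple u xs" "map fst xs = w" "av u xs l = v" "set (map (fst \<circ> snd) xs) \<subseteq> {..<N}"
      "set (map (snd \<circ> snd) xs) \<subseteq> {..<n}" by (auto simp: paths_def)
    have len: "length xs = l" using xs(2) lw by (metis length_map)
    define bs where "bs = map (fst \<circ> snd) xs"
    define cs where "cs = map (snd \<circ> snd) xs"
    have "cs \<noteq> []" using len lw by (auto simp: cs_def)
    moreover have "last cs = v"
    proof -
      have "last cs = cs ! (l - 1)" using \<open>cs \<noteq> []\<close> len by (simp add: last_conv_nth cs_def)
      also have "\<dots> = (u # cs) ! l" using lw by (cases l) auto
      also have "\<dots> = v" using xs(3) by (simp add: av_def cs_def)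
      finally show ?thesis .
    qed
    ultimately have cs: "cs = butlast cs @ [v]" by (metis append_butlast_last_id)
    have d: "distinct (u # cs)" "distinct bs" using xs(1) by (auto simp: simple_def cs_def bs_def)
    have lc: "length cs = l" using len by (simp add: cs_def)
    have "bs \<in> ?B" using xs d len by (auto simp: bs_def)
    moreover have "butlast cs \<in> ?A"
    proof -
      have "distinct (butlast cs @ [v])" "u \<notin> set (butlast cs @ [v])" using d cs by (metis distinct.simps(2))+
      moreover have "set (butlast cs @ [v]) \<subseteq> {..<n}" using xs(5) cs by (simp add: cs_def)
      ultimately show ?thesis using lc by auto
    qed
    moreover have "xs = f (bs, butlast cs)"
    proof -
      have "f (bs, butlast cs) = zip (map fst xs) (zip bs cs)" using cs xs(2) by (simp add: f_def)
      also have "\<dots> = xs" by (rule nth_equalityI) (auto simp: bs_def cs_def)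
      finally show ?thesis by simp
    qed
    ultimately show "xs \<in> f ` (?B \<times> ?A)" by blast
  qed
  then have "card {xs \<in> paths n N l u v. map fst xs = w} = card (?B \<times> ?A)"
    using card_image[OF inj] by simp
  then show ?thesis by (simp add: card_cartesian_product)
qed

lemma sum_weight_paths:
  assumes uv: "u < n" "v < n" "u \<noteq> v"
  shows "(\<Sum>xs\<in>paths n N l u v. (weight lam mu rho (map fst xs))\<^sup>2) = word_sum lam mu rho l *
    (real (card {bs. length bs = l \<and> distinct bs \<and> set bs \<subseteq> {..<N}}) *
     real (card {as. length as = l - 1 \<and> distinct as \<and> set as \<subseteq> {..<n} - {u, v}}))"
proof -
  have "(\<Sum>xs\<in>paths n N l u v. (weight lam mu rho (map fst xs))\<^sup>2) =
    (\<Sum>w\<in>words l. \<Sum>xs\<in>{xs \<in> paths n N l u v. map fst xs = w}. (weight lam mu rho (map fst xs))\<^sup>2)"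
    by (rule sum.group[symmetric, OF finite_paths finite_words]) (auto simp: paths_def)
  also have "\<dots> = (\<Sum>w\<in>words l. real (card {xs \<in> paths n N l u v. map fst xs = w}) * (weight lam mu rho w)\<^sup>2)"
    by (intro sum.cong) auto
  also have "\<dots> = word_sum lam mu rho l *
    (real (card {bs. length bs = l \<and> distinct bs \<and> set bs \<subseteq> {..<N}}) *
     real (card {as. length as = l - 1 \<and> distinct as \<and> set as \<subseteq> {..<n} - {u, v}}))"
    unfolding word_sum_def sum_distrib_right by (intro sum.cong) (auto simp: card_paths_word[OF _ uv])
  finally show ?thesis .
qed

lemma sum_weight_paths_upper:
  assumes uv: "u < n" "v < n" "u \<noteq> v" and l: "l > 0"
  shows "(\<Sum>xs\<in>paths n N l u v. (weight lam mu rho (map fst xs))\<^sup>2) * real n \<le> word_sum lam mu rho l * (real N ^ l * real n ^ l)"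
proof -
  have ws: "word_sum lam mu rho l \<ge> 0" unfolding word_sum_def by (intro sum_nonneg) auto
  have "real (card {bs. length bs = l \<and> distinct bs \<and> set bs \<subseteq> {..<N}}) \<le> real N ^ l"
    using card_distinct_lists_upper[of "{..<N}" l] by (metis card_lessThan finite_lessThan of_nat_le_iff of_nat_power)
  moreover have "real (card {as. length as = l - 1 \<and> distinct as \<and> set as \<subseteq> {..<n} - {u, v}}) \<le> real n ^ (l - 1)"
  proof -
    have "card {as. length as = l - 1 \<and> distinct as \<and> set as \<subseteq> {..<n} - {u, v}} \<le> card ({..<n} - {u, v}) ^ (l - 1)"
      by (rule card_distinct_lists_upper) simp
    also have "\<dots> \<le> n ^ (l - 1)" using card_mono[of "{..<n}" "{..<n} - {u, v}"] by (intro power_mono) auto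
    finally show ?thesis by (simp only: of_nat_le_iff of_nat_power[symmetric])
  qed
  ultimately have "(\<Sum>xs\<in>paths n N l u v. (weight lam mu rho (map fst xs))\<^sup>2) \<le> word_sum lam mu rho l * (real N ^ l * real n ^ (l - 1))"
    unfolding sum_weight_paths[OF uv] by (intro mult_left_mono mult_mono ws) auto
  then have "(\<Sum>xs\<in>paths n N l u v. (weight lam mu rho (map fst xs))\<^sup>2) * real n \<le>
     word_sum lam mu rho l * (real N ^ l * real n ^ (l - 1)) * real n" by (intro mult_right_mono) auto
  also have "\<dots> = word_sum lam mu rho l * (real N ^ l * real n ^ l)" using l by (cases l) auto
  finally show ?thesis .
qed

lemma sum_weight_paths_lower:
  assumes uv: "u < n" "v < n" "u \<noteq> v" and l: "l > 0"
    and small: "4 * (real l)\<^sup>2 \<le> real n" "4 * (real l)\<^sup>2 \<le> real N"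
  shows "word_sum lam mu rho l * (real N ^ l * real n ^ l) \<le> 2 * ((\<Sum>xs\<in>paths n N l u v. (weight lam mu rho (map fst xs))\<^sup>2) * real n)"
proof -
  have ws: "word_sum lam mu rho l \<ge> 0" unfolding word_sum_def by (intro sum_nonneg) auto
  have l1: "1 \<le> real l" "real l \<le> (real l)\<^sup>2" using l by (auto simp: power2_eq_square)
  have N: "N > 0" "l \<le> N" using l1 small by (linarith, linarith)
  have n: "l + 1 \<le> n" using l1 small by linarith
  let ?B = "real (card {bs. length bs = l \<and> distinct bs \<and> set bs \<subseteq> {..<N}})"
  let ?A = "real (card {as. length as = l - 1 \<and> distinct as \<and> set as \<subseteq> {..<n} - {u, v}})"
  have "real N ^ l * (3 / 4) \<le> real N ^ l * (1 - real l * (real l + real 0) / real N)"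
    using small N by (intro mult_left_mono) (auto simp: field_simps power2_eq_square)
  also have "\<dots> \<le> ?B" by (rule card_distinct_lists_lower) (use N in auto)
  finally have B: "real N ^ l * (3 / 4) \<le> ?B" .
  have c: "card ({..<n} - {u, v}) = n - 2" using uv by (subst card_Diff_subset) auto
  have "real (l - 1) * (real (l - 1) + real 2) \<le> (real l)\<^sup>2"
    using l by (cases l) (auto simp: power2_eq_square algebra_simps)
  then have "real (l - 1) * (real (l - 1) + real 2) / real n \<le> 1 / 4"
    using small n by (simp add: field_simps)
  then have "real n ^ (l - 1) * (3 / 4) \<le> real n ^ (l - 1) * (1 - real (l - 1) * (real (l - 1) + real 2) / real n)"
    by (intro mult_left_mono) auto
  also have "\<dots> \<le> ?A" by (rule card_distinct_lists_lower) (use n c l in auto)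
  finally have A: "real n ^ (l - 1) * (3 / 4) \<le> ?A" .
  \<comment> \<open>The two losses multiply to 9/16, which still exceeds 1/2.\<close>
  have "(real N ^ l * (3 / 4)) * (real n ^ (l - 1) * (3 / 4)) \<le> ?B * ?A"
    by (intro mult_mono A B) auto
  moreover have "0 \<le> real N ^ l * real n ^ (l - 1)" by simp
  ultimately have AB: "real N ^ l * real n ^ (l - 1) \<le> 2 * (?B * ?A)" by (simp only: mult_ac)
  have "word_sum lam mu rho l * (real N ^ l * real n ^ l) = word_sum lam mu rho l * (real N ^ l * real n ^ (l - 1)) * real n"
    using l by (cases l) auto
  also have "\<dots> \<le> word_sum lam mu rho l * (2 * (?B * ?A)) * real n"
    by (intro mult_right_mono mult_left_mono AB ws) auto
  also have "\<dots> = 2 * ((\<Sum>xs\<in>paths n N l u v. (weight lam mu rho (map fst xs))\<^sup>2) * real n)"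
    unfolding sum_weight_paths[OF uv] by simp
  finally show ?thesis .
qed

text \<open>A fourth root instead of the square root of \<open>length_bound\<close>: here the square
  of \<open>l\<close> must be small compared with \<open>n\<close>, not merely of its order.\<close>

lemma length_small:
  assumes "n > 0" "real l \<le> K * ln (real n)"
  shows "(real l)\<^sup>2 \<le> 16 * K\<^sup>2 * sqrt (real n)"
proof -
  have s: "1 \<le> sqrt (sqrt (real n))" using assms by simp
  have "ln (real n) = 4 * ln (sqrt (sqrt (real n)))" using assms by (simp add: ln_sqrt)
  also have "ln (sqrt (sqrt (real n))) \<le> sqrt (sqrt (real n))" using s ln_le_minus_one[of "sqrt (sqrt (real n))"] by linarith
  finally have ln: "ln (real n) \<le> 4 * sqrt (sqrt (real n))" by simp
  have "real l \<le> \<bar>K\<bar> * ln (real n)"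
    using assms by (intro order_trans[OF assms(2)] mult_right_mono) auto
  also have "\<dots> \<le> \<bar>K\<bar> * (4 * sqrt (sqrt (real n)))" by (intro mult_left_mono ln) auto
  finally have "(real l)\<^sup>2 \<le> (\<bar>K\<bar> * (4 * sqrt (sqrt (real n))))\<^sup>2" by (intro power_mono) auto
  also have "\<dots> = 16 * K\<^sup>2 * sqrt (real n)" by (simp add: power_mult_distrib)
  finally show ?thesis .
qed

lemma length_eventually_small:
  assumes gam: "gam > 0"
  shows "\<exists>n0. \<forall>n N l. n \<ge> n0 \<longrightarrow> n > 0 \<longrightarrow> real n = gam * real N \<longrightarrow> real l \<le> K * ln (real n) \<longrightarrow>
    4 * (real l)\<^sup>2 \<le> real n \<and> 4 * (real l)\<^sup>2 \<le> real N"
proof -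
  \<comment> \<open>Once \<open>n\<close> is at least the square of \<open>Z\<close>,
    \<open>Z * sqrt n <= n\<close>; the factor \<open>1 + gam\<close> settles the bounds by
    \<open>n\<close> and by \<open>N = n / gam\<close> together.\<close>
  define Z where "Z = 64 * K\<^sup>2 * (1 + gam)"
  have Z: "Z \<ge> 0" using gam by (simp add: Z_def)
  show ?thesis
  proof (intro exI[of _ "nat \<lceil>Z\<^sup>2\<rceil>"] allI impI)
    fix n N l assume n: "nat \<lceil>Z\<^sup>2\<rceil> \<le> n" "n > 0" and nN: "real n = gam * real N" and l: "real l \<le> K * ln (real n)"
    have "Z\<^sup>2 \<le> real n" using n by linarith
    then have "Z \<le> sqrt (real n)" using real_le_rsqrt by blast
    then have "Z * sqrt (real n) \<le> sqrt (real n) * sqrt (real n)" by (intro mult_right_mono) auto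
    then have zn: "Z * sqrt (real n) \<le> real n" by simp
    have "4 * (real l)\<^sup>2 * (1 + gam) \<le> 4 * (16 * K\<^sup>2 * sqrt (real n)) * (1 + gam)"
      by (intro mult_right_mono mult_left_mono length_small[OF n(2) l]) (use gam in auto)
    also have "\<dots> = Z * sqrt (real n)" by (simp add: Z_def)
    finally have *: "4 * (real l)\<^sup>2 * (1 + gam) \<le> real n" using zn by linarith
    have "0 \<le> (real l)\<^sup>2 * gam" using gam by simp
    then have 1: "4 * (real l)\<^sup>2 \<le> real n" using * by (simp add: algebra_simps)
    have "4 * (real l)\<^sup>2 * gam \<le> real N * gam" using * nN by (simp add: algebra_simps) (smt (verit) zero_le_power2)
    then have 2: "4 * (real l)\<^sup>2 \<le> real N" using gam by simp
    show "4 * (real l)\<^sup>2 \<le> real n \<and> 4 * (real l)\<^sup>2 \<le> real N" using 1 2 by simp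
  qed
qed

section \<open>Correlation of one path with the spike at its ends\<close>

context path_pair begin

text \<open>With one path no noise entry has a partner, so only the pure signal term survives. Each
  b-vertex contributes a Gaussian moment of order 0 or 2, each interior a-vertex its change factor,
  and each end the second moment of the prior. The case \<open>r = 0\<close> is used for
  integrability only.\<close>

lemma single_expectation:
  assumes "r \<le> (1 :: nat)"
  defines "F \<equiv> (\<lambda>\<omega>. obs_path lam mu n u xs \<omega> * (spike_x \<omega> u ^ r * spike_x \<omega> v ^ r))"
  shows "integrable (planted P n N) F"
    and "r = 1 \<Longrightarrow> (\<integral>\<omega>. F \<omega> \<partial>planted P n N) = weight lam mu rho (map fst xs) / real n ^ l"
proof -
  define hh where "hh k = (if k < r then u else v)" for k
  define H where "H = {..<2 * r}"
  let ?d = "\<lambda>k. wv xs (fst k)" and ?i = "\<lambda>k. fst (path_edge u xs k)" and ?j = "\<lambda>k. snd (path_edge u xs k)"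
  have F: "F = (\<lambda>\<omega>. (\<Prod>k\<in>I. obs lam mu n \<omega> (?d k) (?i k) (?j k)) * (\<Prod>k\<in>H. spike_x \<omega> (hh k)))"
  proof
    fix \<omega>
    have "H = {..<r} \<union> {r..<2 * r}" by (auto simp: H_def)
    then have "(\<Prod>k\<in>H. spike_x \<omega> (hh k)) = (\<Prod>k<r. spike_x \<omega> (hh k)) * (\<Prod>k=r..<2 * r. spike_x \<omega> (hh k))"
      by (simp only:) (rule prod.union_disjoint, auto)
    also have "\<dots> = (\<Prod>k<r. spike_x \<omega> u) * (\<Prod>k=r..<2 * r. spike_x \<omega> v)"
      by (intro arg_cong2[of _ _ _ _ "(*)"] prod.cong) (auto simp: hh_def)
    finally have "(\<Prod>k\<in>H. spike_x \<omega> (hh k)) = spike_x \<omega> u ^ r * spike_x \<omega> v ^ r" by simp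
    then show "F \<omega> = (\<Prod>k\<in>I. obs lam mu n \<omega> (?d k) (?i k) (?j k)) * (\<Prod>k\<in>H. spike_x \<omega> (hh k))"
      unfolding F_def path_monomial_obs by (simp add: I_def XD(2))
  qed
  have cH: "card {k \<in> H. hh k = i} = (if i = u then r else 0) + (if i = v then r else 0)" for i
  proof -
    have "{k \<in> H. hh k = i} = (if i = u then {..<r} else {}) \<union> (if i = v then {r..<2 * r} else {})"
      using uv by (auto simp: H_def hh_def split: if_splits)
    then show ?thesis using uv by (auto simp: card_Un_disjoint)
  qed
  have deg: "card {k \<in> I. ?i k = i} + card {k \<in> H. hh k = i} \<le> 4" for i
    unfolding cH using card_inc_a[of xs i] assms(1) uv by auto
  have rng: "?i ` I \<subseteq> {..<n}" "?j ` I \<subseteq> {..<N}" "hh ` H \<subseteq> {..<n}"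
  proof -
    have "?i k < n \<and> ?j k < N" if k: "k \<in> I" for k
      using edge_in[OF k, of xs] XD(4,5) by auto
    then show "?i ` I \<subseteq> {..<n}" "?j ` I \<subseteq> {..<N}" by auto
    show "hh ` H \<subseteq> {..<n}" using uv by (auto simp: hh_def)
  qed
  have fH: "finite H" by (simp add: H_def)
  note ob = obs_expectation[OF prior finite_I fH rng deg, where lam = lam and mu = mu and dd = ?d]
  show "integrable (planted P n N) F" unfolding F by (rule ob(1))
  assume r: "r = 1"
  let ?T = "obs_term lam mu n N P ?d ?i ?j hh I H"
  have zero: "?T B = 0" if B: "B \<in> Pow I" "B \<noteq> {}" for B
  proof -
    obtain k where k: "k \<in> B" using B by auto
    have "{k' \<in> B. ?d k' = ?d k \<and> (?i k', ?j k') = (?i k, ?j k)} = {k}"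
    proof (intro equalityI subsetI)
      fix k' assume "k' \<in> {k' \<in> B. ?d k' = ?d k \<and> (?i k', ?j k') = (?i k, ?j k)}"
      then have "k' \<in> I" "k \<in> I" "path_edge u xs k' = path_edge u xs k" using k B(1) by (auto simp: prod_eq_iff)
      then show "k' \<in> {k}" using inj_onD[OF path_edge_inj[OF XD(1)], of k' k] XD(2) by (simp add: I_def)
    qed (use k in simp)
    then have 0: "normal_moment (card {k' \<in> B. ?d k' = ?d k \<and> (?i k', ?j k') = (?i k, ?j k)}) = 0" by simp
    have "?i k \<in> {..<n}" "?j k \<in> {..<N}" using rng(1,2) B k by blast+
    then have "(?i k, ?j k) \<in> {..<n} \<times> {..<N}" by (rule SigmaI)
    then have "(\<Prod>e\<in>{..<n} \<times> {..<N}. normal_moment (card {k' \<in> B. ?d k' = ?d k \<and> (?i k', ?j k') = e})) = 0"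
      by (intro prod_zero bexI[where x = "(?i k, ?j k)"] 0) auto
    then show ?thesis unfolding obs_term_def by (cases "?d k") auto
  qed
  have "(\<integral>\<omega>. F \<omega> \<partial>planted P n N) = (\<Sum>B\<in>Pow I. ?T B)" unfolding F by (rule ob(2))
  also have "\<dots> = (\<Sum>B\<in>{{}}. ?T B)" by (rule sum.mono_neutral_right) (use zero in auto)
  also have "\<dots> = ?T {}" by simp
  also have "\<dots> = weight lam mu rho (map fst xs) / real n ^ l"
  proof -
    have a: "(\<Prod>k\<in>I - {}. amp lam mu n (?d k)) = (\<Prod>t<l. dval lam mu (wv xs t)) / real n ^ l"
      using prod_amp[OF lam_pos mu_pos, of n "wv xs" l] by (simp add: I_def)
    have m: "(\<integral>p. (\<Prod>k\<in>{k \<in> I - {}. ?i k = i}. coord (?d k) p) * fst p ^ card {k \<in> H. hh k = i} \<partial>P) =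
      (\<Prod>t\<le>l. if av u xs t = i then change_wt rho xs t else 1)" for i
    proof -
      have P1: "(\<integral>p. 1 \<partial>P) = (1::real)" by (rule prior_one(1))
      have dx: "t \<le> l \<Longrightarrow> i = av u xs t \<Longrightarrow> (\<Prod>p\<le>l. if av u xs p = i then change_wt rho xs p else 1) = change_wt rho xs t"
        "i \<notin> av u xs ` {..l} \<Longrightarrow> (\<Prod>p\<le>l. if av u xs p = i then change_wt rho xs p else 1) = 1" for t
        using prod_vertex_delta[OF XD(1)] XD(2) by auto
      show ?thesis
      proof (cases "i \<in> av u xs ` {..l}")
        case False
        then have emp: "{k \<in> I - {}. ?i k = i} = {}" using edge_in(1)[of _ xs] by fastforce
        have "i \<noteq> u" "i \<noteq> v" using False end_vertices by auto
        then show ?thesis unfolding emp cH using dx(2)[OF False] P1 by simp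
      next
        case True
        then obtain t where t: "t \<le> l" "i = av u xs t" by auto
        have inc: "{k \<in> I - {}. ?i k = i} = (if t < l then {(t, False)} else {}) \<union> (if 0 < t then {(t - 1, True)} else {})"
          using inc_a[of xs t] t by simp
        show ?thesis
        proof (cases "t = 0 \<or> t = l")
          case True
          then have "i = u \<and> t = 0 \<or> i = v \<and> t = l" using t XD(3) by auto
          \<comment> \<open>The first and last letters are Bullet, so the edge at an end carries the
            same coordinate as the spike; the moment is 1 and not \<open>rho\<close>.\<close>
          then have "(\<lambda>p. (\<Prod>k\<in>{k \<in> I - {}. ?i k = i}. coord (?d k) p) * fst p ^ card {k \<in> H. hh k = i}) = (\<lambda>p. (fst p)\<^sup>2)"
            unfolding inc cH using uv r l_pos XD(6,7) by (auto simp: coord_def power2_eq_square)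
          then show ?thesis using priorD(5)[OF prior] dx(1)[OF t] True XD(2) by (auto simp: change_wt_def)
        next
          case False
          then have t': "0 < t" "t < l" using t by auto
          have "i \<noteq> u" using t t' av_eq[OF XD(1), of t 0] XD(2) by auto
          moreover have "i \<noteq> v" using t t' av_eq[OF XD(1), of t l] XD(2,3) by auto
          ultimately show ?thesis
            unfolding cH using prod_incident[of xs t "{k \<in> I - {}. ?i k = i}"] t' t dx(1)[OF t] by simp
        qed
      qed
    qed
    have b: "(\<Prod>j<N. normal_moment (card {k \<in> I - {}. ?d k = d \<and> ?j k = j})) = 1" for d
    proof (rule prod.neutral, rule ballI)
      fix j assume "j \<in> {..<N}"
      have "card {k \<in> I - {}. ?d k = d \<and> ?j k = j} = 0 \<or> card {k \<in> I - {}. ?d k = d \<and> ?j k = j} = 2"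
      proof (cases "j \<in> bv xs ` {..<l}")
        case False
        then have "{k \<in> I - {}. ?d k = d \<and> ?j k = j} = {}" using inc_b_empty[OF False] by auto
        then show ?thesis by (simp only: card.empty simp_thms)
      next
        case True
        then obtain t where t: "t < l" "j = bv xs t" by auto
        have "{k \<in> I - {}. ?d k = d \<and> ?j k = j} = {k \<in> {(t, False), (t, True)}. ?d k = d}"
          using inc_b[of xs t] t by auto
        also have "\<dots> = (if wv xs t = d then {(t, False), (t, True)} else {})" by auto
        finally show ?thesis by simp
      qed
      then show "normal_moment (card {k \<in> I - {}. ?d k = d \<and> ?j k = j}) = 1"
        by (elim disjE) (simp_all only: normal_moment_simps)
    qed
    have "(\<Prod>i<n. \<Prod>t\<le>l. if av u xs t = i then change_wt rho xs t else 1) = (\<Prod>t\<le>l. change_wt rho xs t)"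
      by (rule prod_over_vertices) (use XD(4) in auto)
    also have "\<dots> = rho ^ card (changes (map fst xs))" using prod_change_wt[of rho xs] XD(2) by simp
    finally show ?thesis
      unfolding obs_term_def a m b by (simp add: weight_def XD(2) wv_def)
  qed
  finally show "(\<integral>\<omega>. F \<omega> \<partial>planted P n N) = weight lam mu rho (map fst xs) / real n ^ l" .
qed

end

section \<open>Moments of the statistic and of the overlap\<close>

lemma spike_power:
  assumes pr: "prior rho C P" and i: "i < n" and m: "m \<le> 4"
  shows "integrable (planted P n N) (\<lambda>\<omega>. spike_x \<omega> i ^ m)"
    and "(\<integral>\<omega>. spike_x \<omega> i ^ m \<partial>planted P n N) = (\<integral>p. fst p ^ m \<partial>P)"
proof -
  let ?z = "\<lambda>_ :: nat. 0 :: nat" and ?d = "\<lambda>_ :: nat. Bullet" and ?g = "\<lambda>_ :: nat. i"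
  have deg: "card {k \<in> ({} :: nat set). ?z k = j} + card {k \<in> {..<m}. ?g k = j} \<le> 4" for j
    using m by (cases "i = j") auto
  have rng: "?z ` {} \<subseteq> {..<n}" "?z ` {} \<subseteq> {..<N}" "?g ` {..<m} \<subseteq> {..<n}" using i by auto
  note ob = obs_expectation[OF pr finite.emptyI finite_lessThan rng deg, where dd = ?d and lam = 1 and mu = 1]
  interpret prob_space P by (rule priorD(1)[OF pr])
  show "integrable (planted P n N) (\<lambda>\<omega>. spike_x \<omega> i ^ m)" using ob(1) by simp
  have "(\<integral>\<omega>. spike_x \<omega> i ^ m \<partial>planted P n N) = obs_term 1 1 n N P ?d ?z ?z ?g {} {..<m} {}"
    using ob(2) by simp
  also have "\<dots> = (\<Prod>j<n. \<integral>p. fst p ^ card {k \<in> {..<m}. ?g k = j} \<partial>P)"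
    by (simp add: obs_term_def)
  also have "\<dots> = (\<Prod>j<n. if i = j then (\<integral>p. fst p ^ m \<partial>P) else 1)"
    by (intro prod.cong) (auto simp: prob_space)
  also have "\<dots> = (\<integral>p. fst p ^ m \<partial>P)" using i by simp
  finally show "(\<integral>\<omega>. spike_x \<omega> i ^ m \<partial>planted P n N) = (\<integral>p. fst p ^ m \<partial>P)" .
qed

lemma prob_space_planted:
  assumes "prob_space P"
  shows "prob_space (planted P n N)"
proof -
  show ?thesis unfolding planted_def
    by (intro prob_space_pair prob_space_PiM prob_space_std_normal assms)
qed

text \<open>Replaces a quotient by an expression whose expectation is a combination of moments. With
  \<open>y = \<bar>S\<bar> / (B * p)\<close>, which is at most the overlap and, by Cauchy-Schwarz,
  at most 1, it reduces to \<open>2 * y * (s * t) <= y^2 + (s * t)^2\<close> and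
  \<open>y^2 <= y\<close>. The factor \<open>b w\<close> enters because the statistic correlates
  only with products of two spike entries.\<close>

lemma overlap_pointwise:
  assumes B: "B > 0" "L2_set a {..<n} \<le> B" and s: "s \<ge> 0" and w: "w < n"
  shows "2 * s * (b w * (\<Sum>i<n. a i * b i)) / B - s\<^sup>2 * ((b w)\<^sup>2 * (\<Sum>i<n. (b i)\<^sup>2)) \<le> overlap n a b"
    and "0 \<le> overlap n a b" "overlap n a b \<le> 1"
proof -
  define S where "S = (\<Sum>i<n. a i * b i)"
  define p where "p = L2_set b {..<n}"
  define q where "q = L2_set a {..<n}"
  have pq: "p \<ge> 0" "q \<ge> 0" by (simp_all add: p_def q_def)
  have p2: "p\<^sup>2 = (\<Sum>i<n. (b i)\<^sup>2)" unfolding p_def L2_set_def by (simp add: sum_nonneg)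
  have "\<bar>S\<bar> \<le> (\<Sum>i<n. \<bar>a i\<bar> * \<bar>b i\<bar>)" unfolding S_def by (rule order_trans[OF sum_abs]) (simp add: abs_mult)
  also have "\<dots> \<le> q * p" unfolding p_def q_def by (rule L2_set_mult_ineq)
  finally have cs: "\<bar>S\<bar> \<le> q * p" .
  have ov: "overlap n a b = \<bar>S\<bar> / (q * p)" by (simp add: overlap_def S_def p_def q_def)
  show "0 \<le> overlap n a b" unfolding ov using pq by simp
  show "overlap n a b \<le> 1" unfolding ov using pq cs by (cases "q * p = 0") (auto simp: divide_le_eq_1)
  define t where "t = \<bar>b w\<bar> * p"
  have t2: "t\<^sup>2 = (b w)\<^sup>2 * (\<Sum>i<n. (b i)\<^sup>2)" by (simp add: t_def power_mult_distrib p2)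
  show "2 * s * (b w * (\<Sum>i<n. a i * b i)) / B - s\<^sup>2 * ((b w)\<^sup>2 * (\<Sum>i<n. (b i)\<^sup>2)) \<le> overlap n a b"
  proof (cases "q * p = 0")
    case True
    then have "S = 0" using cs by (simp only: abs_le_zero_iff)
    then show ?thesis unfolding ov S_def[symmetric] t2[symmetric] by simp
  next
    case False
    then have qp: "q > 0" "p > 0" using pq by auto
    define y where "y = \<bar>S\<bar> / (B * p)"
    have "q * p \<le> B * p" using B pq by (intro mult_right_mono) (auto simp: q_def)
    then have "\<bar>S\<bar> \<le> B * p" using cs by linarith
    then have y1: "y \<le> 1" using qp B by (simp add: y_def)
    have y0: "0 \<le> y" using qp B by (simp add: y_def)
    have "y \<le> overlap n a b" unfolding ov y_def
      using \<open>q * p \<le> B * p\<close> qp B by (intro divide_left_mono) auto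
    have "2 * s * (b w * S) / B \<le> 2 * s * (\<bar>b w\<bar> * \<bar>S\<bar>) / B"
      using s B by (intro divide_right_mono mult_left_mono) (auto simp: abs_mult[symmetric])
    also have "\<dots> = 2 * s * (y * t)" using qp by (simp add: y_def t_def)
    also have "\<dots> \<le> y\<^sup>2 + s\<^sup>2 * t\<^sup>2"
      using sum_squares_bound[of y "s * t"] by (simp add: power_mult_distrib mult_ac)
    also have "y\<^sup>2 \<le> y" using y0 y1 by (simp add: power2_eq_square mult_left_le)
    finally show ?thesis using \<open>y \<le> overlap n a b\<close> unfolding S_def[symmetric] t2[symmetric] by simp
  qed
qed

text \<open>The two subtracted terms come from AM-GM applied to \<open>p * z\<close> on the event \<open>\<bar>p\<bar> > R ^ 4\<close>.\<close>

lemma truncation_pointwise: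
  fixes p z R :: real
  assumes R: "R > 0"
  shows "p * z - p\<^sup>2 * z\<^sup>2 / (8 * R) - 2 * p\<^sup>2 / R ^ 7 \<le> (p * (if \<bar>p\<bar> \<le> R ^ 4 then 1 else 0)) * z"
proof (cases "\<bar>p\<bar> \<le> R ^ 4")
  case True
  have "0 \<le> p\<^sup>2 * z\<^sup>2 / (8 * R)" "0 \<le> 2 * p\<^sup>2 / R ^ 7" using R by auto
  then show ?thesis using True by simp
next
  case False
  have "(R ^ 4)\<^sup>2 \<le> \<bar>p\<bar>\<^sup>2" using False R by (intro power_mono) auto
  then have p2: "R ^ 8 \<le> p\<^sup>2" by (simp add: power_mult[symmetric])
  have "0 \<le> (p * z - 4 * R)\<^sup>2" by simp
  then have "p * z \<le> (p * z)\<^sup>2 / (8 * R) + 2 * R"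
    using R by (simp add: field_simps power2_eq_square)
  also have "2 * R = 2 * R ^ 8 / R ^ 7" using R by (simp add: field_simps power_eq_if)
  also have "\<dots> \<le> 2 * p\<^sup>2 / R ^ 7" using p2 R by (intro divide_right_mono) auto
  finally show ?thesis using False by (simp add: power_mult_distrib)
qed

section \<open>Second and first moment of the statistic\<close>

context
  fixes gam rho lam mu C \<delta> K :: real
  assumes gam: "gam > 0" and rho01: "0 < rho" "rho < 1" and lm: "lam > 0" "mu > 0"
    and lamg: "lam\<^sup>2 \<le> gam" and \<delta>: "0 < \<delta>" and A: "A_plus lam mu rho > (1 + \<delta>) * gam"
begin

lemma A_gt: "gam < A_plus lam mu rho"
proof -
  have "gam \<le> (1 + \<delta>) * gam" using gam \<delta> by (simp add: algebra_simps)
  then show ?thesis using A by linarith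
qed

lemma A_pos: "A_plus lam mu rho > 0"
  using A_gt gam by linarith

lemma weight_nonneg: "weight lam mu rho w \<ge> 0"
  unfolding weight_def using dval_pos[OF lm] rho01
  by (intro mult_nonneg_nonneg prod_nonneg) (auto intro: less_imp_le)

lemma length_pos:
  assumes "n \<ge> 2" "(1 + \<delta>) ^ l \<ge> (real n)\<^sup>2"
  shows "l > 0"
proof (rule ccontr)
  assume "\<not> l > 0"
  then have "(real n)\<^sup>2 \<le> 1" using assms(2) by simp
  moreover have "2\<^sup>2 \<le> (real n)\<^sup>2" using assms(1) by (intro power_mono) auto
  ultimately show False by simp
qed

lemma beta_pos:
  assumes "l > 0"
  shows "beta lam mu rho l > 0"
proof -
  obtain c where c: "c > 0" "\<forall>l>0. c * A_plus lam mu rho ^ l \<le> word_sum lam mu rho l"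
    using word_sum_lower[OF rho01 lm] A_gt lamg by (meson le_less_trans)
  have "0 < c * A_plus lam mu rho ^ l" using c A_pos by simp
  then show ?thesis using c(2) assms beta_bounds(2)[OF assms, of lam mu rho] lm
    by (smt (verit, best))
qed

text \<open>After the row bound, each S contributes its squared weight. The count of paths then
  cancels all powers of \<open>n\<close> and \<open>N\<close>, and
  \<open>word_sum * R0 * A ^ l / beta^2\<close> remains, where both \<open>word_sum\<close> and
  \<open>A ^ l\<close> are of the order of \<open>beta\<close> at most.\<close>

lemma Psi_second_moment:
  "\<exists>R>0. \<forall>n N l P u v e. real n / real N = gam \<longrightarrow> real l \<le> K * ln (real n) \<longrightarrow> (1 + \<delta>) ^ l \<ge> (real n)\<^sup>2 \<longrightarrow>
     prior rho C P \<longrightarrow> u < n \<longrightarrow> v < n \<longrightarrow> u \<noteq> v \<longrightarrow> e = 0 \<or> e = 2 \<longrightarrow>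
     integrable (planted P n N) (\<lambda>\<omega>. (Psi_obs lam mu rho l n N \<omega> u v)\<^sup>2 * (spike_x \<omega> u ^ e * spike_x \<omega> v ^ e)) \<and>
     (\<integral>\<omega>. (Psi_obs lam mu rho l n N \<omega> u v)\<^sup>2 * (spike_x \<omega> u ^ e * spike_x \<omega> v ^ e) \<partial>planted P n N) \<le> R"
proof -
  define A where "A = A_plus lam mu rho"
  have A0: "A > 0" using A_pos by (simp add: A_def)
  define Cq where "Cq = (1 + 2 * \<bar>C\<bar>) / rho"
  note CqC = Cq_def
  have Cq1: "Cq \<ge> 1" using rho01 by (simp add: Cq_def field_simps)
  obtain R0 where R0: "R0 > 0" "\<And>n N l a b w d j f. real n = gam * real N \<Longrightarrow> real l \<le> K * ln (real n) \<Longrightarrow> (1 + \<delta>) ^ l \<ge> (real n)\<^sup>2 \<Longrightarrow>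
     ref_path n N l a b (dval lam mu) rho Cq 9 \<Longrightarrow>
     ref_path.walk_sum n N l a b w (dval lam mu) rho Cq 9 l (d, j, a 0, f, True) \<le> R0 * A ^ l / real n"
    using walk_sum_bound[OF gam rho01 lm lamg \<delta> A Cq1, of K] unfolding A_def by blast
  obtain c where c: "c > 0" "\<And>l. l > 0 \<Longrightarrow> c * A ^ l \<le> word_sum lam mu rho l"
    using word_sum_lower[OF rho01 lm] A_gt lamg unfolding A_def by (meson le_less_trans)
  \<comment> \<open>The 16 is 4 from \<open>word_sum <= 4 * beta\<close> times 4 from
    \<open>c * A ^ l <= word_sum <= 4 * beta\<close>.\<close>
  define R where "R = 16 * R0 / c"
  have R: "R > 0" using R0 c by (simp add: R_def)
  show ?thesis
  proof (intro exI[of _ R] conjI R allI impI)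
    fix n N l P u v e
    assume gN: "real n / real N = gam" and lK: "real l \<le> K * ln (real n)" and l2: "(1 + \<delta>) ^ l \<ge> (real n)\<^sup>2"
      and pr: "prior rho C P" and uv: "u < n" "v < n" "u \<noteq> v" and e: "e = 0 \<or> e = (2::nat)"
    have N0: "N > 0" using gN gam by (cases N) auto
    have nN: "real n = gam * real N" using gN N0 by (simp add: field_simps)
    have n0: "n > 0" using uv by simp
    have l0: "l > 0" by (rule length_pos[OF _ l2]) (use uv in auto)
    define W where "W xs = weight lam mu rho (map fst xs)" for xs :: "pstep list"
    define pm where "pm xs \<omega> = obs_path lam mu n u xs \<omega>" for xs \<omega>
    define g where "g \<omega> = spike_x \<omega> u ^ e * spike_x \<omega> v ^ e" for \<omega>
    define c0 where "c0 = 1 / (real N ^ l * inverse (real n) * beta lam mu rho l)"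
    define S where "S = paths n N l u v"
    let ?M = "planted P n N"
    have beta: "beta lam mu rho l > 0" by (rule beta_pos[OF l0])
    have W: "W xs \<ge> 0" for xs unfolding W_def by (rule weight_nonneg)
    have Psi: "Psi_obs lam mu rho l n N \<omega> u v = c0 * (\<Sum>xs\<in>S. W xs * pm xs \<omega>)" for \<omega>
      unfolding c0_def S_def W_def pm_def by (rule Psi_sum[OF l0 uv]) (use lm in auto)
    have sq: "(Psi_obs lam mu rho l n N \<omega> u v)\<^sup>2 * g \<omega> =
      (\<Sum>xs\<in>S. \<Sum>ys\<in>S. c0\<^sup>2 * W xs * W ys * (pm xs \<omega> * pm ys \<omega> * g \<omega>))" for \<omega>
      unfolding Psi power_mult_distrib power2_eq_square[of "sum _ _"] sum_product
      by (simp add: sum_distrib_left sum_distrib_right mult_ac)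
    have pp: "path_pair n N l u v xs ys lam mu rho C P e" if "xs \<in> S" "ys \<in> S" for xs ys
      by unfold_locales (use n0 N0 l0 uv that lm rho01 pr e in \<open>auto simp: S_def\<close>)
    have int: "integrable ?M (\<lambda>\<omega>. pm xs \<omega> * pm ys \<omega> * g \<omega>)" if "xs \<in> S" "ys \<in> S" for xs ys
    proof -
      interpret path_pair n N l u v xs ys lam mu rho C P e by (rule pp[OF that])
      show ?thesis unfolding pm_def g_def by (rule pair_expectation(1))
    qed
    show "integrable ?M (\<lambda>\<omega>. (Psi_obs lam mu rho l n N \<omega> u v)\<^sup>2 * (spike_x \<omega> u ^ e * spike_x \<omega> v ^ e))"
      unfolding g_def[symmetric] sq by (intro Bochner_Integration.integrable_sum integrable_mult_right int)
    have row: "(\<Sum>ys\<in>S. W ys * \<bar>\<integral>\<omega>. pm xs \<omega> * pm ys \<omega> * g \<omega> \<partial>?M\<bar>) \<le> W xs / real n ^ l * real N ^ l * (R0 * A ^ l / real n)"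
      if xs: "xs \<in> S" for xs
    proof -
      interpret path_pair n N l u v xs xs lam mu rho C P e by (rule pp[OF xs xs])
      have Cq: "path_pair.Cq rho C = Cq" using Cq_def Cm_def CqC by simp
      have "(\<Sum>ys\<in>S. W ys * \<bar>\<integral>\<omega>. pm xs \<omega> * pm ys \<omega> * g \<omega> \<partial>?M\<bar>) \<le> W xs / real n ^ l * real N ^ l *
        ref_path.walk_sum n N l (av u xs) (bv xs) (wv xs) (dval lam mu) rho (path_pair.Cq rho C) 9 l (Bullet, N, u, True, True)"
        unfolding W_def pm_def g_def S_def
        by (rule row_bound[OF n0 N0 l0 uv _ lm rho01 pr e]) (use xs S_def in auto)
      also have "\<dots> \<le> W xs / real n ^ l * real N ^ l * (R0 * A ^ l / real n)"
      proof (rule mult_left_mono)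
        show "ref_path.walk_sum n N l (av u xs) (bv xs) (wv xs) (dval lam mu) rho (path_pair.Cq rho C) 9 l (Bullet, N, u, True, True) \<le> R0 * A ^ l / real n"
          using R0(2)[OF nN lK l2, of "av u xs" "bv xs" "wv xs" Bullet N True] ref_path_axioms unfolding Cq by simp
      qed (use W in simp)
      finally show ?thesis .
    qed
    have "(\<integral>\<omega>. (Psi_obs lam mu rho l n N \<omega> u v)\<^sup>2 * g \<omega> \<partial>?M) =
      (\<Sum>xs\<in>S. \<Sum>ys\<in>S. c0\<^sup>2 * W xs * W ys * (\<integral>\<omega>. pm xs \<omega> * pm ys \<omega> * g \<omega> \<partial>?M))"
      unfolding sq by (simp add: Bochner_Integration.integral_sum int Bochner_Integration.integrable_sum)
    also have "\<dots> \<le> (\<Sum>xs\<in>S. \<Sum>ys\<in>S. c0\<^sup>2 * W xs * W ys * \<bar>\<integral>\<omega>. pm xs \<omega> * pm ys \<omega> * g \<omega> \<partial>?M\<bar>)"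
      by (intro sum_mono mult_left_mono) (use W in auto)
    also have "\<dots> = c0\<^sup>2 * (\<Sum>xs\<in>S. W xs * (\<Sum>ys\<in>S. W ys * \<bar>\<integral>\<omega>. pm xs \<omega> * pm ys \<omega> * g \<omega> \<partial>?M\<bar>))"
      by (simp add: sum_distrib_left mult_ac)
    also have "\<dots> \<le> c0\<^sup>2 * (\<Sum>xs\<in>S. W xs * (W xs / real n ^ l * real N ^ l * (R0 * A ^ l / real n)))"
      by (intro mult_left_mono sum_mono row W) auto
    also have "\<dots> = c0\<^sup>2 * (((\<Sum>xs\<in>S. (W xs)\<^sup>2) * real n) * (real N ^ l * R0 * A ^ l / (real n ^ l * (real n)\<^sup>2)))"
      using n0 by (simp add: sum_distrib_left sum_distrib_right power2_eq_square field_simps)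
    also have "\<dots> \<le> c0\<^sup>2 * ((word_sum lam mu rho l * (real N ^ l * real n ^ l)) * (real N ^ l * R0 * A ^ l / (real n ^ l * (real n)\<^sup>2)))"
      unfolding S_def W_def
      by (intro mult_left_mono mult_right_mono sum_weight_paths_upper uv l0) (use R0 A0 in auto)
    also have "\<dots> = word_sum lam mu rho l * R0 * A ^ l / (beta lam mu rho l)\<^sup>2"
      using n0 N0 beta by (simp add: c0_def field_simps power2_eq_square)
    also have "\<dots> \<le> (4 * beta lam mu rho l) * R0 * (4 * beta lam mu rho l / c) / (beta lam mu rho l)\<^sup>2"
    proof (intro divide_right_mono mult_mono)
      show b: "word_sum lam mu rho l \<le> 4 * beta lam mu rho l" by (rule beta_bounds(2)[OF l0]) (use lm in auto)
      have "c * A ^ l \<le> 4 * beta lam mu rho l" using c(2)[OF l0] b by linarith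
      then show "A ^ l \<le> 4 * beta lam mu rho l / c" using c(1) by (simp add: field_simps)
    qed (use R0 A0 beta in auto)
    also have "\<dots> = R" using beta c by (simp add: R_def field_simps power2_eq_square)
    finally show "(\<integral>\<omega>. (Psi_obs lam mu rho l n N \<omega> u v)\<^sup>2 * (spike_x \<omega> u ^ e * spike_x \<omega> v ^ e) \<partial>?M) \<le> R"
      unfolding g_def .
  qed
qed

text \<open>Each path correlates with the spike by its own weight over \<open>n ^ l\<close>, so
  squared weights are summed, and the normalisation of \<open>Psi\<close> cancels this up to
  \<open>word_sum / (2 * beta)\<close>, which is at least 1/2.\<close>

lemma Psi_first_moment:
  assumes gN: "real n / real N = gam" and l2: "(1 + \<delta>) ^ l \<ge> (real n)\<^sup>2"
    and pr: "prior rho C P" and uv: "u < n" "v < n" "u \<noteq> v"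
    and small: "4 * (real l)\<^sup>2 \<le> real n" "4 * (real l)\<^sup>2 \<le> real N"
  shows "(\<lambda>\<omega>. Psi_obs lam mu rho l n N \<omega> u v) \<in> borel_measurable (planted P n N)"
    and "integrable (planted P n N) (\<lambda>\<omega>. Psi_obs lam mu rho l n N \<omega> u v * (spike_x \<omega> u * spike_x \<omega> v))"
    and "1 / 2 \<le> (\<integral>\<omega>. Psi_obs lam mu rho l n N \<omega> u v * (spike_x \<omega> u * spike_x \<omega> v) \<partial>planted P n N)"
proof -
  have N0: "N > 0" using gN gam by (cases N) auto
  have n0: "n > 0" using uv by simp
  have l0: "l > 0" by (rule length_pos[OF _ l2]) (use uv in auto)
  define W where "W xs = weight lam mu rho (map fst xs)" for xs :: "pstep list"
  define pm where "pm xs \<omega> = obs_path lam mu n u xs \<omega>" for xs \<omega>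
  define c0 where "c0 = 1 / (real N ^ l * inverse (real n) * beta lam mu rho l)"
  define S where "S = paths n N l u v"
  let ?M = "planted P n N"
  have beta: "beta lam mu rho l > 0" by (rule beta_pos[OF l0])
  have Psi: "Psi_obs lam mu rho l n N \<omega> u v = c0 * (\<Sum>xs\<in>S. W xs * pm xs \<omega>)" for \<omega>
    unfolding c0_def S_def W_def pm_def by (rule Psi_sum[OF l0 uv]) (use lm in auto)
  have single: "integrable ?M (pm xs)" "integrable ?M (\<lambda>\<omega>. pm xs \<omega> * (spike_x \<omega> u * spike_x \<omega> v))"
    "(\<integral>\<omega>. pm xs \<omega> * (spike_x \<omega> u * spike_x \<omega> v) \<partial>?M) = W xs / real n ^ l" if "xs \<in> S" for xs
  proof -
    interpret path_pair n N l u v xs xs lam mu rho C P 0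
      by unfold_locales (use n0 N0 l0 uv that lm rho01 pr in \<open>auto simp: S_def\<close>)
    show "integrable ?M (pm xs)" using single_expectation(1)[of 0] by (simp add: pm_def[abs_def])
    show "integrable ?M (\<lambda>\<omega>. pm xs \<omega> * (spike_x \<omega> u * spike_x \<omega> v))"
      using single_expectation(1)[of 1] by (simp add: pm_def)
    show "(\<integral>\<omega>. pm xs \<omega> * (spike_x \<omega> u * spike_x \<omega> v) \<partial>?M) = W xs / real n ^ l"
      using single_expectation(2)[of 1] by (simp add: pm_def W_def)
  qed
  show "(\<lambda>\<omega>. Psi_obs lam mu rho l n N \<omega> u v) \<in> borel_measurable ?M"
    unfolding Psi
    by (intro borel_measurable_times borel_measurable_const borel_measurable_sum) (use single(1) in auto)
  have eq: "Psi_obs lam mu rho l n N \<omega> u v * (spike_x \<omega> u * spike_x \<omega> v) =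
    (\<Sum>xs\<in>S. c0 * W xs * (pm xs \<omega> * (spike_x \<omega> u * spike_x \<omega> v)))" for \<omega>
    unfolding Psi by (simp add: sum_distrib_left sum_distrib_right mult_ac)
  show "integrable ?M (\<lambda>\<omega>. Psi_obs lam mu rho l n N \<omega> u v * (spike_x \<omega> u * spike_x \<omega> v))"
    unfolding eq by (intro Bochner_Integration.integrable_sum integrable_mult_right single(2))
  have "(\<integral>\<omega>. Psi_obs lam mu rho l n N \<omega> u v * (spike_x \<omega> u * spike_x \<omega> v) \<partial>?M) =
    (\<Sum>xs\<in>S. c0 * W xs * (W xs / real n ^ l))"
    unfolding eq by (simp add: Bochner_Integration.integral_sum single)
  also have "\<dots> = ((\<Sum>xs\<in>S. (W xs)\<^sup>2) * real n) / (real N ^ l * real n ^ l * beta lam mu rho l)"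
    using n0 by (simp add: c0_def sum_distrib_left sum_distrib_right sum_divide_distrib power2_eq_square field_simps)
  also have "\<dots> \<ge> (word_sum lam mu rho l * (real N ^ l * real n ^ l) / 2) / (real N ^ l * real n ^ l * beta lam mu rho l)"
    using sum_weight_paths_lower[OF uv l0 small, of lam mu rho] beta
    unfolding S_def W_def by (intro divide_right_mono) auto
  also have "(word_sum lam mu rho l * (real N ^ l * real n ^ l) / 2) / (real N ^ l * real n ^ l * beta lam mu rho l) =
    word_sum lam mu rho l / beta lam mu rho l / 2" using n0 N0 by (simp add: field_simps)
  finally have 1: "word_sum lam mu rho l / beta lam mu rho l / 2 \<le>
    (\<integral>\<omega>. Psi_obs lam mu rho l n N \<omega> u v * (spike_x \<omega> u * spike_x \<omega> v) \<partial>?M)" .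
  have "beta lam mu rho l \<le> word_sum lam mu rho l" by (rule beta_bounds(1)[OF l0]) (use lm in auto)
  then have "1 / 2 \<le> word_sum lam mu rho l / beta lam mu rho l / 2" using beta by simp
  then show "1 / 2 \<le> (\<integral>\<omega>. Psi_obs lam mu rho l n N \<omega> u v * (spike_x \<omega> u * spike_x \<omega> v) \<partial>?M)"
    using 1 by linarith
qed

end

section \<open>Nondegenerate parameters and the expected overlap\<close>

text \<open>If one signal vanished, \<open>A_plus\<close> would be the square of the other, which is
  at most \<open>gam\<close>. So \<open>A_plus > gam\<close> forces both to be positive, as dividing
  by amplitudes requires.\<close>

lemma A_plus_zero: "A_plus 0 mu rho = mu\<^sup>2" "A_plus lam 0 rho = lam\<^sup>2"
proof -
  have s: "sqrt (x ^ 4) = x\<^sup>2" for x :: real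
  proof -
    have "x ^ 4 = (x\<^sup>2)\<^sup>2" by simp
    then show ?thesis by (simp only: real_sqrt_abs) simp
  qed
  show "A_plus 0 mu rho = mu\<^sup>2" "A_plus lam 0 rho = lam\<^sup>2" by (simp_all add: A_plus_def s)
qed

text \<open>Argued through fourth moments rather than independence, so that \<open>u = w\<close> is
  covered: the squared norm of the spike contains that term too.\<close>

lemma spike_moments:
  assumes pr: "prior rho C P" and uw: "u < n" "w < n"
  shows "(\<lambda>\<omega>. spike_x \<omega> u) \<in> borel_measurable (planted P n N)"
    and "integrable (planted P n N) (\<lambda>\<omega>. spike_x \<omega> u * spike_x \<omega> w)"
    and "integrable (planted P n N) (\<lambda>\<omega>. (spike_x \<omega> w)\<^sup>2 * (spike_x \<omega> u)\<^sup>2)"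
    and "(\<integral>\<omega>. (spike_x \<omega> w)\<^sup>2 * (spike_x \<omega> u)\<^sup>2 \<partial>planted P n N) \<le> C"
proof -
  interpret prob_space "planted P n N" by (rule prob_space_planted[OF priorD(1)[OF pr]])
  have m: "(\<lambda>\<omega>. spike_x \<omega> i) \<in> borel_measurable (planted P n N)" if "i < n" for i
    using borel_measurable_integrable[OF spike_power(1)[OF pr that, of 1]] by simp
  note [measurable] = m[OF uw(1)] m[OF uw(2)]
  show "(\<lambda>\<omega>. spike_x \<omega> u) \<in> borel_measurable (planted P n N)" by measurable
  note i4 = spike_power[OF pr uw(1), of 4, simplified] spike_power[OF pr uw(2), of 4, simplified]
  have am: "a * b \<le> (a\<^sup>2 + b\<^sup>2) / 2" for a b :: real
    using sum_squares_bound[of a b] by simp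
  have pw: "(x\<^sup>2)\<^sup>2 = x ^ 4" for x :: real by simp
  have bd: "(spike_x \<omega> w)\<^sup>2 * (spike_x \<omega> u)\<^sup>2 \<le> (spike_x \<omega> w ^ 4 + spike_x \<omega> u ^ 4) / 2" for \<omega>
    using am[of "(spike_x \<omega> w)\<^sup>2" "(spike_x \<omega> u)\<^sup>2"] unfolding pw .
  have i: "integrable (planted P n N) (\<lambda>\<omega>. (spike_x \<omega> w ^ 4 + spike_x \<omega> u ^ 4) / 2)"
    using i4 by auto
  show i2: "integrable (planted P n N) (\<lambda>\<omega>. (spike_x \<omega> w)\<^sup>2 * (spike_x \<omega> u)\<^sup>2)"
  proof (rule Bochner_Integration.integrable_bound[OF i], measurable, rule AE_I2)
    fix \<omega>
    show "norm ((spike_x \<omega> w)\<^sup>2 * (spike_x \<omega> u)\<^sup>2) \<le> norm ((spike_x \<omega> w ^ 4 + spike_x \<omega> u ^ 4) / 2)"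
      using bd[of \<omega>] by simp
  qed
  have "(\<integral>\<omega>. (spike_x \<omega> w)\<^sup>2 * (spike_x \<omega> u)\<^sup>2 \<partial>planted P n N) \<le> (\<integral>\<omega>. (spike_x \<omega> w ^ 4 + spike_x \<omega> u ^ 4) / 2 \<partial>planted P n N)"
    by (rule integral_mono[OF i2 i bd])
  also have "\<dots> = (\<integral>p. fst p ^ 4 \<partial>P)" using i4 by simp
  finally show "(\<integral>\<omega>. (spike_x \<omega> w)\<^sup>2 * (spike_x \<omega> u)\<^sup>2 \<partial>planted P n N) \<le> C"
    using priorD(9)[OF pr] by linarith
  have i1: "integrable (planted P n N) (\<lambda>\<omega>. 1 + (spike_x \<omega> w)\<^sup>2 * (spike_x \<omega> u)\<^sup>2)" using i2 by auto
  show "integrable (planted P n N) (\<lambda>\<omega>. spike_x \<omega> u * spike_x \<omega> w)"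
  proof (rule Bochner_Integration.integrable_bound[OF i1], measurable, rule AE_I2)
    fix \<omega>
    have "\<bar>spike_x \<omega> u * spike_x \<omega> w\<bar> \<le> (1 + (spike_x \<omega> u * spike_x \<omega> w)\<^sup>2) / 2"
      using am[of 1 "\<bar>spike_x \<omega> u * spike_x \<omega> w\<bar>"] by simp
    also have "\<dots> \<le> 1 + (spike_x \<omega> w)\<^sup>2 * (spike_x \<omega> u)\<^sup>2" by (simp add: power_mult_distrib mult.commute)
    finally show "norm (spike_x \<omega> u * spike_x \<omega> w) \<le> norm (1 + (spike_x \<omega> w)\<^sup>2 * (spike_x \<omega> u)\<^sup>2)" by simp
  qed
qed

text \<open>Everything is reduced to moments of \<open>\<Psi>\<close> for single pairs: truncation
  keeps a correlation of 1/4 per vertex, and summing over \<open>u\<close> gives order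
  \<open>n\<close>, matched by the order \<open>n\<close> of the product of the two norms after
  scaling with \<open>s\<close>.\<close>

lemma overlap_expectation:
  fixes \<Psi> :: "sample \<Rightarrow> nat \<Rightarrow> real" and R C :: real
  assumes pr: "prior rho C P" and n: "n \<ge> 2" and w: "w < n" and R: "R \<ge> 2"
    and self: "\<And>\<omega>. \<Psi> \<omega> w = 0"
    and meas: "\<And>u. u < n \<Longrightarrow> u \<noteq> w \<Longrightarrow> (\<lambda>\<omega>. \<Psi> \<omega> u) \<in> borel_measurable (planted P n N)"
    and int: "\<And>u. u < n \<Longrightarrow> u \<noteq> w \<Longrightarrow> integrable (planted P n N) (\<lambda>\<omega>. \<Psi> \<omega> u * (spike_x \<omega> w * spike_x \<omega> u))"
    and first: "\<And>u. u < n \<Longrightarrow> u \<noteq> w \<Longrightarrow> 1 / 2 \<le> (\<integral>\<omega>. \<Psi> \<omega> u * (spike_x \<omega> w * spike_x \<omega> u) \<partial>planted P n N)"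
    and int2: "\<And>u. u < n \<Longrightarrow> u \<noteq> w \<Longrightarrow> integrable (planted P n N) (\<lambda>\<omega>. (\<Psi> \<omega> u)\<^sup>2)"
    and second: "\<And>u. u < n \<Longrightarrow> u \<noteq> w \<Longrightarrow> (\<integral>\<omega>. (\<Psi> \<omega> u)\<^sup>2 \<partial>planted P n N) \<le> R"
    and int3: "\<And>u. u < n \<Longrightarrow> u \<noteq> w \<Longrightarrow> integrable (planted P n N) (\<lambda>\<omega>. (\<Psi> \<omega> u)\<^sup>2 * ((spike_x \<omega> w)\<^sup>2 * (spike_x \<omega> u)\<^sup>2))"
    and third: "\<And>u. u < n \<Longrightarrow> u \<noteq> w \<Longrightarrow> (\<integral>\<omega>. (\<Psi> \<omega> u)\<^sup>2 * ((spike_x \<omega> w)\<^sup>2 * (spike_x \<omega> u)\<^sup>2) \<partial>planted P n N) \<le> R"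
  shows "1 / (64 * R ^ 8 * max 1 C) \<le>
    (\<integral>\<omega>. overlap n (\<lambda>u. \<Psi> \<omega> u * (if \<bar>\<Psi> \<omega> u\<bar> \<le> R ^ 4 then 1 else 0)) (spike_x \<omega>) \<partial>planted P n N)"
proof -
  let ?M = "planted P n N"
  interpret prob_space ?M by (rule prob_space_planted[OF priorD(1)[OF pr]])
  define X where "X \<omega> u = spike_x \<omega> u" for \<omega> u
  define xh where "xh \<omega> u = \<Psi> \<omega> u * (if \<bar>\<Psi> \<omega> u\<bar> \<le> R ^ 4 then 1 else 0)" for \<omega> u
  have R0: "R > 0" using R by simp
  have X_meas [measurable]: "(\<lambda>\<omega>. X \<omega> u) \<in> borel_measurable ?M" if "u < n" for u
    unfolding X_def by (rule spike_moments(1)[OF pr that that])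
  have Psi_meas [measurable]: "(\<lambda>\<omega>. \<Psi> \<omega> u) \<in> borel_measurable ?M" if "u < n" for u
    using meas[OF that] self by (cases "u = w") auto
  have xh_meas [measurable]: "(\<lambda>\<omega>. xh \<omega> u) \<in> borel_measurable ?M" if "u < n" for u
    using that unfolding xh_def by measurable
  have xh_le: "\<bar>xh \<omega> u\<bar> \<le> R ^ 4" for \<omega> u using R0 by (simp add: xh_def)
  have XX: "integrable ?M (\<lambda>\<omega>. X \<omega> u * X \<omega> v)" if "u < n" "v < n" for u v
    unfolding X_def by (rule spike_moments(2)[OF pr that])
  have xhXX: "integrable ?M (\<lambda>\<omega>. xh \<omega> u * (X \<omega> w * X \<omega> u))" if u: "u < n" for u
  proof (rule Bochner_Integration.integrable_bound[OF integrable_mult_right[OF XX[OF w u], of "R ^ 4"]])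
    show "(\<lambda>\<omega>. xh \<omega> u * (X \<omega> w * X \<omega> u)) \<in> borel_measurable ?M" using u w by measurable
    show "AE \<omega> in ?M. norm (xh \<omega> u * (X \<omega> w * X \<omega> u)) \<le> norm (R ^ 4 * (X \<omega> w * X \<omega> u))"
    proof (rule AE_I2)
      fix \<omega>
      have "\<bar>xh \<omega> u\<bar> * \<bar>X \<omega> w * X \<omega> u\<bar> \<le> R ^ 4 * \<bar>X \<omega> w * X \<omega> u\<bar>" by (rule mult_right_mono[OF xh_le]) simp
      then show "norm (xh \<omega> u * (X \<omega> w * X \<omega> u)) \<le> norm (R ^ 4 * (X \<omega> w * X \<omega> u))"
        using R0 by (simp add: abs_mult)
    qed
  qed
  have quarter: "1 / 4 \<le> (\<integral>\<omega>. xh \<omega> u * (X \<omega> w * X \<omega> u) \<partial>?M)" if u: "u < n" "u \<noteq> w" for u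
  proof -
    \<comment> \<open>Each of the two subtracted terms has expectation at most 1/8, the first by the
      bound \<open>R\<close> on the weighted moment, the second since \<open>R >= 2\<close>. Of the
      correlation 1/2 there remains 1/4.\<close>
    let ?low = "\<lambda>\<omega>. \<Psi> \<omega> u * (X \<omega> w * X \<omega> u) - (\<Psi> \<omega> u)\<^sup>2 * (X \<omega> w * X \<omega> u)\<^sup>2 / (8 * R) - 2 * (\<Psi> \<omega> u)\<^sup>2 / R ^ 7"
    have sq: "(X \<omega> w * X \<omega> u)\<^sup>2 = (X \<omega> w)\<^sup>2 * (X \<omega> u)\<^sup>2" for \<omega> by (rule power_mult_distrib)
    have i: "integrable ?M (\<lambda>\<omega>. \<Psi> \<omega> u * (X \<omega> w * X \<omega> u))" "integrable ?M (\<lambda>\<omega>. (\<Psi> \<omega> u)\<^sup>2 * (X \<omega> w * X \<omega> u)\<^sup>2 / (8 * R))"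
      "integrable ?M (\<lambda>\<omega>. 2 * (\<Psi> \<omega> u)\<^sup>2 / R ^ 7)"
      using int[OF u] int2[OF u] int3[OF u] unfolding sq unfolding X_def by auto
    have "(\<integral>\<omega>. ?low \<omega> \<partial>?M) = (\<integral>\<omega>. \<Psi> \<omega> u * (X \<omega> w * X \<omega> u) \<partial>?M) -
        (\<integral>\<omega>. (\<Psi> \<omega> u)\<^sup>2 * (X \<omega> w * X \<omega> u)\<^sup>2 \<partial>?M) / (8 * R) - 2 * (\<integral>\<omega>. (\<Psi> \<omega> u)\<^sup>2 \<partial>?M) / R ^ 7"
      using i by simp
    moreover have "(\<integral>\<omega>. (\<Psi> \<omega> u)\<^sup>2 * (X \<omega> w * X \<omega> u)\<^sup>2 \<partial>?M) / (8 * R) \<le> R / (8 * R)"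
      using third[OF u] R0 unfolding sq unfolding X_def by (intro divide_right_mono) auto
    moreover have "2 * (\<integral>\<omega>. (\<Psi> \<omega> u)\<^sup>2 \<partial>?M) / R ^ 7 \<le> 2 * R / R ^ 7"
      using second[OF u] R0 by (intro divide_right_mono mult_left_mono) auto
    moreover have "2 * R / R ^ 7 \<le> 1 / 8"
    proof -
      have "2 ^ 6 \<le> R ^ 6" using R by (intro power_mono) auto
      moreover have "2 * R / R ^ 7 = 2 / R ^ 6" using R0 by (simp add: field_simps power_eq_if)
      moreover have "2 / R ^ 6 \<le> 2 / 2 ^ 6" using calculation(1) by (intro divide_left_mono) auto
      ultimately show ?thesis by simp
    qed
    moreover have "R / (8 * R) = 1 / 8" using R0 by simp
    ultimately have "1 / 4 \<le> (\<integral>\<omega>. ?low \<omega> \<partial>?M)" using first[OF u] unfolding X_def by linarith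
    also have "\<dots> \<le> (\<integral>\<omega>. xh \<omega> u * (X \<omega> w * X \<omega> u) \<partial>?M)"
    proof (rule integral_mono)
      show "integrable ?M ?low" using i by auto
      show "integrable ?M (\<lambda>\<omega>. xh \<omega> u * (X \<omega> w * X \<omega> u))" by (rule xhXX[OF u(1)])
      show "?low \<omega> \<le> xh \<omega> u * (X \<omega> w * X \<omega> u)" for \<omega>
        unfolding xh_def by (rule truncation_pointwise[OF R0])
    qed
    finally show ?thesis .
  qed
  define B where "B = R ^ 4 * sqrt (real n)"
  have B: "B > 0" using R0 n by (simp add: B_def)
  have L2: "L2_set (xh \<omega>) {..<n} \<le> B" for \<omega>
  proof -
    have "L2_set (xh \<omega>) {..<n} \<le> L2_set (\<lambda>_. R ^ 4) {..<n}"
    proof -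
      have "(\<Sum>i<n. (xh \<omega> i)\<^sup>2) \<le> (\<Sum>i<n. (R ^ 4)\<^sup>2)"
        by (intro sum_mono) (metis xh_le abs_ge_zero power2_abs power_mono)
      then show ?thesis unfolding L2_set_def by (rule real_sqrt_le_mono)
    qed
    also have "\<dots> = sqrt (real n * (R ^ 4)\<^sup>2)" by (simp only: L2_set_def sum_constant card_lessThan)
    also have "\<dots> = B" unfolding real_sqrt_mult real_sqrt_abs using R0 by (simp add: B_def)
    finally show ?thesis .
  qed
  define C1 where "C1 = max 1 C"
  have C1: "C1 \<ge> 1" "C \<le> C1" by (auto simp: C1_def)
  \<comment> \<open>The maximiser of \<open>2 * s0 / (8 * R ^ 4) - s0^2 * C1\<close>; the maximum is
    the constant in the claim.\<close>
  define s0 where "s0 = 1 / (8 * R ^ 4 * C1)"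
  define s where "s = s0 / sqrt (real n)"
  have s0: "s0 > 0" using R0 C1 by (simp add: s0_def)
  have s: "s \<ge> 0" using s0 by (simp add: s_def)
  define D where "D \<omega> = X \<omega> w * (\<Sum>u<n. xh \<omega> u * X \<omega> u)" for \<omega>
  define Tt where "Tt \<omega> = (X \<omega> w)\<^sup>2 * (\<Sum>u<n. (X \<omega> u)\<^sup>2)" for \<omega>
  have D_eq: "D \<omega> = (\<Sum>u<n. xh \<omega> u * (X \<omega> w * X \<omega> u))" for \<omega>
    unfolding D_def sum_distrib_left by (intro sum.cong) auto
  have T_eq: "Tt \<omega> = (\<Sum>u<n. (X \<omega> w)\<^sup>2 * (X \<omega> u)\<^sup>2)" for \<omega>
    unfolding Tt_def sum_distrib_left ..
  have iD: "integrable ?M D" unfolding D_eq[abs_def] by (intro Bochner_Integration.integrable_sum xhXX) auto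
  have iT: "integrable ?M Tt" unfolding T_eq[abs_def] X_def
    by (intro Bochner_Integration.integrable_sum spike_moments(3)[OF pr _ w]) auto
  have ED: "real n / 8 \<le> (\<integral>\<omega>. D \<omega> \<partial>?M)"
  proof -
    \<comment> \<open>The vertex \<open>w\<close> itself contributes nothing, and
      \<open>n - 1 >= n / 2\<close>.\<close>
    have "real n / 8 \<le> (real n - 1) / 4" using n by simp
    also have "\<dots> = (\<Sum>u\<in>{..<n} - {w}. 1 / 4)" using w by (simp add: of_nat_diff)
    also have "\<dots> \<le> (\<Sum>u\<in>{..<n} - {w}. \<integral>\<omega>. xh \<omega> u * (X \<omega> w * X \<omega> u) \<partial>?M)"
      by (intro sum_mono quarter) auto
    also have "\<dots> = (\<Sum>u<n. \<integral>\<omega>. xh \<omega> u * (X \<omega> w * X \<omega> u) \<partial>?M)"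
    proof (rule sum.mono_neutral_left)
      have "xh \<omega> w = 0" for \<omega> by (simp only: xh_def self mult_zero_left)
      then have "(\<integral>\<omega>. xh \<omega> w * (X \<omega> w * X \<omega> w) \<partial>?M) = 0" by (simp only: mult_zero_left integral_zero)
      then show "\<forall>u\<in>{..<n} - ({..<n} - {w}). (\<integral>\<omega>. xh \<omega> u * (X \<omega> w * X \<omega> u) \<partial>?M) = 0" by blast
    qed auto
    also have "\<dots> = (\<integral>\<omega>. D \<omega> \<partial>?M)" unfolding D_eq
      by (rule Bochner_Integration.integral_sum[symmetric]) (use xhXX in auto)
    finally show ?thesis .
  qed
  have ET: "(\<integral>\<omega>. Tt \<omega> \<partial>?M) \<le> real n * C1"
  proof -
    have "(\<integral>\<omega>. Tt \<omega> \<partial>?M) = (\<Sum>u<n. \<integral>\<omega>. (X \<omega> w)\<^sup>2 * (X \<omega> u)\<^sup>2 \<partial>?M)" unfolding T_eq X_def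
      by (rule Bochner_Integration.integral_sum) (use spike_moments(3)[OF pr _ w] in auto)
    also have "\<dots> \<le> (\<Sum>u<n. C1)" unfolding X_def
      using spike_moments(4)[OF pr _ w] C1 by (intro sum_mono) (meson lessThan_iff order_trans)
    finally show ?thesis by simp
  qed
  have ov: "2 * s * D \<omega> / B - s\<^sup>2 * Tt \<omega> \<le> overlap n (xh \<omega>) (X \<omega>)" "0 \<le> overlap n (xh \<omega>) (X \<omega>)" "overlap n (xh \<omega>) (X \<omega>) \<le> 1" for \<omega>
    unfolding D_def Tt_def using overlap_pointwise[OF B L2[of \<omega>] s w, where b = "X \<omega>"] by auto
  have iov: "integrable ?M (\<lambda>\<omega>. overlap n (xh \<omega>) (X \<omega>))"
  proof (rule integrable_const_bound[of _ 1])
    show "AE \<omega> in ?M. norm (overlap n (xh \<omega>) (X \<omega>)) \<le> 1" using ov(2,3) by (intro AE_I2) auto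
    show "(\<lambda>\<omega>. overlap n (xh \<omega>) (X \<omega>)) \<in> borel_measurable ?M"
      unfolding overlap_def L2_set_def
      by (intro borel_measurable_divide borel_measurable_abs borel_measurable_sum borel_measurable_times
          borel_measurable_sqrt borel_measurable_power xh_meas X_meas) auto
  qed
  have "1 / (64 * R ^ 8 * C1) = 2 * s0 / (8 * R ^ 4) - s0\<^sup>2 * C1"
    using R0 C1 by (simp add: s0_def field_simps power2_eq_square power_eq_if)
  also have "\<dots> = 2 * s * (real n / 8) / B - s\<^sup>2 * (real n * C1)"
  proof -
    define r where "r = sqrt (real n)"
    have r: "r > 0" "real n = r * r" using n by (auto simp: r_def)
    have "s = s0 / r" "B = R ^ 4 * r" by (simp_all add: s_def B_def r_def)
    then show ?thesis unfolding r(2) using r(1) R0 by (simp add: field_simps power2_eq_square)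
  qed
  also have "\<dots> \<le> 2 * s * (\<integral>\<omega>. D \<omega> \<partial>?M) / B - s\<^sup>2 * (\<integral>\<omega>. Tt \<omega> \<partial>?M)"
    using s B by (intro diff_mono divide_right_mono mult_left_mono ED ET) auto
  also have "\<dots> = (\<integral>\<omega>. 2 * s * D \<omega> / B - s\<^sup>2 * Tt \<omega> \<partial>?M)" using iD iT by simp
  also have "\<dots> \<le> (\<integral>\<omega>. overlap n (xh \<omega>) (X \<omega>) \<partial>?M)"
    by (rule integral_mono) (use iD iT iov ov in auto)
  finally show ?thesis unfolding xh_def X_def C1_def .
qed

theorem theorem2p16:
  fixes gam rho lam mu \<epsilon> C \<delta> K :: real
  assumes "gam > 0" and "0 < rho" and "rho < 1" and "lam \<ge> 0" and "mu \<ge> 0"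
    and "lam\<^sup>2 / gam \<le> 1" and "mu\<^sup>2 / gam \<le> 1"
    and "\<epsilon> > 0" and "F_fun lam mu rho gam > 1 + \<epsilon>"
    and "0 < \<delta>" and "\<delta> < 0.1" and "A_plus lam mu rho > (1 + \<delta>) * gam"
  shows "\<exists>R>0. \<exists>c>0. \<exists>n0::nat.
    \<forall>(n::nat) (N::nat) (l::nat) (P::(real \<times> real) measure).
      real n / real N = gam \<longrightarrow> real l \<le> K * ln (real n) \<longrightarrow> (1 + \<delta>) ^ l \<ge> (real n)\<^sup>2 \<longrightarrow>
      prior rho C P \<longrightarrow>
      (let M = planted P n N;
           \<Psi> = (\<lambda>\<omega>. Psi lam mu rho l n N (obs_X lam n \<omega>) (obs_Y mu n \<omega>))
       in (\<forall>u<n. \<forall>v<n. u \<noteq> v \<longrightarrow>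
             integrable M (\<lambda>\<omega>. (\<Psi> \<omega> u v)\<^sup>2) \<and> (\<integral>\<omega>. (\<Psi> \<omega> u v)\<^sup>2 \<partial>M) \<le> R \<and>
             integrable M (\<lambda>\<omega>. (\<Psi> \<omega> u v)\<^sup>2 * (spike_x \<omega> u)\<^sup>2 * (spike_x \<omega> v)\<^sup>2) \<and>
             (\<integral>\<omega>. (\<Psi> \<omega> u v)\<^sup>2 * (spike_x \<omega> u)\<^sup>2 * (spike_x \<omega> v)\<^sup>2 \<partial>M) \<le> R) \<and>
          (n \<ge> n0 \<longrightarrow> (\<forall>w<n.
             (\<integral>\<omega>. overlap n (xhat lam mu rho l n N R (obs_X lam n \<omega>) (obs_Y mu n \<omega>) w)
                   (spike_x \<omega>) \<partial>M) \<ge> c)))"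
proof -
  have lamg: "lam\<^sup>2 \<le> gam" and mug: "mu\<^sup>2 \<le> gam" using assms by (auto simp: pos_divide_le_eq)
  have "gam < (1 + \<delta>) * gam" using assms(1,10) by (simp add: algebra_simps)
  then have gA: "gam < A_plus lam mu rho" using assms(12) by linarith
  have "lam \<noteq> 0" using gA mug A_plus_zero(1)[of mu rho] by auto
  then have lam: "lam > 0" using assms by simp
  have "mu \<noteq> 0" using gA lamg A_plus_zero(2)[of lam rho] by auto
  then have mu: "mu > 0" using assms by simp
  note params = assms(1,2,3) lam mu lamg assms(10,12)
  obtain R1 where R1: "R1 > 0" and second: "\<And>n N l P u v e. real n / real N = gam \<Longrightarrow> real l \<le> K * ln (real n) \<Longrightarrow> (1 + \<delta>) ^ l \<ge> (real n)\<^sup>2 \<Longrightarrow>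
     prior rho C P \<Longrightarrow> u < n \<Longrightarrow> v < n \<Longrightarrow> u \<noteq> v \<Longrightarrow> e = 0 \<or> e = 2 \<Longrightarrow>
     integrable (planted P n N) (\<lambda>\<omega>. (Psi_obs lam mu rho l n N \<omega> u v)\<^sup>2 * (spike_x \<omega> u ^ e * spike_x \<omega> v ^ e)) \<and>
     (\<integral>\<omega>. (Psi_obs lam mu rho l n N \<omega> u v)\<^sup>2 * (spike_x \<omega> u ^ e * spike_x \<omega> v ^ e) \<partial>planted P n N) \<le> R1"
    using Psi_second_moment[OF params, of K C] by blast
  \<comment> \<open>One constant is both the moment bound and the truncation level; truncation needs
    it to be at least 2.\<close>
  define R where "R = max 2 R1"
  have R: "R \<ge> 2" "R1 \<le> R" by (auto simp: R_def)
  obtain n1 where n1: "\<And>n N l. n \<ge> n1 \<Longrightarrow> n > 0 \<Longrightarrow> real n = gam * real N \<Longrightarrow> real l \<le> K * ln (real n) \<Longrightarrow>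
    4 * (real l)\<^sup>2 \<le> real n \<and> 4 * (real l)\<^sup>2 \<le> real N"
    using length_eventually_small[OF assms(1), of K] by blast
  define c where "c = 1 / (64 * R ^ 8 * max 1 C)"
  have R_pos: "R > 0" using R by simp
  have c: "c > 0" using R by (simp add: c_def)
  show ?thesis
  \<comment> \<open>The moment bounds hold for all \<open>n\<close>. The threshold serves the
    overlap alone: 2 provides a second vertex, and \<open>n1\<close> makes enough self-avoiding
    paths available.\<close>
  proof (rule exI[of _ R], rule conjI[OF R_pos], rule exI[of _ c], rule conjI[OF c], rule exI[of _ "max 2 n1"], intro allI impI)
    fix n N l P
    assume gN: "real n / real N = gam" and lK: "real l \<le> K * ln (real n)" and l2: "(1 + \<delta>) ^ l \<ge> (real n)\<^sup>2"
      and pr: "prior rho C P"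
    let ?M = "planted P n N"
    let ?\<Psi> = "\<lambda>\<omega>. Psi_obs lam mu rho l n N \<omega>"
    have sec: "integrable ?M (\<lambda>\<omega>. (?\<Psi> \<omega> u v)\<^sup>2)" "(\<integral>\<omega>. (?\<Psi> \<omega> u v)\<^sup>2 \<partial>?M) \<le> R"
      "integrable ?M (\<lambda>\<omega>. (?\<Psi> \<omega> u v)\<^sup>2 * ((spike_x \<omega> u)\<^sup>2 * (spike_x \<omega> v)\<^sup>2))"
      "(\<integral>\<omega>. (?\<Psi> \<omega> u v)\<^sup>2 * ((spike_x \<omega> u)\<^sup>2 * (spike_x \<omega> v)\<^sup>2) \<partial>?M) \<le> R" if "u < n" "v < n" "u \<noteq> v" for u v
      using second[OF gN lK l2 pr that, of 0] second[OF gN lK l2 pr that, of 2] R(2) by auto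
    have "(\<integral>\<omega>. overlap n (xhat lam mu rho l n N R (obs_X lam n \<omega>) (obs_Y mu n \<omega>) w) (spike_x \<omega>) \<partial>?M) \<ge> c"
      if n: "max 2 n1 \<le> n" and w: "w < n" for w
    proof -
      have "N > 0" using gN assms(1) by (cases N) auto
      then have nN: "real n = gam * real N" using gN by (simp add: field_simps)
      have small: "4 * (real l)\<^sup>2 \<le> real n" "4 * (real l)\<^sup>2 \<le> real N"
        using n1[OF _ _ nN lK] n by auto
      have xh: "xhat lam mu rho l n N R (obs_X lam n \<omega>) (obs_Y mu n \<omega>) w =
        (\<lambda>u. ?\<Psi> \<omega> w u * (if \<bar>?\<Psi> \<omega> w u\<bar> \<le> R ^ 4 then 1 else 0))" for \<omega>
        by (simp add: xhat_def Let_def fun_eq_iff)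
      show ?thesis unfolding xh c_def
      proof (rule overlap_expectation[OF pr _ w R(1)])
        show "2 \<le> n" using n by simp
        show "?\<Psi> \<omega> w w = 0" for \<omega> by (simp add: Psi_def)
        fix u assume u: "u < n" "u \<noteq> w"
        note fm = Psi_first_moment[OF params gN l2 pr w u(1) u(2)[symmetric] small]
        show "(\<lambda>\<omega>. ?\<Psi> \<omega> w u) \<in> borel_measurable ?M" by (rule fm(1))
        show "integrable ?M (\<lambda>\<omega>. ?\<Psi> \<omega> w u * (spike_x \<omega> w * spike_x \<omega> u))" by (rule fm(2))
        show "1 / 2 \<le> (\<integral>\<omega>. ?\<Psi> \<omega> w u * (spike_x \<omega> w * spike_x \<omega> u) \<partial>?M)" by (rule fm(3))
      qed (use sec[OF w] in auto)
    qed
    then show "let M = ?M; \<Psi> = ?\<Psi>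
       in (\<forall>u<n. \<forall>v<n. u \<noteq> v \<longrightarrow>
             integrable M (\<lambda>\<omega>. (\<Psi> \<omega> u v)\<^sup>2) \<and> (\<integral>\<omega>. (\<Psi> \<omega> u v)\<^sup>2 \<partial>M) \<le> R \<and>
             integrable M (\<lambda>\<omega>. (\<Psi> \<omega> u v)\<^sup>2 * (spike_x \<omega> u)\<^sup>2 * (spike_x \<omega> v)\<^sup>2) \<and>
             (\<integral>\<omega>. (\<Psi> \<omega> u v)\<^sup>2 * (spike_x \<omega> u)\<^sup>2 * (spike_x \<omega> v)\<^sup>2 \<partial>M) \<le> R) \<and>
          (n \<ge> max 2 n1 \<longrightarrow> (\<forall>w<n.
             (\<integral>\<omega>. overlap n (xhat lam mu rho l n N R (obs_X lam n \<omega>) (obs_Y mu n \<omega>) w)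
                   (spike_x \<omega>) \<partial>M) \<ge> c))"
      unfolding Let_def using sec by (simp add: mult.assoc)
  qed
qed

end
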